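(* Let $\varepsilon>0$. Then there exists a constant $\delta=\delta(\varepsilon)>0$ such that for all sufficiently large primes $p$ the following holds. If $\omega\in\mathbb{F}_{p^3}\setminus\mathbb{F}_p$ and $I,J\subset\mathbb{F}_p$ are intervals of length at least $p^{3/8+\varepsilon}$, then for every nontrivial multiplicative character $\chi$ of $\mathbb{F}_{p^3}$, \[ \left|\sum_{x\in I}\sum_{y\in J}\chi(x+\omega y)\right| < p^{-\delta(\varepsilon)}\,|I|\,|J|. \]
   Context: An interval is a set of consecutive integers $\{n\in\mathbb{Z}: a\le n\le b\}$, viewed inside $\mathbb{F}_p$ via reduction mod $p$. A multiplicative character $\chi$ of $\mathbb{F}_{p^3}$ is a homomorphism $\mathbb{F}_{p^3}^*\to\mathbb{C}^*$, extended by $\chi(0)=0$. The constant $\delta$ does not depend on $\omega$, $I$, $J$ or $\chi$. *)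

theory Defs
  imports
    "HOL-Algebra.Multiplicative_Group"
    "HOL-Computational_Algebra.Primes"
begin

text \<open>
  Finite fields are objects of the locale \<^locale>\<open>field\<close> rather than types, since the field
  varies with the prime inside the statement. For \<open>K\<close> of order \<open>p ^ 3\<close>, the subfield \<open>F_p\<close> is the
  image of the integers under the canonical map \<open>n \<mapsto> n \<cdot> 1\<close>, which is reduction modulo \<open>p\<close>.
\<close>

definition of_int_in :: "('a, 'b) ring_scheme \<Rightarrow> int \<Rightarrow> 'a" where
  "of_int_in K n = [n] \<cdot>\<^bsub>K\<^esub> \<one>\<^bsub>K\<^esub>"

definition prime_subfield :: "('a, 'b) ring_scheme \<Rightarrow> 'a set" where
  "prime_subfield K = range (of_int_in K)"

text \<open>
  The endpoints are arbitrary integers, so an interval may wrap around zero; if it has at least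
  \<open>p\<close> integer points, it is all of \<open>F_p\<close>.
\<close>

definition is_interval_in :: "('a, 'b) ring_scheme \<Rightarrow> 'a set \<Rightarrow> bool" where
  "is_interval_in K I \<longleftrightarrow> (\<exists>a b :: int. I = of_int_in K ` {a..b})"

definition complex_mult_group :: "complex monoid" where
  "complex_mult_group = \<lparr>carrier = UNIV - {0}, monoid.mult = (*), one = 1\<rparr>"

definition mult_character :: "('a, 'b) ring_scheme \<Rightarrow> ('a \<Rightarrow> complex) \<Rightarrow> bool" where
  "mult_character K \<chi> \<longleftrightarrow> \<chi> \<in> hom (mult_of K) complex_mult_group \<and> \<chi> \<zero>\<^bsub>K\<^esub> = 0"

definition nontrivial_character :: "('a, 'b) ring_scheme \<Rightarrow> ('a \<Rightarrow> complex) \<Rightarrow> bool" where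
  "nontrivial_character K \<chi> \<longleftrightarrow> (\<exists>x \<in> carrier (mult_of K). \<chi> x \<noteq> 1)"

end

theory Submission
  imports "HOL-Algebra.Algebraic_Closure_Type" "HOL-Computational_Algebra.Fundamental_Theorem_Algebra"
    "HOL-Real_Asymp.Real_Asymp" Defs
begin

text \<open>
  Burgess's method. Shifting the box by \<open>t s\<close>, with \<open>t\<close> a small integer and \<open>s = a + \<omega> b\<close> for coprime
  \<open>a\<close>, \<open>b\<close> in a slightly smaller box, and writing \<open>\<chi>(z + t s) = \<chi>(s) \<chi>(z/s + t)\<close>, Hoelder's inequality
  reduces the claim to the second moment of the number of representations \<open>u = z/s\<close> and to a high moment
  of the sums \<open>\<Sum>\<^sub>t \<chi>(u + t)\<close> over all \<open>u\<close> in the field.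

  As \<open>1\<close>, \<open>\<omega>\<close>, \<open>\<omega>\<^sup>2\<close> are independent over the prime field, \<open>z s' = z' s\<close> is an identity between products
  of linear forms, and unique factorization leaves only \<open>(z, s) = (z', s')\<close> or \<open>z = l s\<close>, \<open>z' = l s'\<close> with \<open>l\<close> in
  the prime field. So the second moment is of the size of the square of the box, which is where the
  exponent \<open>3/8\<close> comes from.

  The high moment needs Weil's bound for \<open>\<Sum>\<^sub>u \<chi>(f(u))\<close> with \<open>f\<close> a product of linear polynomials, one of
  them occurring exactly once. The sums \<open>S\<^sub>n\<close> of \<open>\<chi>\<close> composed with norms over the extensions of degree \<open>n\<close> are
  (up to sign) the power sums of the reciprocal roots of a polynomial L-function, and
  a short Stepanov argument gives \<open>S\<^sub>n = O(q\<^sup>n\<^sup>/\<^sup>2)\<close> for even \<open>n\<close> with a constant that may depend on \<open>q\<close>.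
  Hence these roots are at most \<open>\<surd>q\<close> in modulus, whatever the order of \<open>\<chi>\<close>.
\<close>

section \<open>Finite subfields of an algebraically closed field\<close>

text \<open>Stepanov's method counts points over the extension of degree \<open>2 * n\<close>, where
  the \<open>q ^ n\<close>-power map is an involution; this is why only even degrees are controlled.
  It bounds the fibres of the norm of \<open>f\<close> over nonzero values from above, and the known
  total turns this into a two-sided estimate of the character sum. Odd degrees disappear by
  multiplying the L-function at \<open>z\<close> with the one at \<open>- z\<close>: the logarithmic
  derivative keeps only even terms, and no zero is lost. A constant depending on \<open>q\<close>
  does no harm, since only a radius of convergence matters. The exponent comes from weighing the
  factors: with \<open>H\<close> close to the side \<open>L\<close>, the energy factor
  \<open>M ^ 4\<close> nearly cancels against \<open>H ^ 4\<close>, and there is a saving once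
  \<open>(L * L) ^ 2\<close> exceeds \<open>sqrt (p ^ 3)\<close> by a power of \<open>p\<close>. The
  energy bound compares residues as integers and so needs \<open>2 * H * M < p\<close>; hence
  \<open>\<epsilon>\<close> is capped at \<open>1 / 16\<close> and longer intervals are cut into
  pieces.\<close>

lemma proots_linear_factors: "proots (\<Prod>x\<in>#A. [:-x, 1:]) = (A :: 'a :: idom multiset)"
proof (induction A)
  case (add a A)
  have "(\<Prod>x\<in>#A. [:-x, 1:]) \<noteq> 0" by (auto simp: prod_mset_zero_iff)
  thus ?case using add by (simp add: proots_mult del: mult_pCons_left)
qed simp

text \<open>All extensions of the subfield live inside one algebraically closed type, as fixed sets
  of powers of Frobenius, so that the degree \<open>n\<close> of \<open>Fn n\<close> can
  vary.\<close>

locale finite_subfield =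
  fixes q e :: nat and F :: "'c :: alg_closed_field set"
  assumes prime_CHAR: "prime CHAR('c)" and e_pos: "e > 0" and q_eq: "q = CHAR('c) ^ e"
    and F_eq: "F = {x. x ^ q = x}"
begin

lemma q_gt_1: "q > 1"
  using prime_CHAR e_pos unfolding q_eq by (metis one_less_power prime_gt_1_nat)

lemma q_pow_gt_1: "n > 0 \<Longrightarrow> q ^ n > 1"
  using q_gt_1 by (metis one_less_power)

lemma q_pow_CHAR: "q ^ n = CHAR('c) ^ (e * n)"
  by (simp add: q_eq power_mult)

lemma frob_add: "(x + y :: 'c) ^ (q ^ n) = x ^ (q ^ n) + y ^ (q ^ n)"
  by (rule freshmans_dream'[OF prime_CHAR q_pow_CHAR])

lemma frob_sum: "(sum f A :: 'c) ^ (q ^ n) = (\<Sum>i\<in>A. f i ^ (q ^ n))"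
  by (rule freshmans_dream_sum'[OF prime_CHAR q_pow_CHAR])

lemma frob_0 [simp]: "(0 :: 'c) ^ (q ^ n) = 0"
  using q_gt_1 by (simp add: power_0_left)

lemma frob_minus: "(- x :: 'c) ^ (q ^ n) = - (x ^ (q ^ n))"
  using frob_add[of x "- x" n] by (simp add: add_eq_0_iff2 add_eq_0_iff)

lemma frob_diff: "(x - y :: 'c) ^ (q ^ n) = x ^ (q ^ n) - y ^ (q ^ n)"
  using frob_add[of x "- y" n] by (simp add: frob_minus)

lemma frob_inj: "(x :: 'c) ^ (q ^ n) = y ^ (q ^ n) \<Longrightarrow> x = y"
  using frob_diff[of x y n] by (metis eq_iff_diff_eq_0 power_eq_0_iff)

lemma F_iff: "x \<in> F \<longleftrightarrow> x ^ q = x"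
  by (simp add: F_eq)

lemma F_pow: "x \<in> F \<Longrightarrow> x ^ (q ^ n) = x"
  by (induction n) (simp_all add: F_iff power_mult)

lemma F_closed [simp]: "0 \<in> F" "1 \<in> F" "x \<in> F \<Longrightarrow> y \<in> F \<Longrightarrow> x + y \<in> F"
    "x \<in> F \<Longrightarrow> y \<in> F \<Longrightarrow> x * y \<in> F" "x \<in> F \<Longrightarrow> - x \<in> F"
    "x \<in> F \<Longrightarrow> y \<in> F \<Longrightarrow> x - y \<in> F" "x \<in> F \<Longrightarrow> x ^ n \<in> F" "x \<in> F \<Longrightarrow> inverse x \<in> F"
  using frob_add[of x y 1] frob_minus[of x 1] frob_diff[of x y 1] frob_0[of 1]
  by (auto simp: F_iff power_mult_distrib power_inverse simp flip: power_mult)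
    (metis mult.commute power_mult)

lemma F_prod: "(\<And>i. i \<in> A \<Longrightarrow> f i \<in> F) \<Longrightarrow> prod f A \<in> F"
  by (induction A rule: infinite_finite_induct) auto

lemma F_sum: "(\<And>i. i \<in> A \<Longrightarrow> f i \<in> F) \<Longrightarrow> sum f A \<in> F"
  by (induction A rule: infinite_finite_induct) auto

definition Fn :: "nat \<Rightarrow> 'c set" where "Fn n = {x. x ^ (q ^ n) = x}"

lemma Fn_1: "Fn 1 = F"
  by (simp add: Fn_def F_eq)

text \<open>The derivative of the defining polynomial is \<open>-1\<close>, so its roots are simple,
  and algebraic closedness supplies as many as the degree.\<close>

lemma card_Fn:
  assumes "n > 0"
  shows "finite (Fn n)" "card (Fn n) = q ^ n"
proof -
  let ?Q = "q ^ n"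
  define p :: "'c poly" where "p = monom 1 ?Q + [:0, -1:]"
  have Q: "?Q > 1" using q_pow_gt_1[OF assms] .
  have deg: "degree p = ?Q"
    unfolding p_def by (subst degree_add_eq_left) (use Q in \<open>auto simp: degree_monom_eq\<close>)
  have p0: "p \<noteq> 0" using deg assms q_gt_1 by auto
  have roots: "{x. poly p x = 0} = Fn n"
    by (auto simp: p_def Fn_def poly_monom)
  have "of_nat ?Q = (0 :: 'c)"
    using e_pos assms by (simp add: q_eq power_0_left)
  hence pd: "pderiv p = -1"
    by (simp add: p_def pderiv_add pderiv_monom pderiv_pCons one_pCons)
  have ord: "order x p = 1" if "poly p x = 0" for x
  proof -
    have "\<not> [:-x, 1:] ^ 2 dvd p"
    proof
      assume "[:-x, 1:] ^ 2 dvd p"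
      then obtain r where r: "p = [:-x, 1:] ^ 2 * r" by (elim dvdE)
      define l where "l = [:-x, 1:]"
      have "p = l * (l * r)" by (simp only: r l_def power2_eq_square mult.assoc)
      moreover have "poly l x = 0" by (simp add: l_def)
      ultimately have "poly (pderiv p) x = 0" by (simp add: pderiv_mult)
      thus False by (simp add: pd)
    qed
    hence "order x p < 2" using p0 by (simp add: order_divides not_le)
    moreover have "order x p \<noteq> 0" using that p0 order_root by blast
    ultimately show ?thesis by simp
  qed
  obtain A where A: "size A = degree p" "p = smult (lead_coeff p) (\<Prod>x\<in>#A. [:-x, 1:])"
    using alg_closed_imp_factorization[OF p0] by blast
  have "proots p = A"
    using p0 by (subst A(2)) (simp add: proots_linear_factors)
  hence "size (proots p) = ?Q" using A deg by simp
  moreover have "size (proots p) = (\<Sum>x\<in>Fn n. 1)"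
    using p0 by (subst size_multiset_overloaded_eq) (auto simp: roots[symmetric] ord intro!: sum.cong)
  ultimately show "card (Fn n) = q ^ n" by simp
  with Q show "finite (Fn n)" by (metis card.infinite not_less_zero)
qed

lemma finite_F: "finite F" and card_F: "card F = q"
  using card_Fn[of 1] unfolding Fn_1 by simp_all

subsection \<open>Polynomials over the subfield\<close>

definition FP :: "'c poly set" where "FP = {g. \<forall>i. coeff g i \<in> F}"

lemma FP_closed [simp]: "0 \<in> FP" "1 \<in> FP" "g \<in> FP \<Longrightarrow> h \<in> FP \<Longrightarrow> g + h \<in> FP"
    "g \<in> FP \<Longrightarrow> h \<in> FP \<Longrightarrow> g - h \<in> FP" "g \<in> FP \<Longrightarrow> - g \<in> FP"
    "c \<in> F \<Longrightarrow> g \<in> FP \<Longrightarrow> smult c g \<in> FP"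
    "g \<in> FP \<Longrightarrow> h \<in> FP \<Longrightarrow> g * h \<in> FP" "pCons c g \<in> FP \<longleftrightarrow> c \<in> F \<and> g \<in> FP"
  by (auto simp: FP_def coeff_mult coeff_pCons one_pCons split: nat.splits intro!: F_sum)

lemma FP_power [simp]: "g \<in> FP \<Longrightarrow> g ^ n \<in> FP"
  by (induction n) auto

lemma FP_sum: "(\<And>i. i \<in> A \<Longrightarrow> f i \<in> FP) \<Longrightarrow> sum f A \<in> FP"
  by (induction A rule: infinite_finite_induct) auto

lemma FP_prod: "(\<And>i. i \<in> A \<Longrightarrow> f i \<in> FP) \<Longrightarrow> prod f A \<in> FP"
  by (induction A rule: infinite_finite_induct) auto

lemma FP_monom: "c \<in> F \<Longrightarrow> monom c n \<in> FP"
  by (auto simp: FP_def)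

lemma FP_pcompose: "g \<in> FP \<Longrightarrow> h \<in> FP \<Longrightarrow> pcompose g h \<in> FP"
  by (induction g) (auto simp: pcompose_pCons)

lemma poly_F: "g \<in> FP \<Longrightarrow> x \<in> F \<Longrightarrow> poly g x \<in> F"
  by (induction g) auto

lemma poly_frob: "g \<in> FP \<Longrightarrow> poly g (x ^ (q ^ n)) = poly g x ^ (q ^ n)"
  by (induction g) (auto simp: frob_add power_mult_distrib F_pow)

text \<open>Coefficientwise Frobenius. It is multiplicative and fixes exactly the polynomials in
  \<open>FP\<close>, so rationality over the subfield becomes an invariance check.\<close>

definition \<sigma> :: "'c poly \<Rightarrow> 'c poly" where "\<sigma> = map_poly (\<lambda>x. x ^ q)"

lemma coeff_\<sigma>: "coeff (\<sigma> g) i = coeff g i ^ q"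
  using q_gt_1 by (simp add: \<sigma>_def coeff_map_poly)

lemma \<sigma>_mult: "\<sigma> (g * h) = \<sigma> g * \<sigma> h"
proof (rule poly_eqI)
  fix i show "coeff (\<sigma> (g * h)) i = coeff (\<sigma> g * \<sigma> h) i"
    using frob_sum[of "\<lambda>j. coeff g j * coeff h (i - j)" "{..i}" 1]
    by (simp add: coeff_\<sigma> coeff_mult power_mult_distrib)
qed

lemma \<sigma>_1: "\<sigma> 1 = 1"
  using q_gt_1 by (intro poly_eqI) (auto simp: coeff_\<sigma> one_pCons coeff_pCons split: nat.splits)

lemma \<sigma>_power: "\<sigma> (g ^ n) = \<sigma> g ^ n"
  by (induction n) (auto simp: \<sigma>_mult \<sigma>_1)

lemma \<sigma>_prod: "\<sigma> (prod f A) = (\<Prod>i\<in>A. \<sigma> (f i))"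
  by (induction A rule: infinite_finite_induct) (auto simp: \<sigma>_mult \<sigma>_1)

lemma \<sigma>_linear: "\<sigma> [:- a, 1:] = [:- (a ^ q), 1:]"
  using q_gt_1 frob_minus[of a 1] by (intro poly_eqI) (auto simp: coeff_\<sigma> coeff_pCons split: nat.splits)

lemma FP_iff_\<sigma>: "g \<in> FP \<longleftrightarrow> \<sigma> g = g"
  by (auto simp: FP_def poly_eq_iff coeff_\<sigma> F_iff)

lemma FP_cancel:
  assumes "g * h \<in> FP" "g \<in> FP" "g \<noteq> 0"
  shows "h \<in> FP"
proof -
  have "g * \<sigma> h = g * h" using assms by (simp add: FP_iff_\<sigma> \<sigma>_mult)
  thus ?thesis using assms(3) by (simp add: FP_iff_\<sigma>)
qed

lemma order_frob_le: "g \<in> FP \<Longrightarrow> g \<noteq> 0 \<Longrightarrow> order x g \<le> order (x ^ q) g"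
proof -
  assume g: "g \<in> FP" "g \<noteq> 0"
  obtain h where h: "g = [:- x, 1:] ^ order x g * h" using order_1 dvdE by blast
  have "g = \<sigma> g" using g by (simp add: FP_iff_\<sigma>)
  also have "\<dots> = [:- (x ^ q), 1:] ^ order x g * \<sigma> h" by (subst h) (simp add: \<sigma>_mult \<sigma>_power \<sigma>_linear)
  finally have "[:- (x ^ q), 1:] ^ order x g dvd g" by (metis dvd_triv_left)
  thus ?thesis using g by (simp add: order_divides)
qed

lemma order_frob_le': "g \<in> FP \<Longrightarrow> g \<noteq> 0 \<Longrightarrow> order x g \<le> order (x ^ (q ^ n)) g"
proof (induction n)
  case (Suc n)
  have "order (x ^ (q ^ n)) g \<le> order ((x ^ (q ^ n)) ^ q) g" using Suc.prems by (rule order_frob_le)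
  thus ?case using Suc by (simp add: mult.commute flip: power_mult)
qed simp

section \<open>Stepanov's method\<close>

text \<open>The exponent of the norm from \<open>Fn n\<close> to \<open>F\<close>: the product of
  the conjugates \<open>y ^ (q ^ i)\<close> is \<open>y ^ sg n\<close>.\<close>

definition sg :: "nat \<Rightarrow> nat" where "sg n = (\<Sum>i<n. q ^ i)"

lemma sg_eq: "(q - 1) * sg n + 1 = q ^ n"
proof (induction n)
  case (Suc n)
  obtain r where r: "q = Suc r" using q_gt_1 by (cases q) auto
  have "sg (Suc n) = sg n + q ^ n" by (simp add: sg_def)
  thus ?case using Suc by (simp add: r algebra_simps)
qed (simp add: sg_def)

lemma sg_add: "sg (m + n) = sg m + q ^ m * sg n"
  by (induction n) (simp_all add: sg_def power_add algebra_simps)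

end

text \<open>The term of least order at \<open>a\<close> is the only one not divisible by the next
  power of \<open>[:-a, 1:]\<close>.\<close>

lemma sum_neq_0_distinct_orders:
  fixes f :: "'i \<Rightarrow> 'a :: idom poly"
  assumes "finite A" "A \<noteq> {}" "\<And>i. i \<in> A \<Longrightarrow> f i \<noteq> 0" "inj_on (\<lambda>i. order a (f i)) A"
  shows "sum f A \<noteq> 0"
proof
  assume s: "sum f A = 0"
  obtain k where k: "k \<in> A" "\<And>i. i \<in> A \<Longrightarrow> order a (f k) \<le> order a (f i)"
    using assms(2) ex_has_least_nat[of "\<lambda>i. i \<in> A" _ "\<lambda>i. order a (f i)"] by blast
  have "[:-a, 1:] ^ Suc (order a (f k)) dvd sum f (A - {k})"
  proof (rule dvd_sum)
    fix i assume i: "i \<in> A - {k}"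
    hence "order a (f i) \<noteq> order a (f k)" using assms(4) k(1) by (auto simp: inj_on_def)
    with k(2)[of i] i show "[:-a, 1:] ^ Suc (order a (f k)) dvd f i"
      unfolding order_divides by auto
  qed
  moreover have "f k = - sum f (A - {k})"
    using s assms(1) k(1) by (simp add: sum.remove[of A k] add_eq_0_iff2)
  ultimately have "[:-a, 1:] ^ Suc (order a (f k)) dvd f k" by simp
  thus False using assms(3)[OF k(1)] order by blast
qed

context finite_subfield
begin

text \<open>Bounding coefficients instead of the degree makes \<open>FPd 0\<close> the zero
  polynomial alone, so the count \<open>q ^ d\<close> holds for every \<open>d\<close>.\<close>

definition FPd :: "nat \<Rightarrow> 'c poly set" where "FPd d = {g \<in> FP. \<forall>i\<ge>d. coeff g i = 0}"

lemma FPd_iff: "d > 0 \<Longrightarrow> g \<in> FPd d \<longleftrightarrow> g \<in> FP \<and> degree g < d"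
  by (auto simp: FPd_def coeff_eq_0 intro: degree_lessI)

lemma card_FPd: "finite (FPd d)" "card (FPd d) = q ^ d"
proof -
  have "bij_betw (\<lambda>c. \<Sum>i<d. monom (c i) i) (PiE {..<d} (\<lambda>_. F)) (FPd d)"
  proof (rule bij_betw_byWitness[of _ "\<lambda>g. \<lambda>i\<in>{..<d}. coeff g i"])
    have co: "coeff (\<Sum>i<d. monom (c i) i) j = (if j < d then c j else 0)" for c :: "nat \<Rightarrow> 'c" and j
      by (simp add: coeff_sum)
    show "\<forall>c\<in>PiE {..<d} (\<lambda>_. F). (\<lambda>i\<in>{..<d}. coeff (\<Sum>i<d. monom (c i) i) i) = c"
      by (auto simp: co fun_eq_iff PiE_def extensional_def restrict_def)
    show "\<forall>g\<in>FPd d. (\<Sum>i<d. monom ((\<lambda>i\<in>{..<d}. coeff g i) i) i) = g"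
      by (auto simp: co poly_eq_iff FPd_def)
    show "(\<lambda>c. \<Sum>i<d. monom (c i) i) ` (PiE {..<d} (\<lambda>_. F)) \<subseteq> FPd d"
    proof (rule image_subsetI)
      fix c assume c: "c \<in> PiE {..<d} (\<lambda>_. F)"
      hence "c i \<in> F" if "i < d" for i using that by (auto simp: PiE_def Pi_def)
      thus "(\<Sum>i<d. monom (c i) i) \<in> FPd d" by (simp add: FPd_def FP_def co)
    qed
    show "(\<lambda>g. \<lambda>i\<in>{..<d}. coeff g i) ` FPd d \<subseteq> PiE {..<d} (\<lambda>_. F)"
      by (auto simp: FPd_def FP_def simp del: restrict_apply intro!: restrict_PiE_iff[THEN iffD2])
  qed
  moreover have "card (PiE {..<d} (\<lambda>_. F)) = q ^ d"
    by (simp add: card_PiE card_F)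
  moreover have "finite (PiE {..<d} (\<lambda>_. F))"
    by (intro finite_PiE) (auto simp: finite_F)
  ultimately show "finite (FPd d)" "card (FPd d) = q ^ d"
    by (auto simp: bij_betw_finite bij_betw_same_card[symmetric])
qed

text \<open>
  The auxiliary polynomial \<open>G\<close> is built from \<open>w\<close>-th powers in disguise: since \<open>\<rho>(x)^w = \<rho>(x^w)\<close> for \<open>\<rho>\<close> over
  the subfield, \<open>G^w\<close> agrees on the points to be counted with a polynomial \<open>E\<close> of small degree whose
  coefficients depend linearly on those of \<open>G\<close>. Hence \<open>E = 0\<close> can be forced by pigeonhole, while
  \<open>G \<noteq> 0\<close> because its terms have distinct orders at the simple root \<open>a\<close> of \<open>f\<close>.
\<close>
lemma stepanov_count:
  assumes f: "f \<in> FP" "f \<noteq> 0" "a \<in> F" "order a f = 1" and c: "c \<in> F" "c \<noteq> 0"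
    and n: "n > 0" and J: "J > 0"
    and big: "sg n * q ^ n + J + sg n * (q - 1) * degree f \<le> (q - 1) * J * sg n"
  shows "card {x \<in> Fn (2 * n). poly f x ^ sg (2 * n) = c} \<le> (J + degree f) * q ^ n"
proof -
  define w m s where "w = q ^ n" and "m = q - 1" and "s = sg n"
  define D where "D = degree f"
  have ms: "m * s + 1 = w" using sg_eq[of n] by (simp add: w_def m_def s_def)
  have m0: "m > 0" using q_gt_1 by (simp add: m_def)
  have w1: "w > 1" using q_pow_gt_1[OF n] by (simp add: w_def)
  have s0: "s > 0" using ms w1 by (cases s) auto
  define IJ where "IJ = {..<m} \<times> {..<J}"
  define R where "R = PiE IJ (\<lambda>_. FPd s)"
  define d where "d = s * w + J + s * m * D"
  have big': "d \<le> m * J * s"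
    using big by (simp add: d_def s_def w_def m_def D_def mult_ac)
  define G where "G = (\<lambda>r. \<Sum>(i,j)\<in>IJ. r (i,j) * [:-a, 1:] ^ (j * w) * f ^ (i * s))"
  \<comment> \<open>\<open>E r\<close> is \<open>f ^ (s * (m - 1))\<close> times
    \<open>G r ^ w\<close>, rewritten on the fibre. There \<open>f ^ (s + w * s)\<close> has the
    value \<open>c\<close>, so the factor \<open>f ^ (i * s * w)\<close> trades for
    \<open>c ^ i\<close> and leaves the exponent \<open>s * (m - 1 - i)\<close>; the exponent
    \<open>j * w * w\<close> of \<open>[:-a, 1:]\<close> drops to \<open>j\<close>.\<close>
  define E where "E = (\<lambda>r. \<Sum>(i,j)\<in>IJ. pcompose (r (i,j)) (monom 1 w) * [:-a, 1:] ^ j *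
                        smult (c ^ i) (f ^ (s * (m - 1 - i))))"
  have finIJ: "finite IJ" by (simp add: IJ_def)
  have cardR: "card R = q ^ (s * (m * J))"
    by (simp add: R_def card_PiE finIJ card_FPd) (simp add: IJ_def power_mult)
  have finR: "finite R" unfolding R_def by (intro finite_PiE finIJ card_FPd)
  \<comment> \<open>One below \<open>d\<close>, so that the pigeonhole comparison with
    \<open>card R\<close>, which is at least \<open>q ^ d\<close>, is strict.\<close>
  have "E r \<in> FPd (d - 1)" if "r \<in> R" for r
  proof -
    have rij: "r ij \<in> FP" "degree (r ij) \<le> s - 1" if "ij \<in> IJ" for ij
    proof -
      have "r ij \<in> FPd s" using that \<open>r \<in> R\<close> unfolding R_def by (rule PiE_mem[rotated])
      thus "r ij \<in> FP" "degree (r ij) \<le> s - 1" unfolding FPd_iff[OF s0] by auto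
    qed
    have EFP: "E r \<in> FP"
      unfolding E_def using rij f c
      by (auto intro!: FP_sum FP_closed FP_pcompose FP_monom simp: case_prod_unfold)
    have "degree (pcompose (r (i,j)) (monom 1 w) * [:-a, 1:] ^ j * smult (c ^ i) (f ^ (s * (m - 1 - i)))) \<le> d - 2"
      if ij: "(i,j) \<in> IJ" for i j
    proof -
      have "degree (pcompose (r (i,j)) (monom 1 w)) \<le> (s - 1) * w"
        using rij(2)[OF ij] degree_pcompose_le[of "r (i,j)" "monom 1 w"]
        by (simp add: degree_monom_eq) (meson le_trans mult_le_mono1)
      moreover have "degree ([:-a, 1:] ^ j) \<le> J - 1"
        using ij by (auto simp: degree_linear_power IJ_def)
      moreover have "degree (smult (c ^ i) (f ^ (s * (m - 1 - i)))) \<le> s * (m - 1) * D"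
      proof -
        have "degree (f ^ (s * (m - 1 - i))) \<le> degree f * (s * (m - 1 - i))" by (rule degree_power_le)
        also have "\<dots> \<le> degree f * (s * (m - 1))" by (intro mult_le_mono) auto
        finally show ?thesis using c by (simp add: D_def mult_ac)
      qed
      ultimately have "degree (pcompose (r (i,j)) (monom 1 w) * [:-a, 1:] ^ j * smult (c ^ i) (f ^ (s * (m - 1 - i))))
          \<le> (s - 1) * w + (J - 1) + s * (m - 1) * D"
        by (meson add_le_mono degree_mult_le le_trans)
      also have "\<dots> \<le> d - 2"
      proof -
        have "(s - 1) * w + w = s * w" using s0 by (cases s) auto
        moreover have "s * (m - 1) * D \<le> s * m * D" by (intro mult_le_mono) auto
        ultimately show ?thesis using w1 J unfolding d_def by linarith
      qed
      finally show ?thesis .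
    qed
    hence "degree (E r) \<le> d - 2"
      unfolding E_def by (intro degree_sum_le finIJ) auto
    moreover have "d \<ge> 2" using w1 s0 J by (cases s) (auto simp: d_def)
    ultimately have "degree (E r) < d - 1 \<or> d = 2 \<and> degree (E r) = 0" by linarith
    moreover have "d > 2" using w1 s0 J by (cases s) (auto simp: d_def)
    ultimately show ?thesis using EFP by (subst FPd_iff) auto
  qed
  hence "E ` R \<subseteq> FPd (d - 1)" by blast
  hence "card (E ` R) \<le> q ^ (d - 1)" using card_mono card_FPd by metis
  also have "d > 0" using J by (simp add: d_def)
  hence "q ^ (d - 1) < q ^ d" using q_gt_1 by simp
  also have "q ^ d \<le> card R"
    unfolding cardR using big' q_gt_1 by (intro power_increasing) (auto simp: mult_ac)
  finally have "\<not> inj_on E R" by (intro pigeonhole)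
  then obtain r1 r2 where r12: "r1 \<in> R" "r2 \<in> R" "E r1 = E r2" "r1 \<noteq> r2" by (auto simp: inj_on_def)
  define r where "r = (\<lambda>ij. r1 ij - r2 ij)"
  have r_FPd: "r ij \<in> FP" "degree (r ij) < s" if "ij \<in> IJ" for ij
  proof -
    have "r1 ij \<in> FPd s" "r2 ij \<in> FPd s"
      using that r12(1,2) PiE_mem[of _ IJ "\<lambda>_. FPd s"] unfolding R_def by blast+
    thus "r ij \<in> FP" "degree (r ij) < s" by (simp_all add: FPd_iff[OF s0] r_def degree_diff_less)
  qed
  have E0: "E r = 0"
    using r12(3) by (simp add: E_def r_def case_prod_unfold pcompose_diff left_diff_distrib sum_subtractf smult_diff_right)
  obtain ij0 where ij0: "ij0 \<in> IJ" "r ij0 \<noteq> 0"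
  proof -
    have "\<exists>ij\<in>IJ. r1 ij \<noteq> r2 ij" using PiE_ext[of r1 IJ _ r2] r12(1,2,4) unfolding R_def by blast
    thus ?thesis using that by (auto simp: r_def)
  qed

  define A where "A = {ij \<in> IJ. r ij \<noteq> 0}"
  define t where "t = (\<lambda>ij. r ij * [:-a, 1:] ^ (snd ij * w) * f ^ (fst ij * s))"
  have G_A: "G r = sum t A"
    unfolding G_def A_def t_def case_prod_unfold by (rule sum.mono_neutral_cong_right) (auto simp: finIJ)
  have t0: "t ij \<noteq> 0" if "ij \<in> A" for ij
    using that f by (simp add: t_def A_def)
  have ord: "order a (t ij) = snd ij * w + (fst ij * s + order a (r ij))" if "ij \<in> A" for ij
  proof -
    have "order a (f ^ k) = k" for k
      using f by (induction k) (simp_all add: order_mult)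
    thus ?thesis using t0[OF that] unfolding t_def by (simp add: order_mult order_power_n_n)
  qed
  have "G r \<noteq> 0"
    unfolding G_A
  proof (rule sum_neq_0_distinct_orders[where a = a])
    \<comment> \<open>The orders are read as mixed-radix numbers: as
      \<open>order a (r ij) < s\<close> and \<open>m * s < w\<close>, division by \<open>w\<close>
      and then by \<open>s\<close> recovers \<open>j\<close> and \<open>i\<close>.\<close>
    show "inj_on (\<lambda>ij. order a (t ij)) A"
    proof (rule inj_onI)
      fix x y assume x: "x \<in> A" and y: "y \<in> A" and "order a (t x) = order a (t y)"
      hence eq: "snd x * w + (fst x * s + order a (r x)) = snd y * w + (fst y * s + order a (r y))"
        by (simp add: ord)
      have bnd: "order a (r z) < s" "fst z * s + order a (r z) < w" if "z \<in> A" for z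
      proof -
        have "order a (r z) \<le> degree (r z)" using that by (intro order_degree) (auto simp: A_def)
        thus o: "order a (r z) < s" using that r_FPd(2)[of z] by (auto simp: A_def)
        have "Suc (fst z) * s \<le> m * s" using that by (intro mult_le_mono) (auto simp: A_def IJ_def)
        with o ms show "fst z * s + order a (r z) < w" by simp
      qed
      have "snd x = snd y"
        using arg_cong[OF eq, of "\<lambda>v. v div w"] bnd[OF x] bnd[OF y] w1 by simp
      with eq have eq2: "fst x * s + order a (r x) = fst y * s + order a (r y)" by simp
      have "fst x = fst y"
        using arg_cong[OF eq2, of "\<lambda>v. v div s"] bnd[OF x] bnd[OF y] s0 by simp
      with \<open>snd x = snd y\<close> show "x = y" by (simp add: prod_eq_iff)
    qed
    have "ij0 \<in> A" using ij0 by (simp add: A_def)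
    thus "A \<noteq> {}" by blast
  qed (use t0 finIJ in \<open>auto simp: A_def\<close>)

  have sub: "{x \<in> Fn (2 * n). poly f x ^ sg (2 * n) = c} \<subseteq> {x. poly (G r) x = 0}"
  proof safe
    fix x assume x: "x \<in> Fn (2 * n)" and fx: "c = poly f x ^ sg (2 * n)"
    define y where "y = poly f x"
    have c_eq: "c = y ^ (s + w * s)"
      by (simp add: fx y_def mult_2 sg_add s_def w_def)
    have y0: "y \<noteq> 0" using c c_eq s0 by auto
    have xw: "(x ^ w) ^ w = x"
      using x by (simp add: Fn_def w_def mult_2 power_add power_mult)
    have "y ^ (s * (m - 1)) * poly (G r) x ^ w = poly (E r) x"
    proof -
      have "poly (G r) x ^ w = (\<Sum>(i,j)\<in>IJ. (poly (r (i,j)) x * (x - a) ^ (j * w) * y ^ (i * s)) ^ w)"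
        using frob_sum[of "\<lambda>(i,j). poly (r (i,j)) x * (x - a) ^ (j * w) * y ^ (i * s)" IJ n]
        by (simp add: G_def poly_sum case_prod_unfold w_def y_def)
      hence "y ^ (s * (m - 1)) * poly (G r) x ^ w =
          (\<Sum>(i,j)\<in>IJ. y ^ (s * (m - 1)) * (poly (r (i,j)) x * (x - a) ^ (j * w) * y ^ (i * s)) ^ w)"
        by (simp add: sum_distrib_left case_prod_unfold)
      also have "\<dots> = (\<Sum>(i,j)\<in>IJ. poly (r (i,j)) (x ^ w) * (x - a) ^ j * (c ^ i * y ^ (s * (m - 1 - i))))"
      proof (intro sum.cong refl, clarify)
        fix i j assume ij: "(i, j) \<in> IJ"
        have 1: "poly (r (i,j)) x ^ w = poly (r (i,j)) (x ^ w)"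
          using poly_frob[OF r_FPd(1)[OF ij]] by (simp add: w_def)
        have "((x - a) ^ w) ^ w = x - a"
          using frob_diff[of x a n] frob_diff[of "x ^ w" "a ^ w" n] xw F_pow[OF f(3), of n] by (simp add: w_def)
        hence 2: "((x - a) ^ (j * w)) ^ w = (x - a) ^ j"
          by (metis mult.commute power_mult)
        have im: "m - 1 = i + (m - 1 - i)" using ij by (auto simp: IJ_def)
        have "s * (m - 1) + i * s * w = (s + w * s) * i + s * (m - 1 - i)"
          by (subst im) (simp add: algebra_simps)
        hence 3: "y ^ (s * (m - 1)) * (y ^ (i * s)) ^ w = c ^ i * y ^ (s * (m - 1 - i))"
          unfolding c_eq by (metis power_add power_mult)
        show "y ^ (s * (m - 1)) * (poly (r (i,j)) x * (x - a) ^ (j * w) * y ^ (i * s)) ^ w =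
            poly (r (i,j)) (x ^ w) * (x - a) ^ j * (c ^ i * y ^ (s * (m - 1 - i)))"
          unfolding power_mult_distrib 1 2 3[symmetric] by (simp only: mult_ac)
      qed
      also have "\<dots> = poly (E r) x"
        by (simp add: E_def poly_sum case_prod_unfold poly_pcompose poly_monom y_def mult_ac)
      finally show ?thesis .
    qed
    thus "poly (G r) x = 0" using y0 E0 w1 by simp
  qed
  have "card {x \<in> Fn (2 * n). poly f x ^ sg (2 * n) = c} \<le> card {x. poly (G r) x = 0}"
    using sub \<open>G r \<noteq> 0\<close> by (intro card_mono poly_roots_finite)
  also have "\<dots> \<le> degree (G r)" using \<open>G r \<noteq> 0\<close> by (rule card_poly_roots_bound)
  also have "\<dots> \<le> (J + D) * w"
    unfolding G_def
  proof (rule degree_sum_le[OF finIJ], clarify)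
    fix i j assume ij: "(i, j) \<in> IJ"
    have 1: "degree (r (i,j)) \<le> w"
    proof -
      have "s \<le> m * s" using m0 by simp
      thus ?thesis using r_FPd(2)[OF ij] ms by linarith
    qed
    have 2: "degree ([:-a, 1:] ^ (j * w)) \<le> (J - 1) * w" using ij by (auto simp: degree_linear_power IJ_def)
    have "degree (f ^ (i * s)) \<le> degree f * (i * s)" by (rule degree_power_le)
    also have "\<dots> \<le> D * (m * s)" unfolding D_def by (intro mult_le_mono) (use ij in \<open>auto simp: IJ_def\<close>)
    also have "\<dots> \<le> D * w" using ms by (intro mult_le_mono) auto
    finally have "degree (r (i,j) * [:-a, 1:] ^ (j * w) * f ^ (i * s)) \<le> w + (J - 1) * w + D * w"
      using 1 2 by (meson add_le_mono degree_mult_le le_trans)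
    also have "\<dots> = (J + D) * w" using J by (cases J) (auto simp: algebra_simps)
    finally show "degree (r (i,j) * [:-a, 1:] ^ (j * w) * f ^ (i * s)) \<le> (J + D) * w" .
  qed
  finally show ?thesis by (simp add: w_def D_def)
qed

lemma stepanov_bound:
  assumes f: "f \<in> FP" "f \<noteq> 0" "a \<in> F" "order a f = 1" and c: "c \<in> F" "c \<noteq> 0"
    and n: "n > 0" and big: "q ^ n > degree f * (q - 1) + 4"
  shows "(q - 1) * card {x \<in> Fn (2 * n). poly f x ^ sg (2 * n) = c} \<le>
    q ^ (2 * n) + (2 * degree f * (q - 1) + q + 1) * q ^ n"
proof -
  define w m s D where "w = q ^ n" and "m = q - 1" and "s = sg n" and "D = degree f"
  have ms: "m * s + 1 = w" using sg_eq[of n] by (simp add: w_def m_def s_def)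
  have m0: "m > 0" using q_gt_1 by (simp add: m_def)
  have s0: "s > 0" using ms q_pow_gt_1[OF n] by (cases s) (auto simp: w_def)
  have big': "w > D * m + 4" using big by (simp add: w_def m_def D_def)
  \<comment> \<open>This places \<open>m * J\<close> between \<open>w + D * m + 2\<close> and
    \<open>w + D * m + 2 + m\<close>: large enough for the pigeonhole count, small enough that
    \<open>m * (J + D) * w\<close> exceeds \<open>w * w\<close> only by terms linear in
    \<open>w\<close>.\<close>
  define J where "J = (w + D * m + 2) div m + 1"
  have mJ: "m * J = m * ((w + D * m + 2) div m) + m"
    by (simp only: J_def distrib_left mult_1_right)
  have Jlow: "m * J \<ge> w + D * m + 2"
    using mult_div_mod_eq[of m "w + D * m + 2"] mod_less_divisor[OF m0, of "w + D * m + 2"] mJ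
    by linarith
  have Jup: "m * J \<le> w + D * m + 2 + m"
    using mult_div_mod_eq[of m "w + D * m + 2"] mJ by linarith
  have "s * w + J + s * m * D \<le> m * J * s"
  proof -
    obtain v where v: "w = v + 2" using big' by (intro that[of "w - 2"]) simp
    have ms': "m * s = v + 1" using ms v by simp
    have "m * (s * w + s * m * D) \<le> m * (J * v)"
    proof -
      have "m * (s * w + s * m * D) = (v + 1) * (v + 2) + (v + 1) * (m * D)"
        using ms' v by (simp add: distrib_left mult.assoc[symmetric])
      also have "\<dots> \<le> (w + D * m + 2) * v"
        using big' unfolding v by (simp add: algebra_simps)
      also have "\<dots> \<le> m * J * v" using Jlow by (intro mult_le_mono) auto
      finally show ?thesis by (simp add: mult_ac)
    qed
    hence "s * w + s * m * D \<le> J * v" using m0 by simp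
    moreover have "m * J * s = J * v + J" using ms' by (simp add: mult_ac flip: mult.assoc)
    ultimately show ?thesis by linarith
  qed
  hence "card {x \<in> Fn (2 * n). poly f x ^ sg (2 * n) = c} \<le> (J + D) * w"
    using stepanov_count[OF f c n, of J] by (simp add: J_def w_def m_def s_def D_def)
  hence "m * card {x \<in> Fn (2 * n). poly f x ^ sg (2 * n) = c} \<le> m * ((J + D) * w)" by simp
  also have "\<dots> = (m * J + m * D) * w" by (simp add: algebra_simps)
  also have "\<dots> \<le> (w + D * m + 2 + m + m * D) * w" using Jup by (intro mult_le_mono) (simp_all add: mult.commute)
  also have "\<dots> = w * w + (2 * D * m + (m + 2)) * w" by (simp add: algebra_simps)
  also have "w * w = q ^ (2 * n)" by (simp add: w_def mult_2 power_add)
  also have "m + 2 = q + 1" using q_gt_1 by (simp add: m_def)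
  finally show ?thesis by (simp add: w_def m_def D_def mult_ac add.assoc)
qed

end

context finite_subfield
begin

lemma sg_pos: "n > 0 \<Longrightarrow> sg n > 0"
  using sg_eq[of n] q_pow_gt_1[of n] by (cases "sg n") auto

lemma F_norm:
  assumes "y ^ (q ^ n) = y" "n > 0"
  shows "y ^ sg n \<in> F"
proof (cases "y = 0")
  case False
  have "y * y ^ ((q - 1) * sg n) = y * 1"
    using assms(1) sg_eq[of n] by (metis Suc_eq_plus1 mult_1_right power_Suc)
  hence "y ^ ((q - 1) * sg n) = 1" using False by (simp only: mult_cancel_left) auto
  moreover have "q * sg n = sg n + (q - 1) * sg n" using q_gt_1 by (simp add: algebra_simps)
  ultimately show ?thesis by (simp add: F_iff mult.commute[of _ q] power_add flip: power_mult)
qed (use assms sg_pos in \<open>auto simp: power_0_left\<close>)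

end

section \<open>Characters of a finite subfield and their sums over norms\<close>

locale subfield_char = finite_subfield q e F
  for q e :: nat and F :: "'c :: alg_closed_field set" +
  fixes \<chi> :: "'c \<Rightarrow> complex"
  assumes \<chi>_mult: "x \<in> F \<Longrightarrow> y \<in> F \<Longrightarrow> \<chi> (x * y) = \<chi> x * \<chi> y"
    and \<chi>_0 [simp]: "\<chi> 0 = 0" and \<chi>_1 [simp]: "\<chi> 1 = 1"
    and nontriv: "\<exists>x\<in>F. x \<noteq> 0 \<and> \<chi> x \<noteq> 1"
begin

lemma \<chi>_power: "x \<in> F \<Longrightarrow> \<chi> (x ^ n) = \<chi> x ^ n"
  by (induction n) (auto simp: \<chi>_mult)

lemma norm_\<chi>: "x \<in> F \<Longrightarrow> x \<noteq> 0 \<Longrightarrow> norm (\<chi> x) = 1"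
proof -
  assume x: "x \<in> F" "x \<noteq> 0"
  have "x * x ^ (q - 1) = x * 1" using x q_gt_1 by (simp add: F_iff flip: power_Suc)
  hence "x ^ (q - 1) = 1" using x by simp
  hence "\<chi> x ^ (q - 1) = 1" using x by (metis \<chi>_1 \<chi>_power)
  thus ?thesis using power_eq_1_iff q_gt_1 by fastforce
qed

lemma norm_\<chi>_le: "x \<in> F \<Longrightarrow> norm (\<chi> x) \<le> 1"
  using norm_\<chi>[of x] by (cases "x = 0") auto

lemma sum_\<chi>: "(\<Sum>x\<in>F. \<chi> x) = 0"
proof -
  obtain y where y: "y \<in> F" "y \<noteq> 0" "\<chi> y \<noteq> 1" using nontriv by blast
  have "(\<Sum>x\<in>F. \<chi> x) = (\<Sum>x\<in>F. \<chi> (y * x))"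
    by (rule sum.reindex_bij_witness[of _ "\<lambda>x. y * x" "\<lambda>x. inverse y * x"])
      (use y in \<open>auto simp flip: mult.assoc\<close>)
  also have "\<dots> = \<chi> y * (\<Sum>x\<in>F. \<chi> x)"
    using y by (simp add: \<chi>_mult sum_distrib_left)
  finally show ?thesis using y by (simp add: algebra_simps)
qed

lemma sum_\<chi>_affine:
  assumes "y \<in> F" "u \<in> F" "u \<noteq> 0"
  shows "(\<Sum>x\<in>F. \<chi> (y + x * u)) = 0"
proof -
  have "(\<Sum>x\<in>F. \<chi> (y + x * u)) = (\<Sum>x\<in>F. \<chi> x)"
    by (rule sum.reindex_bij_witness[of _ "\<lambda>x. (x - y) * inverse u" "\<lambda>x. y + x * u"]) (use assms in \<open>auto simp: mult.assoc\<close>)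
  thus ?thesis by (simp add: sum_\<chi>)
qed

definition norm_sum :: "'c poly \<Rightarrow> nat \<Rightarrow> complex" where
  "norm_sum f n = (\<Sum>x\<in>Fn n. \<chi> (poly f x ^ sg n))"

text \<open>Fibre counts are bounded only from above. As \<open>\<chi>\<close> sums to
  \<open>0\<close>, the bound \<open>U\<close> may be subtracted from each count; the deficits over
  \<open>c \<noteq> 0\<close> are nonnegative, so the sum of their absolute values follows from the
  total \<open>q ^ (2 * n)\<close>, and the main term cancels.\<close>

lemma norm_sum_le:
  assumes f: "f \<in> FP" "f \<noteq> 0" "a \<in> F" "order a f = 1"
    and n: "n > 0" and big: "q ^ n > degree f * (q - 1) + 4"
  shows "cmod (norm_sum f (2 * n)) \<le> real (2 * degree f * (q - 1) + q + 1 + degree f) * real q ^ n"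
proof -
  define N where "N = (\<lambda>c. card {x \<in> Fn (2 * n). poly f x ^ sg (2 * n) = c})"
  define C where "C = 2 * degree f * (q - 1) + q + 1"
  define U where "U = (real q ^ (2 * n) + real C * real q ^ n) / real (q - 1)"
  have n2: "2 * n > 0" using n by simp
  have q1: "real (q - 1) > 0" using q_gt_1 by simp
  have fin: "finite (Fn (2 * n))" using card_Fn[OF n2] by simp
  have inF: "poly f x ^ sg (2 * n) \<in> F" if "x \<in> Fn (2 * n)" for x
    using that poly_frob[OF f(1), of x "2 * n"] n2 by (intro F_norm) (auto simp: Fn_def)
  have N_le: "real (N c) \<le> U" if "c \<in> F - {0}" for c
  proof -
    have "real ((q - 1) * N c) \<le> real (q ^ (2 * n) + C * q ^ n)"
      unfolding of_nat_le_iff N_def C_def using that by (intro stepanov_bound[OF f _ _ n big]) auto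
    thus ?thesis using q1 by (simp add: U_def field_simps)
  qed
  have tot: "(\<Sum>c\<in>F. N c) = q ^ (2 * n)"
  proof -
    have "(\<Sum>c\<in>F. N c) = card (\<Union>c\<in>F. {x \<in> Fn (2 * n). poly f x ^ sg (2 * n) = c})"
      unfolding N_def by (rule card_UN_disjoint[symmetric]) (use fin finite_F in auto)
    also have "(\<Union>c\<in>F. {x \<in> Fn (2 * n). poly f x ^ sg (2 * n) = c}) = Fn (2 * n)"
      using inF by blast
    finally show ?thesis using card_Fn[OF n2] by simp
  qed
  have N0: "N 0 \<le> degree f"
  proof -
    have "N 0 \<le> card {x. poly f x = 0}"
      unfolding N_def by (intro card_mono poly_roots_finite f) auto
    also have "\<dots> \<le> degree f" by (rule card_poly_roots_bound[OF f(2)])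
    finally show ?thesis .
  qed
  have "norm_sum f (2 * n) = (\<Sum>c\<in>F. \<Sum>x\<in>{x \<in> Fn (2 * n). poly f x ^ sg (2 * n) = c}. \<chi> (poly f x ^ sg (2 * n)))"
    unfolding norm_sum_def by (rule sum.group[symmetric]) (use fin finite_F inF in auto)
  also have "\<dots> = (\<Sum>c\<in>F. of_real (real (N c)) * \<chi> c)"
    by (simp add: N_def)
  also have "\<dots> = (\<Sum>c\<in>F. of_real (real (N c) - U) * \<chi> c)"
    by (simp add: left_diff_distrib sum_subtractf sum_\<chi> flip: sum_distrib_left)
  also have "\<dots> = (\<Sum>c\<in>F - {0}. of_real (real (N c) - U) * \<chi> c)"
    by (rule sum.mono_neutral_right) (use finite_F in auto)
  finally have "cmod (norm_sum f (2 * n)) \<le> (\<Sum>c\<in>F - {0}. cmod (of_real (real (N c) - U) * \<chi> c))"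
    by (simp add: norm_sum)
  also have "\<dots> = (\<Sum>c\<in>F - {0}. U - real (N c))"
  proof (intro sum.cong refl)
    fix c assume "c \<in> F - {0}"
    hence "cmod (\<chi> c) = 1" "real (N c) - U \<le> 0" using N_le norm_\<chi> by auto
    thus "cmod (of_real (real (N c) - U) * \<chi> c) = U - real (N c)"
      unfolding norm_mult norm_of_real by simp
  qed
  also have "\<dots> = real (q - 1) * U - (real (q ^ (2 * n)) - real (N 0))"
  proof -
    have "(\<Sum>c\<in>F. real (N c)) = real (q ^ (2 * n))" unfolding tot[symmetric] by simp
    hence "(\<Sum>c\<in>F - {0}. real (N c)) = real (q ^ (2 * n)) - real (N 0)"
      using finite_F by (simp add: sum_diff1)
    thus ?thesis using finite_F card_F by (simp add: sum_subtractf card_Diff_singleton)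
  qed
  also have "\<dots> \<le> real C * real q ^ n + real (degree f)"
    using q1 N0 by (simp add: U_def)
  also have "real (degree f) \<le> real (degree f) * real q ^ n"
    using q_gt_1 by (simp add: mult_le_cancel_left1)
  finally show ?thesis by (simp add: C_def algebra_simps)
qed

end

section \<open>The L-function of a product of linear factors\<close>

locale split_char_sum = subfield_char q e F \<chi>
  for q e :: nat and F :: "'c :: alg_closed_field set" and \<chi> +
  fixes T :: "'c set" and ex :: "'c \<Rightarrow> nat" and t0 :: 'c
  assumes T: "T \<subseteq> F" and ex_pos: "t \<in> T \<Longrightarrow> ex t > 0" and t0: "t0 \<in> T" "ex t0 = 1"
begin

lemma finite_T: "finite T"
  using T finite_F finite_subset by blast

definition f :: "'c poly" where "f = (\<Prod>t\<in>T. [:t, 1:] ^ ex t)"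

lemma poly_f: "poly f x = (\<Prod>t\<in>T. (t + x) ^ ex t)"
  by (simp add: f_def poly_prod)

lemma f: "f \<in> FP" "f \<noteq> 0" "- t0 \<in> F" "order (- t0) f = 1"
proof -
  show "f \<in> FP" unfolding f_def using T by (intro FP_prod FP_power) auto
  show f0: "f \<noteq> 0" using finite_T by (simp add: f_def)
  show "- t0 \<in> F" using t0 T by auto
  define g where "g = (\<Prod>t\<in>T - {t0}. [:t, 1:] ^ ex t)"
  have fg: "f = [:t0, 1:] * g" unfolding f_def g_def using finite_T t0 by (simp add: prod.remove[of T t0] del: mult_pCons_left)
  have "poly g (- t0) \<noteq> 0" using finite_T by (auto simp: g_def poly_prod)
  hence "order (- t0) g = 0" by (rule order_0I)
  moreover have "order (- t0) [:t0, 1:] = 1" using order_power_n_n[of "- t0" 1] by simp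
  ultimately show "order (- t0) f = 1" using f0 unfolding fg by (simp add: order_mult del: mult_pCons_left)
qed

text \<open>For monic \<open>g\<close>, the resultant with \<open>f\<close>: the product of
  \<open>poly f x\<close> over the roots \<open>x\<close> of \<open>g\<close> with multiplicity. The
  sign turns \<open>poly g (- t)\<close> into the product of the \<open>t + x\<close>.\<close>

definition res :: "'c poly \<Rightarrow> 'c" where
  "res g = (\<Prod>t\<in>T. ((-1) ^ degree g * poly g (- t)) ^ ex t)"

lemma res_mult: "g \<noteq> 0 \<Longrightarrow> h \<noteq> 0 \<Longrightarrow> res (g * h) = res g * res h"
  by (simp add: res_def degree_mult_eq power_add mult_ac flip: prod.distrib power_mult_distrib)

lemma res_1 [simp]: "res 1 = 1"
  by (simp add: res_def)

lemma res_power: "g \<noteq> 0 \<Longrightarrow> res (g ^ n) = res g ^ n"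
  by (induction n) (auto simp: res_mult)

lemma res_F: "g \<in> FP \<Longrightarrow> res g \<in> F"
  unfolding res_def using T by (intro F_prod F_closed poly_F) auto

definition Mon :: "nat \<Rightarrow> 'c poly set" where
  "Mon N = {g \<in> FP. degree g = N \<and> lead_coeff g = 1}"

lemma finite_Mon: "finite (Mon N)"
  by (rule finite_subset[OF _ card_FPd(1)[of "Suc N"]]) (auto simp: Mon_def FPd_def coeff_eq_0)

lemma Mon_nz: "g \<in> Mon N \<Longrightarrow> g \<noteq> 0"
  by (auto simp: Mon_def)

text \<open>The coefficients of the L-function, seen as a Dirichlet series over monic
  polynomials.\<close>

definition c :: "nat \<Rightarrow> complex" where "c N = (\<Sum>g\<in>Mon N. \<chi> (res g))"

lemma c_0: "c 0 = 1"
proof -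
  have "Mon 0 = {1}"
    by (auto simp: Mon_def elim!: degree_eq_zeroE)
  thus ?thesis by (simp add: c_def)
qed

lemma c_1: "c 1 = (\<Sum>a\<in>F. \<chi> (\<Prod>t\<in>T. (t + a) ^ ex t))"
  unfolding c_def
proof (rule sum.reindex_bij_witness[of _ "\<lambda>a. [:-a, 1:]" "\<lambda>g. - coeff g 0"])
  fix g assume g: "g \<in> Mon 1"
  define a where "a = coeff g 0"
  have ab: "g = [:a, 1:]"
    using g by (intro poly_eqI) (auto simp: Mon_def a_def coeff_pCons coeff_eq_0 split: nat.splits)
  show "[:- (- coeff g 0), 1:] = g" "- coeff g 0 \<in> F"
    "\<chi> (\<Prod>t\<in>T. (t + - coeff g 0) ^ ex t) = \<chi> (res g)"
    using g by (auto simp: ab Mon_def res_def F_closed(5) intro!: arg_cong[of _ _ \<chi>] prod.cong)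
qed (auto simp: Mon_def)

text \<open>Multiples \<open>smult a h\<close> of a polynomial vanishing at all \<open>- t\<close>
  except \<open>- t0\<close> are added to \<open>g\<close>. Only the factor of \<open>res\<close> at
  \<open>t0\<close> changes; its exponent is \<open>1\<close>, so it is affine in \<open>a\<close>
  and runs through the whole field, where \<open>\<chi>\<close> sums to \<open>0\<close>. The bound
  on \<open>N\<close> keeps \<open>degree h = card T - 1\<close> below the leading term.\<close>

lemma c_vanish:
  assumes N: "N \<ge> card T"
  shows "c N = 0"
proof -
  define h where "h = (\<Prod>t\<in>T - {t0}. [:t, 1:])"
  define u where "u = (-1) ^ N * poly h (- t0)"
  have hFP: "h \<in> FP" unfolding h_def using T by (intro FP_prod) auto
  have "card T > 0" using t0 finite_T by (auto simp: card_gt_0_iff)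
  moreover have "degree h = card T - 1"
    unfolding h_def using t0 finite_T by (subst degree_prod_eq_sum_degree) auto
  ultimately have degh: "degree h < N" using N by linarith
  have u: "u \<in> F" "u \<noteq> 0"
  proof -
    show "u \<in> F" unfolding u_def using poly_F[OF hFP f(3)] by (intro F_closed(4,7)) auto
    show "u \<noteq> 0" unfolding u_def using finite_T by (auto simp: h_def poly_prod)
  qed
  have sh: "g + smult a h \<in> Mon N" if "g \<in> Mon N" "a \<in> F" for g a
  proof -
    have d: "degree (smult a h) < degree g" using that degh degree_smult_le[of a h] by (simp add: Mon_def)
    hence "degree (g + smult a h) = degree g" by (rule degree_add_eq_left)
    moreover have "coeff (smult a h) (degree g) = 0" using d by (rule coeff_eq_0)
    moreover have "coeff g N = 1" "degree g = N" using that by (auto simp: Mon_def)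
    ultimately have "coeff (g + smult a h) N = 1" "degree (g + smult a h) = N" by simp_all
    thus ?thesis using that hFP by (simp add: Mon_def del: coeff_add)
  qed
  have shift: "c N = (\<Sum>g\<in>Mon N. \<chi> (res (g + smult a h)))" if "a \<in> F" for a
    unfolding c_def
    by (rule sum.reindex_bij_witness[of _ "\<lambda>g. g + smult a h" "\<lambda>g. g + smult (- a) h"])
      (use that sh[of _ a] sh[of _ "- a"] in auto)
  have "of_nat q * c N = (\<Sum>a\<in>F. \<Sum>g\<in>Mon N. \<chi> (res (g + smult a h)))"
  proof -
    have "(\<Sum>a\<in>F. \<Sum>g\<in>Mon N. \<chi> (res (g + smult a h))) = (\<Sum>a\<in>F. c N)"
      by (intro sum.cong refl shift[symmetric])
    thus ?thesis by (simp add: card_F)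
  qed
  also have "\<dots> = (\<Sum>g\<in>Mon N. \<Sum>a\<in>F. \<chi> (res (g + smult a h)))"
    by (rule sum.swap)
  also have "\<dots> = 0"
  proof (rule sum.neutral, rule ballI)
    fix g assume g: "g \<in> Mon N"
    define y where "y = (-1) ^ N * poly g (- t0)"
    define k where "k = (\<Prod>t\<in>T - {t0}. ((-1) ^ N * poly g (- t)) ^ ex t)"
    have yF: "y \<in> F" and kF: "k \<in> F"
      unfolding y_def k_def using g f(3) T by (auto intro!: F_closed F_prod poly_F simp: Mon_def)
    have "res (g + smult a h) = k * (y + a * u)" if a: "a \<in> F" for a
    proof -
      have "poly h (- t) = 0" if "t \<in> T - {t0}" for t
        using that finite_T by (auto simp: h_def poly_prod intro!: prod_zero)
      hence "(\<Prod>t\<in>T - {t0}. ((-1) ^ N * poly (g + smult a h) (- t)) ^ ex t) = k"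
        unfolding k_def by (intro prod.cong) auto
      moreover have "degree (g + smult a h) = N" using sh[OF g a] by (simp add: Mon_def)
      ultimately show ?thesis
        unfolding res_def using finite_T t0
        by (simp add: prod.remove[of T t0] y_def u_def algebra_simps)
    qed
    hence "(\<Sum>a\<in>F. \<chi> (res (g + smult a h))) = (\<Sum>a\<in>F. \<chi> k * \<chi> (y + a * u))"
      using kF yF u by (intro sum.cong) (auto simp: \<chi>_mult)
    also have "\<dots> = 0" using sum_\<chi>_affine[OF yF u] by (simp flip: sum_distrib_left)
    finally show "(\<Sum>a\<in>F. \<chi> (res (g + smult a h))) = 0" .
  qed
  finally show ?thesis using q_gt_1 by simp
qed

section \<open>Conjugates and minimal polynomials\<close>

definition dg :: "'c \<Rightarrow> nat" where "dg x = (LEAST k. k > 0 \<and> x ^ (q ^ k) = x)"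

definition mp :: "'c \<Rightarrow> 'c poly" where "mp x = (\<Prod>i<dg x. [:- (x ^ (q ^ i)), 1:])"

lemma dg:
  assumes "x \<in> Fn n" "n > 0"
  shows "dg x > 0" "x ^ (q ^ dg x) = x" "k > 0 \<Longrightarrow> x ^ (q ^ k) = x \<Longrightarrow> dg x \<le> k"
  using LeastI[of "\<lambda>k. k > 0 \<and> x ^ (q ^ k) = x" n] assms
    Least_le[of "\<lambda>k. k > 0 \<and> x ^ (q ^ k) = x" k] by (auto simp: dg_def Fn_def)

lemma frob_comp: "(x :: 'c) ^ (q ^ (i + j)) = (x ^ (q ^ i)) ^ (q ^ j)"
  by (simp only: power_add power_mult[of x])

lemma frob_mult_period: "(x :: 'c) ^ (q ^ k) = x \<Longrightarrow> x ^ (q ^ (j * k)) = x"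
  by (induction j) (simp_all only: mult_Suc frob_comp mult_0 power_0 power_one_right)

lemma Fn_iff_dvd:
  assumes "x \<in> Fn n" "n > 0"
  shows "x \<in> Fn m \<longleftrightarrow> dg x dvd m"
proof
  assume "dg x dvd m"
  thus "x \<in> Fn m" using frob_mult_period[OF dg(2)[OF assms]] by (auto simp: Fn_def mult.commute elim!: dvdE)
next
  assume m: "x \<in> Fn m"
  have "x ^ (q ^ (m div dg x * dg x + m mod dg x)) = x ^ (q ^ (m mod dg x))"
    using frob_mult_period[OF dg(2)[OF assms], of "m div dg x"] by (simp only: frob_comp)
  hence "x ^ (q ^ (m mod dg x)) = x" using m by (simp only: div_mult_mod_eq Fn_def mem_Collect_eq)
  moreover have "m mod dg x < dg x" using dg(1)[OF assms] by simp
  ultimately have "m mod dg x = 0" using dg(3)[OF assms, of "m mod dg x"] by (cases "m mod dg x = 0") auto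
  thus "dg x dvd m" by auto
qed

lemma inj_conj:
  assumes "x \<in> Fn n" "n > 0"
  shows "inj_on (\<lambda>i. x ^ (q ^ i)) {..<dg x}"
proof (rule linorder_inj_onI')
  fix i j assume ij: "i \<in> {..<dg x}" "j \<in> {..<dg x}" "i < j"
  show "x ^ (q ^ i) \<noteq> x ^ (q ^ j)"
  proof
    assume "x ^ (q ^ i) = x ^ (q ^ j)"
    also have "j = (j - i) + i" using ij by simp
    finally have "x ^ (q ^ i) = (x ^ (q ^ (j - i))) ^ (q ^ i)" by (simp add: power_add power_mult)
    hence "x = x ^ (q ^ (j - i))" by (rule frob_inj)
    thus False using dg(3)[OF assms, of "j - i"] ij by simp
  qed
qed

text \<open>Frobenius moves the index of each factor by one, and the last conjugate returns to the
  first.\<close>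

lemma mp_FP:
  assumes "x \<in> Fn n" "n > 0"
  shows "mp x \<in> FP"
proof -
  define g where "g = (\<lambda>i. [:- (x ^ (q ^ i)), 1:])"
  have "\<sigma> (mp x) = (\<Prod>i<dg x. g (Suc i))"
    by (simp add: mp_def g_def \<sigma>_prod \<sigma>_linear mult.commute flip: power_mult)
  moreover have "g 0 * (\<Prod>i<dg x. g (Suc i)) = (\<Prod>i<dg x. g i) * g (dg x)"
    by (simp only: prod.lessThan_Suc_shift[symmetric] prod.lessThan_Suc)
  moreover have "g (dg x) = g 0" using dg(2)[OF assms] by (simp add: g_def)
  moreover have "g 0 \<noteq> 0" by (simp add: g_def)
  ultimately have "\<sigma> (mp x) = (\<Prod>i<dg x. g i)"
    by (metis mult.commute mult_left_cancel)
  thus ?thesis by (simp add: FP_iff_\<sigma> mp_def g_def)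
qed

lemma mp_monic: "lead_coeff (mp x) = 1" "degree (mp x) = dg x" "mp x \<noteq> 0"
proof -
  show "lead_coeff (mp x) = 1" unfolding mp_def lead_coeff_prod by simp
  show "degree (mp x) = dg x" "mp x \<noteq> 0" by (simp_all add: mp_def degree_prod_eq_sum_degree)
qed

lemma prod_linear_power_dvd:
  fixes g :: "'c poly"
  assumes "finite B" "g \<noteq> 0" "\<And>b. b \<in> B \<Longrightarrow> j \<le> order b g"
  shows "(\<Prod>b\<in>B. [:-b, 1:]) ^ j dvd g"
  using assms(1,3)
proof (induction B)
  case (insert b B)
  then obtain h where h: "g = (\<Prod>b\<in>B. [:-b, 1:]) ^ j * h" by (auto elim!: dvdE)
  have "poly ((\<Prod>b\<in>B. [:-b, 1:]) ^ j) b \<noteq> 0"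
    using insert.hyps by (auto simp: poly_prod)
  hence "order b ((\<Prod>b\<in>B. [:-b, 1:]) ^ j) = 0" by (rule order_0I)
  hence "j \<le> order b h" using insert.prems[of b] assms(2) unfolding h by (simp add: order_mult)
  hence "[:-b, 1:] ^ j dvd h" by (simp add: order_divides)
  thus ?case using insert.hyps unfolding h
    by (simp add: power_mult_distrib mult.commute del: mult_pCons_left mult_pCons_right)
qed simp

text \<open>This lets roots replace a factorization into irreducibles: at every conjugate of
  \<open>x\<close> the order of \<open>g\<close> is at least \<open>order x g\<close>, and distinct
  conjugates contribute coprime factors.\<close>

lemma mp_power_dvd_iff:
  assumes "x \<in> Fn n" "n > 0" "g \<in> FP" "g \<noteq> 0"
  shows "mp x ^ j dvd g \<longleftrightarrow> j \<le> order x g"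
proof
  assume "j \<le> order x g"
  hence "j \<le> order (x ^ (q ^ i)) g" for i
    using order_frob_le'[OF assms(3,4), of x i] by (rule le_trans)
  hence "(\<Prod>b\<in>(\<lambda>i. x ^ (q ^ i)) ` {..<dg x}. [:-b, 1:]) ^ j dvd g"
    by (intro prod_linear_power_dvd assms) auto
  thus "mp x ^ j dvd g"
    by (simp add: mp_def prod.reindex[OF inj_conj[OF assms(1,2)]])
next
  assume "mp x ^ j dvd g"
  moreover have "[:-x, 1:] dvd mp x"
    unfolding mp_def using dg(1)[OF assms(1,2)] dvd_prodI[of "{..<dg x}" 0 "\<lambda>i. [:- (x ^ (q ^ i)), 1:]"] by simp
  ultimately have "[:-x, 1:] ^ j dvd g" by (meson dvd_power_same dvd_trans)
  thus "j \<le> order x g" using assms(4) by (simp add: order_divides)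
qed

lemma res_mp:
  assumes "x \<in> Fn n" "n > 0"
  shows "res (mp x) = poly f x ^ sg (dg x)"
proof -
  have "(-1) ^ dg x * poly (mp x) (- t) = (t + x) ^ sg (dg x)" if "t \<in> T" for t
  proof -
    have "(-1) ^ dg x * poly (mp x) (- t) = (\<Prod>i<dg x. (-1) * (- t - x ^ (q ^ i)))"
      unfolding prod.distrib mp_def poly_prod by (simp add: algebra_simps)
    also have "\<dots> = (\<Prod>i<dg x. (t + x) ^ (q ^ i))"
      using that T by (intro prod.cong) (auto simp: frob_add F_pow)
    finally show ?thesis by (simp add: sg_def power_sum)
  qed
  hence "res (mp x) = (\<Prod>t\<in>T. ((t + x) ^ sg (dg x)) ^ ex t)"
    unfolding res_def mp_monic by (intro prod.cong) simp_all
  also have "\<dots> = (\<Prod>t\<in>T. ((t + x) ^ ex t) ^ sg (dg x))"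
    by (intro prod.cong refl) (simp add: mult.commute flip: power_mult)
  finally show ?thesis by (simp only: prod_power_distrib poly_f)
qed

lemma norm_multiple:
  assumes "(y :: 'c) ^ (q ^ k) = y"
  shows "y ^ sg (j * k) = (y ^ sg k) ^ j"
proof (induction j)
  case (Suc j)
  have "y ^ sg (Suc j * k) = y ^ sg k * (y ^ (q ^ k)) ^ sg (j * k)"
    by (simp only: mult_Suc sg_add power_add power_mult[of y "q ^ k"])
  thus ?case by (simp add: assms Suc)
qed (simp add: sg_def)

lemma \<chi>_res_mp_power:
  assumes "x \<in> Fn n" "n > 0"
  shows "\<chi> (res (mp x ^ j)) = \<chi> (poly f x ^ sg (j * dg x))"
proof -
  have "poly f x ^ (q ^ dg x) = poly f x"
    using poly_frob[OF f(1), of x "dg x"] dg(2)[OF assms] by simp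
  thus ?thesis by (simp add: norm_multiple res_power mp_monic res_mp[OF assms])
qed

section \<open>Newton's identities for the L-function\<close>

lemma sum_multiples:
  assumes x: "x \<in> Fn n" "n > 0"
  shows "(\<Sum>g\<in>{g \<in> Mon N. mp x ^ j dvd g}. \<chi> (res g)) =
    (if j * dg x \<le> N then \<chi> (poly f x ^ sg (j * dg x)) * c (N - j * dg x) else 0)"
proof (cases "j * dg x \<le> N")
  case False
  have "degree (mp x ^ j) = j * dg x" by (simp add: degree_power_eq mp_monic)
  hence e: "{g \<in> Mon N. mp x ^ j dvd g} = {}"
    using False Mon_nz by (auto simp: Mon_def dest!: dvd_imp_degree_le)
  show ?thesis unfolding e using False by simp
next
  case True
  define P where "P = mp x ^ j"
  have "lead_coeff P = 1" by (simp only: P_def lead_coeff_power mp_monic(1) power_one)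
  hence P: "lead_coeff P = 1" "P \<in> FP" "P \<noteq> 0" "degree P = j * dg x"
    using mp_FP[OF x] by (simp_all add: P_def degree_power_eq mp_monic)
  have "(\<Sum>g\<in>{g \<in> Mon N. P dvd g}. \<chi> (res g)) = (\<Sum>h\<in>Mon (N - j * dg x). \<chi> (res (P * h)))"
  proof (rule sum.reindex_bij_witness[of _ "\<lambda>h. P * h" "\<lambda>g. g div P"])
    fix g assume "g \<in> {g \<in> Mon N. P dvd g}"
    then obtain h where h: "g = P * h" "P * h \<in> Mon N" by (auto elim!: dvdE)
    moreover have "h \<noteq> 0" using Mon_nz[OF h(2)] by auto
    moreover have "lead_coeff (P * h) = 1" using h(2) unfolding Mon_def mem_Collect_eq by (elim conjE)
    hence "lead_coeff h = 1" unfolding lead_coeff_mult P(1) by (simp only: mult_1_left)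
    ultimately show "P * (g div P) = g" "g div P \<in> Mon (N - j * dg x)" "\<chi> (res (P * (g div P))) = \<chi> (res g)"
      using P FP_cancel[of P h] by (auto simp: Mon_def degree_mult_eq lead_coeff_mult)
  next
    fix h assume h: "h \<in> Mon (N - j * dg x)"
    have "h \<noteq> 0" using Mon_nz[OF h] .
    have "lead_coeff h = 1" using h unfolding Mon_def mem_Collect_eq by (elim conjE)
    hence "lead_coeff (P * h) = 1" unfolding lead_coeff_mult P(1) by (simp only: mult_1_left)
    moreover have "degree (P * h) = N"
      using \<open>h \<noteq> 0\<close> P h True by (simp add: degree_mult_eq Mon_def)
    moreover have "P * h \<in> FP" using P h by (simp add: Mon_def)
    ultimately have "P * h \<in> Mon N" unfolding Mon_def by blast
    thus "P * h div P = h" "P * h \<in> {g \<in> Mon N. P dvd g}"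
      using P by auto
  qed
  also have "\<dots> = (\<Sum>h\<in>Mon (N - j * dg x). \<chi> (res P) * \<chi> (res h))"
    using P Mon_nz by (intro sum.cong refl) (auto simp: res_mult \<chi>_mult res_F Mon_def)
  also have "\<dots> = \<chi> (res P) * c (N - j * dg x)" by (simp add: c_def sum_distrib_left)
  finally show ?thesis using True \<chi>_res_mp_power[OF x] by (simp add: P_def)
qed

text \<open>The conjugates \<open>x ^ (q ^ i)\<close> are roots as well, so two of the first
  \<open>degree g + 1\<close> coincide, and injectivity of Frobenius removes the common
  power.\<close>

lemma root_in_Fn:
  assumes g: "g \<in> FP" "g \<noteq> 0" and x: "poly g x = 0"
  obtains n where "n \<in> {1..degree g}" "x \<in> Fn n"
proof -
  have "(\<lambda>i. x ^ (q ^ i)) ` {..degree g} \<subseteq> {x. poly g x = 0}"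
    using poly_frob[OF g(1)] x by auto
  hence "card ((\<lambda>i. x ^ (q ^ i)) ` {..degree g}) \<le> card {x. poly g x = 0}"
    by (intro card_mono poly_roots_finite g)
  also have "\<dots> < card {..degree g}" using card_poly_roots_bound[OF g(2)] by simp
  finally have "\<not> inj_on (\<lambda>i. x ^ (q ^ i)) {..degree g}" by (rule pigeonhole)
  then obtain i j where ij: "i < j" "j \<le> degree g" "x ^ (q ^ i) = x ^ (q ^ j)"
    by (meson atMost_iff linorder_inj_onI' linorder_not_le)
  from ij(3) have "x ^ (q ^ i) = x ^ (q ^ ((j - i) + i))" using ij by simp
  also have "\<dots> = (x ^ (q ^ (j - i))) ^ (q ^ i)" by (simp only: power_add power_mult)
  finally have "x = x ^ (q ^ (j - i))" by (rule frob_inj)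
  thus ?thesis using ij by (intro that[of "j - i"]) (auto simp: Fn_def)
qed

lemma sum_order:
  assumes g: "g \<in> Mon N"
  shows "(\<Sum>x\<in>(\<Union>n\<in>{1..N}. Fn n). order x g) = N"
proof -
  have g': "g \<in> FP" "g \<noteq> 0" "degree g = N" using g Mon_nz[OF g] by (auto simp: Mon_def)
  obtain A where A: "size A = degree g" "g = smult (lead_coeff g) (\<Prod>x\<in>#A. [:-x, 1:])"
    using alg_closed_imp_factorization[OF g'(2)] by blast
  have "proots g = A"
    using g'(2) by (subst A(2)) (simp add: proots_linear_factors)
  hence "N = size (proots g)" using A g' by simp
  also have "\<dots> = (\<Sum>x\<in>{x. poly g x = 0}. order x g)"
    using g' by (subst size_multiset_overloaded_eq) auto
  also have "\<dots> = (\<Sum>x\<in>(\<Union>n\<in>{1..N}. Fn n). order x g)"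
  proof (rule sum.mono_neutral_left)
    show "finite (\<Union>n\<in>{1..N}. Fn n)" using card_Fn(1) by auto
    show "{x. poly g x = 0} \<subseteq> (\<Union>n\<in>{1..N}. Fn n)"
      using root_in_Fn[OF g'(1,2)] g'(3) by blast
  qed (use g' in \<open>auto simp: order_root\<close>)
  finally show ?thesis by simp
qed

text \<open>The logarithmic derivative of the Euler product, in coefficients. \<open>N\<close> is
  the sum of the orders of \<open>g\<close> at its roots, and \<open>order x g\<close> counts the
  positive \<open>j\<close> with \<open>mp x ^ j dvd g\<close>. After swapping sums, the multiples
  of \<open>mp x ^ j\<close> contribute a character value times \<open>c (N - j * dg x)\<close>, and
  the indices \<open>n = j * dg x\<close> are exactly those with
  \<open>x \<in> Fn n\<close>.\<close>

lemma newton: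
  "of_nat N * c N = (\<Sum>n\<in>{1..N}. norm_sum f n * c (N - n))"
proof -
  define U where "U = (\<Union>n\<in>{1..N}. Fn n)"
  have finU: "finite U" unfolding U_def using card_Fn(1) by auto
  have xU: "\<exists>n>0. x \<in> Fn n" if "x \<in> U" for x using that by (auto simp: U_def Suc_le_eq)
  have "of_nat N * c N = (\<Sum>g\<in>Mon N. of_nat (\<Sum>x\<in>U. order x g) * \<chi> (res g))"
    using sum_order[of _ N] unfolding c_def sum_distrib_left U_def by (intro sum.cong refl) metis
  also have "\<dots> = (\<Sum>g\<in>Mon N. \<Sum>x\<in>U. \<Sum>j\<in>{1..N}. if mp x ^ j dvd g then \<chi> (res g) else 0)"
  proof (intro sum.cong refl)
    fix g assume g: "g \<in> Mon N"
    have "of_nat (order x g) * \<chi> (res g) = (\<Sum>j\<in>{1..N}. if mp x ^ j dvd g then \<chi> (res g) else 0)" if x: "x \<in> U" for x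
    proof -
      obtain n where n: "n > 0" "x \<in> Fn n" using xU[OF x] by blast
      have gFP: "g \<in> FP" using g by (simp add: Mon_def)
      have "order x g \<le> N" using order_degree[OF Mon_nz[OF g], of x] g by (simp add: Mon_def)
      hence "{j \<in> {1..N}. mp x ^ j dvd g} = {1..order x g}"
        unfolding mp_power_dvd_iff[OF n(2,1) gFP Mon_nz[OF g]] by auto
      hence "(\<Sum>j\<in>{1..N}. if mp x ^ j dvd g then \<chi> (res g) else 0) = (\<Sum>j\<in>{1..order x g}. \<chi> (res g))"
        by (simp only: sum.inter_filter[symmetric] finite_atLeastAtMost)
      thus ?thesis by simp
    qed
    thus "of_nat (\<Sum>x\<in>U. order x g) * \<chi> (res g) = (\<Sum>x\<in>U. \<Sum>j\<in>{1..N}. if mp x ^ j dvd g then \<chi> (res g) else 0)"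
      by (simp add: sum_distrib_right)
  qed
  also have "\<dots> = (\<Sum>x\<in>U. \<Sum>j\<in>{1..N}. \<Sum>g\<in>Mon N. if mp x ^ j dvd g then \<chi> (res g) else 0)"
    by (subst sum.swap, intro sum.cong refl, subst sum.swap) (rule refl)
  also have "\<dots> = (\<Sum>x\<in>U. \<Sum>n\<in>{1..N}. if x \<in> Fn n then \<chi> (poly f x ^ sg n) * c (N - n) else 0)"
  proof (rule sum.cong[OF refl])
    fix x assume "x \<in> U"
    then obtain n where n: "n > 0" "x \<in> Fn n" using xU by blast
    define k where "k = dg x"
    have k: "k > 0" using dg(1)[OF n(2,1)] by (simp add: k_def)
    have "(\<Sum>j\<in>{1..N}. \<Sum>g\<in>Mon N. if mp x ^ j dvd g then \<chi> (res g) else 0) =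
      (\<Sum>j\<in>{1..N}. if j * k \<le> N then \<chi> (poly f x ^ sg (j * k)) * c (N - j * k) else 0)"
      using sum_multiples[OF n(2,1)] finite_Mon by (simp add: sum.If_cases Int_def k_def)
    also have "\<dots> = (\<Sum>j\<in>{j \<in> {1..N}. j * k \<le> N}. \<chi> (poly f x ^ sg (j * k)) * c (N - j * k))"
      by (simp add: sum.If_cases Int_def)
    also have "\<dots> = (\<Sum>n\<in>{n \<in> {1..N}. k dvd n}. \<chi> (poly f x ^ sg n) * c (N - n))"
    proof (rule sum.reindex_bij_witness[of _ "\<lambda>n. n div k" "\<lambda>j. j * k"])
      fix j assume "j \<in> {n \<in> {1..N}. k dvd n}"
      thus "j div k \<in> {j \<in> {1..N}. j * k \<le> N}" using k
        by (auto elim!: dvdE intro: le_trans[OF div_le_dividend])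
    qed (use k in auto)
    also have "\<dots> = (\<Sum>n\<in>{1..N}. if x \<in> Fn n then \<chi> (poly f x ^ sg n) * c (N - n) else 0)"
      using Fn_iff_dvd[OF n(2,1)] by (simp add: sum.If_cases Int_def k_def)
    finally show "(\<Sum>j\<in>{1..N}. \<Sum>g\<in>Mon N. if mp x ^ j dvd g then \<chi> (res g) else 0) =
      (\<Sum>n\<in>{1..N}. if x \<in> Fn n then \<chi> (poly f x ^ sg n) * c (N - n) else 0)" .
  qed
  also have "\<dots> = (\<Sum>n\<in>{1..N}. \<Sum>x\<in>U. if x \<in> Fn n then \<chi> (poly f x ^ sg n) * c (N - n) else 0)"
    by (rule sum.swap)
  also have "\<dots> = (\<Sum>n\<in>{1..N}. norm_sum f n * c (N - n))"
  proof (intro sum.cong refl)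
    fix n assume n: "n \<in> {1..N}"
    have "U \<inter> Fn n = Fn n" using n by (auto simp: U_def)
    thus "(\<Sum>x\<in>U. if x \<in> Fn n then \<chi> (poly f x ^ sg n) * c (N - n) else 0) = norm_sum f n * c (N - n)"
      using finU by (simp add: sum.If_cases norm_sum_def sum_distrib_right)
  qed
  finally show ?thesis .
qed

end

section \<open>Weil's bound\<close>

text \<open>If \<open>B\<close> had a zero in the disc of convergence of \<open>g(z) = \<Sum>\<rho>\<^sub>n z\<^sup>n\<close>, then \<open>z B' = B g\<close> would fail at the leading order there.\<close>
lemma poly_nonzero_of_log_deriv:
  fixes B :: "complex poly" and \<rho> :: "nat \<Rightarrow> complex"
  assumes newton: "\<And>N. of_nat N * coeff B N = (\<Sum>i\<le>N. coeff B i * \<rho> (N - i))"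
    and B0: "coeff B 0 \<noteq> 0" and bound: "\<And>n. norm (\<rho> n) \<le> K * s ^ n" and s: "s > 0" and z: "norm z * s < 1"
  shows "poly B z \<noteq> 0"
proof
  assume root: "poly B z = 0"
  define g where "g = (\<lambda>v. \<Sum>n. \<rho> n * v ^ n)"
  have K: "K \<ge> 0" using bound[of 0] norm_ge_zero[of "\<rho> 0"] by (simp del: norm_ge_zero)
  have B: "B \<noteq> 0" using B0 by auto
  have bnd: "norm (\<rho> n * v ^ n) \<le> K * (norm v * s) ^ n" for v n
    using mult_right_mono[OF bound[of n], of "norm v ^ n"] by (simp add: norm_mult norm_power power_mult_distrib mult_ac)
  have sm: "summable (\<lambda>n. K * (norm v * s) ^ n)" if "norm v * s < 1" for v :: complex
    using that s by (intro summable_mult summable_geometric) simp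
  have smn: "summable (\<lambda>n. norm (\<rho> n * v ^ n))" if "norm v * s < 1" for v
    by (rule summable_comparison_test'[OF sm[OF that], of 0]) (use bnd in simp)
  have g_le: "norm (g v) \<le> K / (1 - norm v * s)" if "norm v * s < 1" for v
  proof -
    have "norm (g v) \<le> (\<Sum>n. norm (\<rho> n * v ^ n))" unfolding g_def by (rule summable_norm[OF smn[OF that]])
    also have "\<dots> \<le> (\<Sum>n. K * (norm v * s) ^ n)" by (intro suminf_le bnd smn sm that)
    also have "\<dots> = K / (1 - norm v * s)"
      using that s by (subst suminf_mult) (auto simp: suminf_geometric mult.commute intro!: summable_geometric)
    finally show ?thesis .
  qed
  have ld: "v * poly (pderiv B) v = poly B v * g v" if v: "norm v * s < 1" for v
  proof -
    have polysum: "(\<lambda>n. coeff p n * v ^ n) sums poly p v" for p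
    proof -
      have "(\<lambda>n. coeff p n * v ^ n) sums (\<Sum>n\<le>degree p. coeff p n * v ^ n)"
        by (rule sums_finite) (auto simp: coeff_eq_0)
      thus ?thesis by (simp add: poly_altdef)
    qed
    have "summable (\<lambda>n. norm (coeff B n * v ^ n))"
      by (rule summable_finite[of "{..degree B}"]) (auto simp: coeff_eq_0)
    from Cauchy_product_sums[OF this smn[OF v]]
    have "(\<lambda>N. \<Sum>i\<le>N. coeff B i * v ^ i * (\<rho> (N - i) * v ^ (N - i))) sums (poly B v * g v)"
      using polysum[of B] by (simp add: g_def sums_iff)
    also have "(\<lambda>N. \<Sum>i\<le>N. coeff B i * v ^ i * (\<rho> (N - i) * v ^ (N - i))) = (\<lambda>N. of_nat N * coeff B N * v ^ N)"
    proof
      fix N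
      have "(\<Sum>i\<le>N. coeff B i * v ^ i * (\<rho> (N - i) * v ^ (N - i))) = (\<Sum>i\<le>N. coeff B i * \<rho> (N - i) * v ^ N)"
      proof (intro sum.cong refl)
        fix i assume "i \<in> {..N}"
        hence "v ^ N = v ^ i * v ^ (N - i)" by (simp flip: power_add)
        thus "coeff B i * v ^ i * (\<rho> (N - i) * v ^ (N - i)) = coeff B i * \<rho> (N - i) * v ^ N" by simp
      qed
      thus "(\<Sum>i\<le>N. coeff B i * v ^ i * (\<rho> (N - i) * v ^ (N - i))) = of_nat N * coeff B N * v ^ N"
        by (simp add: newton flip: sum_distrib_right)
    qed
    also have "\<dots> = (\<lambda>N. coeff ([:0, 1:] * pderiv B) N * v ^ N)"
      by (auto simp: fun_eq_iff coeff_pCons coeff_pderiv split: nat.splits)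
    finally have "(\<lambda>N. coeff ([:0, 1:] * pderiv B) N * v ^ N) sums (poly B v * g v)" .
    with polysum[of "[:0, 1:] * pderiv B"] have "poly ([:0, 1:] * pderiv B) v = poly B v * g v"
      by (rule sums_unique2)
    thus ?thesis by simp
  qed
  have z0: "z \<noteq> 0" using root B0 by (auto simp: poly_0_coeff_0)
  obtain m where m: "order z B = Suc m" using root B by (metis order_root not0_implies_Suc)
  obtain r where r: "B = [:-z, 1:] ^ Suc m * r" "\<not> [:-z, 1:] dvd r"
    using order_decomp[OF B, of z] m by auto
  have rz: "poly r z \<noteq> 0" using r(2) by (simp add: poly_eq_0_iff_dvd)
  \<comment> \<open>\<open>p\<close> is \<open>[:0, 1:] * pderiv B\<close> with the factor
    \<open>[:-z, 1:] ^ m\<close> removed. Its value at \<open>z\<close> is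
    \<open>z * of_nat (Suc m) * poly r z\<close>, which is nonzero, but boundedness of
    \<open>g\<close> near \<open>z\<close> forces it to be \<open>0\<close>.\<close>
  define p where "p = [:0, 1:] * (smult (of_nat (Suc m)) r + [:-z, 1:] * pderiv r)"
  have p_eq: "poly p v = (v - z) * poly r v * g v" if v: "norm v * s < 1" "v \<noteq> z" for v
  proof -
    have "pderiv B = [:-z, 1:] ^ m * (smult (of_nat (Suc m)) r + [:-z, 1:] * pderiv r)"
      unfolding r(1) pderiv_mult pderiv_power_Suc
      by (simp add: pderiv_pCons pCons_one algebra_simps del: mult_pCons_left mult_pCons_right)
    hence "v * poly (pderiv B) v = (v - z) ^ m * poly p v" by (simp add: p_def)
    moreover have "poly B v * g v = (v - z) ^ m * ((v - z) * poly r v * g v)"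
      by (simp add: r(1) algebra_simps)
    ultimately show ?thesis using ld[OF v(1)] v(2) by simp
  qed
  obtain t where t: "norm z * s < t" "t < 1" using dense[OF z] by blast
  have "((\<lambda>v. (v - z) * poly r v * (K / (1 - t))) \<longlongrightarrow> (z - z) * poly r z * (K / (1 - t))) (at z)"
    by (intro tendsto_intros)
  hence lim0: "((\<lambda>v. (v - z) * poly r v * of_real (K / (1 - t))) \<longlongrightarrow> 0) (at z)" by simp
  have "((\<lambda>v. norm v * s) \<longlongrightarrow> norm z * s) (at z)" by (intro tendsto_intros)
  hence "eventually (\<lambda>v. norm v * s < t) (at z)" by (rule order_tendstoD) (use t in simp)
  moreover have "eventually (\<lambda>v. v \<noteq> z) (at z)" by (simp add: eventually_at_filter)
  ultimately have "eventually (\<lambda>v. norm (poly p v) \<le> norm ((v - z) * poly r v * of_real (K / (1 - t)))) (at z)"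
  proof eventually_elim
    case (elim v)
    have v: "norm v * s < 1" using elim t by linarith
    have "norm (g v) \<le> K / (1 - norm v * s)" by (rule g_le[OF v])
    also have "\<dots> \<le> K / (1 - t)" using elim t K by (intro divide_left_mono mult_pos_pos) auto
    finally have "norm (g v) \<le> norm (complex_of_real (K / (1 - t)))" using t K by (simp del: of_real_divide)
    thus ?case unfolding p_eq[OF v elim(2)] norm_mult by (intro mult_left_mono) auto
  qed
  hence "(poly p \<longlongrightarrow> 0) (at z)"
    by (intro tendsto_0_le[OF lim0, of _ 1]) simp
  moreover have "(poly p \<longlongrightarrow> poly p z) (at z)" using continuous_within_poly[of z UNIV p] by (simp add: continuous_within)
  ultimately have "poly p z = 0" using LIM_unique by blast
  thus False using z0 rz by (simp add: p_def del: of_nat_Suc)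
qed

text \<open>Up to sign, the ratio of the two coefficients is the sum of the reciprocal roots, each
  of modulus at most \<open>s\<close>.\<close>

lemma norm_linear_coeff_le:
  fixes p :: "complex poly" and s :: real
  assumes "p \<noteq> 0" "\<And>z. poly p z = 0 \<Longrightarrow> norm z * s \<ge> 1" "s > 0"
  shows "norm (coeff p 1) \<le> degree p * s * norm (coeff p 0)"
  using assms(1,2)
proof (induction "degree p" arbitrary: p)
  case 0
  thus ?case by (simp add: coeff_eq_0)
next
  case (Suc n)
  obtain z where z: "poly p z = 0" using alg_closed_imp_poly_has_root[of p] Suc.hyps(2) by auto
  then obtain r where r: "p = [:-z, 1:] * r" by (auto simp: poly_eq_0_iff_dvd elim!: dvdE)
  have r0: "r \<noteq> 0" using Suc.prems r by auto
  have dr: "n = degree r" "degree p = Suc (degree r)" using Suc.hyps(2) r0 unfolding r by (simp_all add: degree_mult_eq del: mult_pCons_left)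
  have IH: "norm (coeff r 1) \<le> degree r * s * norm (coeff r 0)"
    using Suc.prems(2) by (intro Suc.hyps(1) dr r0) (simp add: r)
  have zs: "norm z * s \<ge> 1" by (rule Suc.prems(2)[OF z])
  have "norm (coeff p 1) = norm (coeff r 0 - z * coeff r 1)" by (simp add: r)
  also have "\<dots> \<le> norm (coeff r 0) + norm z * norm (coeff r 1)"
    by (metis norm_mult norm_triangle_ineq4)
  also have "\<dots> \<le> norm z * s * norm (coeff r 0) + norm z * (degree r * s * norm (coeff r 0))"
    using zs IH by (intro add_mono mult_left_mono) (auto simp: mult_le_cancel_right1)
  also have "\<dots> = degree p * s * norm (coeff p 0)"
  proof -
    have "norm (coeff p 0) = norm z * norm (coeff r 0)" by (simp add: r norm_mult)
    thus ?thesis unfolding dr(2) by (simp add: algebra_simps)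
  qed
  finally show ?case .
qed

context split_char_sum
begin

definition Lp :: "complex poly" where "Lp = (\<Sum>k<card T. monom (c k) k)"

lemma coeff_Lp: "coeff Lp k = c k"
  by (simp add: Lp_def coeff_sum c_vanish)

definition Lm :: "complex poly" where "Lm = pcompose Lp [:0, -1:]"

lemma coeff_Lm: "coeff Lm k = (-1) ^ k * c k"
  by (simp add: Lm_def coeff_pcompose_linear coeff_Lp)

text \<open>Replacing \<open>z\<close> by \<open>- z\<close> changes the sign of the odd power sums,
  so they cancel in the logarithmic derivative of \<open>Lp * Lm\<close>; the even ones, which
  Stepanov's method controls, are doubled.\<close>

lemma even_newton:
  "of_nat N * coeff (Lp * Lm) N =
     (\<Sum>i\<le>N. coeff (Lp * Lm) i * (if N - i = 0 then 0 else (1 + (-1) ^ (N - i)) * norm_sum f (N - i)))"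
proof -
  define G where "G = Abs_fps (\<lambda>n. if n = 0 then 0 else norm_sum f n)"
  define H where "H = Abs_fps (\<lambda>n. if n = 0 then 0 else (-1) ^ n * norm_sum f n)"
  define A where "A = fps_of_poly Lp"
  define C where "C = fps_of_poly Lm"
  have sh: "(\<Sum>i=0..N. u i * (if N - i = 0 then 0 else v (N - i))) = (\<Sum>n\<in>{1..N}. v n * u (N - n))"
    for u v :: "nat \<Rightarrow> complex" and N
  proof -
    have "(\<Sum>i=0..N. u i * (if N - i = 0 then 0 else v (N - i))) = (\<Sum>n=0..N. u (N - n) * (if n = 0 then 0 else v n))"
      by (rule sum.reindex_bij_witness[of _ "\<lambda>n. N - n" "\<lambda>i. N - i"]) auto
    also have "\<dots> = (\<Sum>n\<in>{1..N}. v n * u (N - n))"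
      by (rule sum.mono_neutral_cong_right) auto
    finally show ?thesis .
  qed
  have Xd: "fps_nth (fps_X * fps_deriv B) N = of_nat N * fps_nth B N" for B :: "complex fps" and N
    by (cases N) (simp_all del: of_nat_Suc)
  have 1: "fps_X * fps_deriv A = A * G"
  proof (rule fps_ext)
    fix N show "fps_nth (fps_X * fps_deriv A) N = fps_nth (A * G) N"
      using newton[of N] sh[where N = N and u = c and v = "norm_sum f"]
      unfolding Xd unfolding fps_mult_nth by (simp add: A_def G_def coeff_Lp)
  qed
  have 2: "fps_X * fps_deriv C = C * H"
  proof (rule fps_ext)
    fix N
    have "of_nat N * ((-1) ^ N * c N) = (-1) ^ N * (\<Sum>n\<in>{1..N}. norm_sum f n * c (N - n))"
      using newton[of N] by (simp add: algebra_simps)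
    also have "\<dots> = (\<Sum>n\<in>{1..N}. ((-1) ^ n * norm_sum f n) * ((-1) ^ (N - n) * c (N - n)))"
      unfolding sum_distrib_left
    proof (intro sum.cong refl)
      fix n assume "n \<in> {1..N}"
      hence "(-1 :: complex) ^ N = (-1) ^ n * (-1) ^ (N - n)" by (simp flip: power_add)
      thus "(-1) ^ N * (norm_sum f n * c (N - n)) = ((-1) ^ n * norm_sum f n) * ((-1) ^ (N - n) * c (N - n))"
        by simp
    qed
    finally show "fps_nth (fps_X * fps_deriv C) N = fps_nth (C * H) N"
      using sh[where N = N and u = "\<lambda>n. (-1) ^ n * c n" and v = "\<lambda>n. (-1) ^ n * norm_sum f n"]
      unfolding Xd unfolding fps_mult_nth by (simp add: C_def H_def coeff_Lm)
  qed
  have "fps_X * fps_deriv (A * C) = (fps_X * fps_deriv A) * C + A * (fps_X * fps_deriv C)"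
    by (simp add: algebra_simps)
  also have "\<dots> = (A * C) * (G + H)" unfolding 1 2 by (simp add: algebra_simps)
  finally have "fps_nth (fps_X * fps_deriv (fps_of_poly (Lp * Lm))) N = fps_nth (fps_of_poly (Lp * Lm) * (G + H)) N"
    by (simp add: A_def C_def fps_of_poly_mult)
  moreover have "fps_nth (fps_X * fps_deriv (fps_of_poly (Lp * Lm))) N = of_nat N * coeff (Lp * Lm) N"
    unfolding Xd by simp
  moreover have "fps_nth (fps_of_poly (Lp * Lm) * (G + H)) N =
     (\<Sum>i\<le>N. coeff (Lp * Lm) i * (if N - i = 0 then 0 else (1 + (-1) ^ (N - i)) * norm_sum f (N - i)))"
    unfolding fps_mult_nth atLeast0AtMost by (intro sum.cong refl) (simp add: G_def H_def algebra_simps)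
  ultimately show ?thesis by simp
qed

lemma even_norm_sum_bound:
  obtains K where "\<And>n. norm (if n = 0 then 0 else (1 + (-1) ^ n) * norm_sum f n) \<le> K * sqrt (real q) ^ n"
proof -
  define \<rho> where "\<rho> = (\<lambda>n. if n = 0 then 0 else (1 + (-1) ^ n) * norm_sum f n)"
  define M where "M = degree f * (q - 1) + 4"
  define C where "C = real (2 * degree f * (q - 1) + q + 1 + degree f)"
  \<comment> \<open>The finite sum absorbs the indices up to \<open>2 * M\<close>, where the size
    condition of \<open>norm_sum_le\<close> may fail.\<close>
  define K where "K = 2 * C + (\<Sum>n\<le>2 * M. norm (\<rho> n))"
  have q1: "sqrt (real q) \<ge> 1" using q_gt_1 by simp
  have sum0: "(\<Sum>n\<le>2 * M. norm (\<rho> n)) \<ge> 0" by (intro sum_nonneg) auto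
  have "norm (\<rho> n) \<le> K * sqrt (real q) ^ n" for n
  proof (cases "n \<le> 2 * M")
    case True
    have "norm (\<rho> n) \<le> (\<Sum>n\<le>2 * M. norm (\<rho> n))" by (rule member_le_sum) (use True in auto)
    also have "\<dots> \<le> K" by (simp add: K_def C_def)
    also have "\<dots> \<le> K * sqrt (real q) ^ n"
    proof -
      have "K \<ge> 0" unfolding K_def C_def using sum0 by (intro add_nonneg_nonneg mult_nonneg_nonneg) auto
      thus ?thesis using mult_left_mono[OF one_le_power[OF q1, of n]] by fastforce
    qed
    finally show ?thesis .
  next
    case False
    show ?thesis
    proof (cases "even n")
      case True
      then obtain k where k: "n = 2 * k" by (elim evenE)
      have "k < q ^ k" using q_gt_1 by (intro power_gt_expt) simp
      hence "q ^ k > M" using False k by linarith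
      hence "cmod (norm_sum f (2 * k)) \<le> C * real q ^ k"
        unfolding C_def M_def using False k by (intro norm_sum_le[OF f]) auto
      moreover have "sqrt (real q) ^ n = real q ^ k" by (simp add: k power_mult)
      moreover have "norm (\<rho> n) \<le> 2 * cmod (norm_sum f (2 * k))"
        by (simp add: \<rho>_def k norm_mult)
      ultimately have "norm (\<rho> n) \<le> 2 * C * sqrt (real q) ^ n" by simp
      also have "\<dots> \<le> K * sqrt (real q) ^ n" using sum0 by (intro mult_right_mono) (auto simp: K_def)
      finally show ?thesis .
    qed (use sum0 in \<open>auto simp: \<rho>_def K_def C_def\<close>)
  qed
  thus ?thesis using that unfolding \<rho>_def by blast
qed

theorem weil_bound:
  "cmod (\<Sum>a\<in>F. \<chi> (\<Prod>t\<in>T. (t + a) ^ ex t)) \<le> real (card T - 1) * sqrt (real q)"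
proof -
  obtain K where K: "\<And>n. norm (if n = 0 then 0 else (1 + (-1) ^ n) * norm_sum f n) \<le> K * sqrt (real q) ^ n"
    using even_norm_sum_bound by blast
  have L0: "Lp \<noteq> 0" using coeff_Lp[of 0] c_0 by auto
  have roots: "norm z * sqrt (real q) \<ge> 1" if "poly Lp z = 0" for z
  proof (rule ccontr)
    assume "\<not> norm z * sqrt (real q) \<ge> 1"
    hence "poly (Lp * Lm) z \<noteq> 0"
      using q_gt_1 by (intro poly_nonzero_of_log_deriv[OF even_newton _ K]) (auto simp: coeff_mult coeff_Lp coeff_Lm c_0)
    thus False using that by simp
  qed
  have "degree Lp \<le> card T - 1"
    by (rule degree_le) (auto simp: coeff_Lp c_vanish)
  moreover have "norm (coeff Lp 1) \<le> degree Lp * sqrt (real q) * norm (coeff Lp 0)"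
    by (rule norm_linear_coeff_le[OF L0 roots]) (use q_gt_1 in auto)
  ultimately have "norm (coeff Lp 1) \<le> real (card T - 1) * sqrt (real q)"
    by (simp add: coeff_Lp c_0) (meson le_trans mult_right_mono of_nat_le_iff order_trans real_sqrt_ge_zero of_nat_0_le_iff)
  thus ?thesis using coeff_Lp[of 1] c_1 by simp
qed

end

section \<open>Weil's bound over finite field types\<close>

lemma of_int_eq_0_small:
  assumes "(of_int x :: 'a :: ring_1) = 0" "\<bar>x\<bar> < int CHAR('a)"
  shows "x = 0"
proof -
  have "(of_nat (nat \<bar>x\<bar>) :: 'a) = 0"
    using assms(1) by (cases "x \<ge> 0") auto
  hence "CHAR('a) dvd nat \<bar>x\<bar>" by (simp only: of_nat_eq_0_iff_char_dvd)
  thus ?thesis using assms(2) dvd_imp_le_int[of x "int CHAR('a)"] by auto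
qed

lemma of_int_eq_small:
  assumes "(of_int x :: 'a :: ring_1) = of_int y" "\<bar>x - y\<bar> < int CHAR('a)"
  shows "x = y"
  using of_int_eq_0_small[of "x - y", where 'a = 'a] assms by simp

text \<open>\<open>q_ge_3\<close> makes the exponent \<open>q - 2\<close> positive, by which complex
  conjugation becomes a power of \<open>\<chi>\<close> even at \<open>0\<close>.\<close>

locale finite_field_char =
  fixes \<chi> :: "'k :: finite_field \<Rightarrow> complex" and q e :: nat
  assumes q_eq: "q = card (UNIV :: 'k set)" and card_eq: "q = CHAR('k) ^ e" and e_pos: "e > 0" and q_ge_3: "q \<ge> 3"
    and \<chi>_mult: "\<chi> (x * y) = \<chi> x * \<chi> y"
    and \<chi>_0 [simp]: "\<chi> 0 = 0" and \<chi>_1 [simp]: "\<chi> 1 = 1"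
    and nontriv: "\<exists>x. x \<noteq> 0 \<and> \<chi> x \<noteq> 1"
begin

lemma power_q_eq_same: "(x :: 'k) ^ q = x"
  unfolding q_eq by (rule finite_field_power_card_eq_same)

lemma range_to_ac: "range (to_ac :: 'k \<Rightarrow> _) = {x. x ^ q = x}"
proof -
  define p :: "'k alg_closure poly" where "p = monom 1 q + [:0, -1:]"
  have deg: "degree p = q"
    unfolding p_def by (subst degree_add_eq_left) (use q_ge_3 in \<open>auto simp: degree_monom_eq\<close>)
  have p0: "p \<noteq> 0" using deg q_ge_3 by auto
  have roots: "{x. x ^ q = x} = {x. poly p x = 0}" by (auto simp: p_def poly_monom)
  have "card (range (to_ac :: 'k \<Rightarrow> _)) = q" using card_image[OF inj_to_ac] by (simp add: q_eq)
  moreover have "range (to_ac :: 'k \<Rightarrow> _) \<subseteq> {x. x ^ q = x}"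
    by (auto simp: power_q_eq_same simp flip: to_ac_power)
  moreover have "card {x :: 'k alg_closure. x ^ q = x} \<le> q"
    unfolding roots using card_poly_roots_bound[OF p0] deg by simp
  ultimately show ?thesis
    by (intro card_subset_eq) (use poly_roots_finite[OF p0] roots in \<open>auto intro: antisym card_mono\<close>)
qed

lemma weil_finite_field:
  assumes "\<And>t. t \<in> T \<Longrightarrow> ex t > 0" "t0 \<in> T" "ex t0 = 1"
  shows "cmod (\<Sum>u\<in>UNIV. \<chi> (\<Prod>t\<in>T. (t + u) ^ ex t)) \<le> real (card T - 1) * sqrt (real q)"
proof -
  interpret split_char_sum q e "range (to_ac :: 'k \<Rightarrow> _)" "\<chi> \<circ> of_ac" "to_ac ` T" "ex \<circ> of_ac" "to_ac t0"
  proof unfold_locales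
    show "prime CHAR('k alg_closure)" by simp
    show "q = CHAR('k alg_closure) ^ e" using card_eq by simp
    show "\<exists>x\<in>range to_ac. x \<noteq> 0 \<and> (\<chi> \<circ> of_ac) x \<noteq> 1" using nontriv by auto
    show "(\<chi> \<circ> of_ac) 1 = 1" by (metis \<chi>_1 comp_apply of_ac_to_ac to_ac_1)
    show "(\<chi> \<circ> of_ac) (x * y) = (\<chi> \<circ> of_ac) x * (\<chi> \<circ> of_ac) y"
      if "x \<in> range (to_ac :: 'k \<Rightarrow> _)" "y \<in> range to_ac" for x y
      using that by (auto simp: \<chi>_mult simp flip: to_ac_mult)
  qed (use e_pos range_to_ac assms in auto)
  have card_T: "card (to_ac ` T) = card T" by (intro card_image inj_on_subset[OF inj_to_ac]) auto
  have "(\<Sum>a\<in>range to_ac. (\<chi> \<circ> of_ac) (\<Prod>t\<in>to_ac ` T. (t + a) ^ (ex \<circ> of_ac) t)) =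
        (\<Sum>u\<in>UNIV. \<chi> (\<Prod>t\<in>T. (t + u) ^ ex t))"
  proof (subst sum.reindex[OF inj_to_ac], intro sum.cong refl)
    fix u
    have "(\<Prod>t\<in>to_ac ` T. (t + to_ac u) ^ (ex \<circ> of_ac) t) = to_ac (\<Prod>t\<in>T. (t + u) ^ ex t)"
      by (subst prod.reindex) (auto simp: to_ac_prod inj_on_def)
    thus "((\<lambda>a. (\<chi> \<circ> of_ac) (\<Prod>t\<in>to_ac ` T. (t + a) ^ (ex \<circ> of_ac) t)) \<circ> to_ac) u = \<chi> (\<Prod>t\<in>T. (t + u) ^ ex t)"
      by simp
  qed
  with weil_bound show ?thesis by (simp add: card_T)
qed

lemma \<chi>_power: "\<chi> (x ^ n) = \<chi> x ^ n"
  by (induction n) (auto simp: \<chi>_mult)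

lemma \<chi>_prod: "\<chi> (prod f A) = (\<Prod>i\<in>A. \<chi> (f i))"
  by (induction A rule: infinite_finite_induct) (auto simp: \<chi>_mult)

lemma \<chi>_power_q: "x \<noteq> 0 \<Longrightarrow> \<chi> x ^ (q - 1) = 1"
proof -
  assume x: "x \<noteq> 0"
  have "x * x ^ (q - 1) = x * 1" using power_q_eq_same[of x] q_ge_3 by (simp flip: power_Suc)
  hence "x ^ (q - 1) = 1" using x by simp
  thus ?thesis by (metis \<chi>_1 \<chi>_power)
qed

lemma norm_\<chi>: "x \<noteq> 0 \<Longrightarrow> norm (\<chi> x) = 1"
proof -
  assume "x \<noteq> 0"
  hence "norm (\<chi> x) ^ (q - 1) = 1" using \<chi>_power_q by (metis norm_one norm_power)
  thus ?thesis using q_ge_3 power_eq_1_iff[of "norm (\<chi> x)" "q - 1"] by auto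
qed

lemma norm_\<chi>_le: "norm (\<chi> x) \<le> 1"
  using norm_\<chi>[of x] by (cases "x = 0") auto

lemma cnj_\<chi>: "cnj (\<chi> x) = \<chi> x ^ (q - 2)"
proof (cases "x = 0")
  case True
  thus ?thesis using q_ge_3 by (simp add: power_0_left)
next
  case False
  have "q - 1 = Suc (q - 2)" using q_ge_3 by simp
  hence "\<chi> x * \<chi> x ^ (q - 2) = \<chi> x ^ (q - 1)" by (simp only: power_Suc)
  also have "\<dots> = \<chi> x * cnj (\<chi> x)" using \<chi>_power_q[OF False] norm_\<chi>[OF False] by (simp add: complex_norm_square[symmetric])
  finally show ?thesis using norm_\<chi>[OF False] by auto
qed

text \<open>Equal shifts are merged and their weights added, to obtain a set of shifts with
  exponents; since \<open>h k0\<close> is taken only once, its exponent remains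
  \<open>1\<close>.\<close>

lemma weil_weighted:
  fixes h :: "nat \<Rightarrow> 'k" and w :: "nat \<Rightarrow> nat"
  assumes w: "\<And>k. k < n \<Longrightarrow> w k > 0" and k0: "k0 < n" "w k0 = 1"
    and unique: "\<And>k. k < n \<Longrightarrow> h k = h k0 \<Longrightarrow> k = k0"
  shows "cmod (\<Sum>u\<in>UNIV. \<Prod>k<n. \<chi> (u + h k) ^ w k) \<le> real n * sqrt (real q)"
proof -
  define T where "T = h ` {..<n}"
  define ex where "ex = (\<lambda>t. \<Sum>k\<in>{k\<in>{..<n}. h k = t}. w k)"
  have "(\<Prod>k<n. \<chi> (u + h k) ^ w k) = \<chi> (\<Prod>t\<in>T. (t + u) ^ ex t)" for u
  proof -
    have "(\<Prod>k<n. \<chi> (u + h k) ^ w k) = (\<Prod>t\<in>T. \<Prod>k\<in>{k\<in>{..<n}. h k = t}. \<chi> (u + h k) ^ w k)"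
      by (rule prod.group[symmetric]) (auto simp: T_def)
    also have "\<dots> = (\<Prod>t\<in>T. \<Prod>k\<in>{k\<in>{..<n}. h k = t}. \<chi> (t + u) ^ w k)"
      by (intro prod.cong refl) (auto simp: add.commute)
    finally show ?thesis by (simp add: \<chi>_prod \<chi>_power ex_def power_sum)
  qed
  moreover have "cmod (\<Sum>u\<in>UNIV. \<chi> (\<Prod>t\<in>T. (t + u) ^ ex t)) \<le> real (card T - 1) * sqrt (real q)"
  proof (rule weil_finite_field)
    show "h k0 \<in> T" using k0 by (auto simp: T_def)
    have "{k\<in>{..<n}. h k = h k0} = {k0}" using k0 unique by auto
    thus "ex (h k0) = 1" using k0 by (simp add: ex_def)
    fix t assume "t \<in> T"
    then obtain k where k: "k < n" "h k = t" by (auto simp: T_def)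
    have "w k \<le> ex t" unfolding ex_def by (rule member_le_sum) (use k in auto)
    thus "ex t > 0" using w[OF k(1)] by linarith
  qed
  moreover have "card T \<le> n" unfolding T_def using card_image_le[of "{..<n}" h] by simp
  hence "real (card T - 1) * sqrt (real q) \<le> real n * sqrt (real q)" by (intro mult_right_mono) auto
  ultimately show ?thesis by simp
qed

text \<open>If the isolated shift lies in the conjugated half, its weight would be
  \<open>q - 2\<close>. Conjugating the whole sum exchanges the halves and makes that weight
  \<open>1\<close>.\<close>

lemma weil_moment_term:
  fixes h :: "nat \<Rightarrow> 'k"
  assumes k0: "k0 < 2 * r" and unique: "\<And>k. k < 2 * r \<Longrightarrow> h k = h k0 \<Longrightarrow> k = k0"
  shows "cmod (\<Sum>u\<in>UNIV. \<Prod>k<2 * r. if k < r then \<chi> (u + h k) else cnj (\<chi> (u + h k))) \<le> 2 * real r * sqrt (real q)"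
proof (cases "k0 < r")
  case True
  have "(\<Prod>k<2 * r. if k < r then \<chi> (u + h k) else cnj (\<chi> (u + h k))) =
      (\<Prod>k<2 * r. \<chi> (u + h k) ^ (if k < r then 1 else q - 2))" for u
    by (intro prod.cong) (auto simp: cnj_\<chi>)
  thus ?thesis
    using weil_weighted[of "2 * r" "\<lambda>k. if k < r then 1 else q - 2" k0 h] assms True q_ge_3 by auto
next
  case False
  have "cnj (\<Prod>k<2 * r. if k < r then \<chi> (u + h k) else cnj (\<chi> (u + h k))) =
      (\<Prod>k<2 * r. \<chi> (u + h k) ^ (if k < r then q - 2 else 1))" for u
  proof -
    have "cnj (if k < r then \<chi> (u + h k) else cnj (\<chi> (u + h k))) = \<chi> (u + h k) ^ (if k < r then q - 2 else 1)" for k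
      by (cases "k < r") (simp add: cnj_\<chi>, simp)
    thus ?thesis unfolding cnj_prod by (intro prod.cong refl)
  qed
  hence "cnj (\<Sum>u\<in>UNIV. \<Prod>k<2 * r. if k < r then \<chi> (u + h k) else cnj (\<chi> (u + h k))) =
      (\<Sum>u\<in>UNIV. \<Prod>k<2 * r. \<chi> (u + h k) ^ (if k < r then q - 2 else 1))"
    unfolding cnj_sum by (intro sum.cong refl)
  moreover have "cmod (\<Sum>u\<in>UNIV. \<Prod>k<2 * r. \<chi> (u + h k) ^ (if k < r then q - 2 else 1)) \<le> real (2 * r) * sqrt (real q)"
    by (rule weil_weighted[of _ _ k0]) (use assms False q_ge_3 in auto)
  ultimately have "cmod (cnj (\<Sum>u\<in>UNIV. \<Prod>k<2 * r. if k < r then \<chi> (u + h k) else cnj (\<chi> (u + h k)))) \<le> real (2 * r) * sqrt (real q)"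
    by (simp only:)
  thus ?thesis by (simp only: complex_mod_cnj of_nat_mult of_nat_numeral)
qed

end

section \<open>Moments of short character sums\<close>

text \<open>If every value is taken at least twice, at most \<open>r\<close> values occur, so
  \<open>g\<close> is coded by a list of \<open>r\<close> values and a map from the positions into
  it.\<close>

lemma card_no_unique_value:
  fixes A :: "'b set"
  assumes "finite A"
  shows "card {g \<in> PiE {..<2 * r} (\<lambda>_. A). \<forall>k0<2 * r. \<exists>k<2 * r. k \<noteq> k0 \<and> g k = g k0} \<le> r ^ (2 * r) * card A ^ r"
proof -
  define S where "S = {g \<in> PiE {..<2 * r} (\<lambda>_. A). \<forall>k0<2 * r. \<exists>k<2 * r. k \<noteq> k0 \<and> g k = g k0}"
  define Y where "Y = PiE {..<r} (\<lambda>_. A) \<times> PiE {..<2 * r} (\<lambda>_. {..<r})"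
  define \<Phi> where "\<Phi> = (\<lambda>(c :: nat \<Rightarrow> 'b, s :: nat \<Rightarrow> nat). \<lambda>k\<in>{..<2 * r}. c (s k))"
  have finY: "finite Y" unfolding Y_def using assms by (intro finite_cartesian_product finite_PiE) auto
  have "S \<subseteq> \<Phi> ` Y"
  proof
    fix g assume g: "g \<in> S"
    define I where "I = g ` {..<2 * r}"
    have I: "finite I" "I \<subseteq> A" using g by (auto simp: I_def S_def)
    have fib: "card {k\<in>{..<2 * r}. g k = t} \<ge> 2" if t: "t \<in> I" for t
    proof -
      obtain k0 where k0: "k0 < 2 * r" "g k0 = t" using t by (auto simp: I_def)
      then obtain k where k: "k < 2 * r" "k \<noteq> k0" "g k = g k0" using g unfolding S_def by blast
      have "card {k, k0} \<le> card {k\<in>{..<2 * r}. g k = t}" using k k0 by (intro card_mono) auto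
      thus ?thesis using k by simp
    qed
    have "2 * card I = (\<Sum>t\<in>I. 2)" by simp
    also have "\<dots> \<le> (\<Sum>t\<in>I. card {k\<in>{..<2 * r}. g k = t})" by (intro sum_mono fib)
    also have "\<dots> = card (\<Union>t\<in>I. {k\<in>{..<2 * r}. g k = t})"
      by (rule card_UN_disjoint[symmetric]) (use I in auto)
    also have "(\<Union>t\<in>I. {k\<in>{..<2 * r}. g k = t}) = {..<2 * r}" by (auto simp: I_def)
    finally have cI: "card I \<le> r" by simp
    obtain b where b: "bij_betw b {..<card I} I" using ex_bij_betw_nat_finite[OF I(1)] by (auto simp: atLeast0LessThan)
    define c where "c = (\<lambda>i\<in>{..<r}. if i < card I then b i else b 0)"
    define s where "s = (\<lambda>k\<in>{..<2 * r}. the_inv_into {..<card I} b (g k))"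
    have bI: "b i \<in> I" if "i < card I" for i using b that by (auto simp: bij_betw_def)
    have s: "s k < card I" "b (s k) = g k" if "k < 2 * r" for k
    proof -
      have "g k \<in> b ` {..<card I}" using b that by (auto simp: bij_betw_def I_def)
      thus "s k < card I" "b (s k) = g k"
        using b that the_inv_into_into[of b "{..<card I}" "g k" "{..<card I}"] f_the_inv_into_f[of b "{..<card I}" "g k"]
        by (auto simp: s_def bij_betw_def)
    qed
    have "c \<in> PiE {..<r} (\<lambda>_. A)"
    proof (rule PiE_I)
      fix i assume i: "i \<in> {..<r}"
      hence "I \<noteq> {}" by (auto simp: I_def lessThan_empty_iff bot_nat_def)
      hence "0 < card I" using I(1) by (simp add: card_gt_0_iff)
      thus "c i \<in> A" using bI[of i] bI[of 0] I(2) i by (auto simp: c_def)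
    qed (simp add: c_def)
    moreover have "s \<in> PiE {..<2 * r} (\<lambda>_. {..<r})"
    proof (rule PiE_I)
      fix k assume "k \<in> {..<2 * r}"
      thus "s k \<in> {..<r}" using s(1)[of k] cI by simp
    qed (simp add: s_def)
    moreover have "g = \<Phi> (c, s)"
    proof
      fix k show "g k = \<Phi> (c, s) k"
      proof (cases "k < 2 * r")
        case True
        thus ?thesis using s[OF True] cI by (simp add: \<Phi>_def c_def)
      next
        case False
        thus ?thesis using g by (simp add: \<Phi>_def S_def PiE_def extensional_def)
      qed
    qed
    ultimately show "g \<in> \<Phi> ` Y" unfolding Y_def by blast
  qed
  hence "card S \<le> card (\<Phi> ` Y)" using finY by (intro card_mono) auto
  also have "\<dots> \<le> card Y" by (rule card_image_le[OF finY])
  also have "\<dots> = r ^ (2 * r) * card A ^ r" by (simp add: Y_def card_cartesian_product card_PiE mult.commute)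
  finally show ?thesis by (simp add: S_def)
qed

context finite_field_char
begin

text \<open>The power expands into a sum over \<open>2 * r\<close>-tuples. Those in which every
  entry recurs are few and get the trivial bound \<open>q\<close>; all others have an isolated entry
  and fall under Weil's bound. As \<open>T < CHAR('k)\<close>, distinct entries give distinct
  shifts.\<close>

lemma moment_bound:
  assumes T: "T < CHAR('k)"
  shows "(\<Sum>u\<in>UNIV. cmod (\<Sum>t\<in>{1..T}. \<chi> (u + of_nat t)) ^ (2 * r)) \<le>
    real r ^ (2 * r) * real T ^ r * real q + 2 * real r * sqrt (real q) * real T ^ (2 * r)"
proof -
  define A where "A = {1..T}"
  define P where "P = PiE {..<2 * r} (\<lambda>_. A)"
  define bad where "bad = {g \<in> P. \<forall>k0<2 * r. \<exists>k<2 * r. k \<noteq> k0 \<and> g k = g k0}"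
  define \<phi> where "\<phi> = (\<lambda>k u. if k < r then \<chi> u else cnj (\<chi> u))"
  define W where "W = (\<lambda>g. \<Sum>u\<in>UNIV. \<Prod>k<2 * r. \<phi> k (u + of_nat (g k :: nat)))"
  have finP: "finite P" by (simp add: P_def A_def finite_PiE)
  have cardP: "card P = T ^ (2 * r)" by (simp add: P_def A_def card_PiE)
  have expand: "of_real (cmod (\<Sum>t\<in>A. \<chi> (u + of_nat t)) ^ (2 * r)) = (\<Sum>g\<in>P. \<Prod>k<2 * r. \<phi> k (u + of_nat (g k)))" for u
  proof -
    define z where "z = (\<Sum>t\<in>A. \<chi> (u + of_nat t))"
    have "complex_of_real (cmod z ^ (2 * r)) = z ^ r * cnj z ^ r"
      by (simp only: power_mult of_real_power[symmetric] power_mult_distrib[symmetric] complex_norm_square[symmetric])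
    also have "\<dots> = (\<Prod>k<2 * r. if k < r then z else cnj z)"
    proof -
      have "{..<2 * r} = {..<r} \<union> {r..<2 * r}" by auto
      hence "(\<Prod>k<2 * r. if k < r then z else cnj z) =
          (\<Prod>k<r. if k < r then z else cnj z) * (\<Prod>k\<in>{r..<2 * r}. if k < r then z else cnj z)"
        by (simp only: prod.union_disjoint finite_lessThan finite_atLeastLessThan ivl_disj_int)
      also have "(\<Prod>k\<in>{r..<2 * r}. if k < r then z else cnj z) = (\<Prod>k\<in>{r..<2 * r}. cnj z)"
        by (rule prod.cong) auto
      finally show ?thesis by simp
    qed
    also have "\<dots> = (\<Prod>k<2 * r. \<Sum>t\<in>A. \<phi> k (u + of_nat t))"
      by (intro prod.cong) (auto simp: \<phi>_def z_def)
    also have "\<dots> = (\<Sum>g\<in>P. \<Prod>k<2 * r. \<phi> k (u + of_nat (g k)))"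
      unfolding P_def by (rule prod_sum_PiE) (auto simp: A_def)
    finally show ?thesis by (simp add: z_def)
  qed
  have \<phi>_le: "cmod (\<phi> k u) \<le> 1" for k u using norm_\<chi>_le by (simp add: \<phi>_def)
  have triv: "cmod (W g) \<le> real q" for g
  proof -
    have "cmod (W g) \<le> (\<Sum>u\<in>(UNIV :: 'k set). 1)"
      unfolding W_def by (intro sum_norm_le) (simp add: prod_norm[symmetric] prod_le_1 \<phi>_le)
    thus ?thesis by (simp add: q_eq)
  qed
  have inj: "a = b" if "a \<in> A" "b \<in> A" "of_nat a = (of_nat b :: 'k)" for a b
  proof -
    have "(of_int (int a) :: 'k) = of_int (int b)" using that(3) by simp
    hence "int a = int b" by (rule of_int_eq_small) (use that(1,2) T in \<open>auto simp: A_def\<close>)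
    thus ?thesis by simp
  qed
  have good: "cmod (W g) \<le> 2 * real r * sqrt (real q)" if g: "g \<in> P - bad" for g
  proof -
    obtain k0 where k0: "k0 < 2 * r" "\<And>k. k < 2 * r \<Longrightarrow> g k = g k0 \<Longrightarrow> k = k0"
      using g by (auto simp: bad_def)
    have gA: "g k \<in> A" if "k < 2 * r" for k using g that by (auto simp: P_def)
    show ?thesis
      unfolding W_def \<phi>_def
      by (rule weil_moment_term[OF k0(1)]) (use k0 gA inj in blast)
  qed
  have "complex_of_real (\<Sum>u\<in>UNIV. cmod (\<Sum>t\<in>A. \<chi> (u + of_nat t)) ^ (2 * r)) = (\<Sum>g\<in>P. W g)"
    unfolding of_real_sum expand W_def by (rule sum.swap)
  hence "(\<Sum>u\<in>UNIV. cmod (\<Sum>t\<in>A. \<chi> (u + of_nat t)) ^ (2 * r)) = cmod (\<Sum>g\<in>P. W g)"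
  proof -
    assume eq: "complex_of_real (\<Sum>u\<in>UNIV. cmod (\<Sum>t\<in>A. \<chi> (u + of_nat t)) ^ (2 * r)) = (\<Sum>g\<in>P. W g)"
    have "(\<Sum>u\<in>UNIV. cmod (\<Sum>t\<in>A. \<chi> (u + of_nat t)) ^ (2 * r)) \<ge> 0" by (intro sum_nonneg) auto
    thus ?thesis unfolding eq[symmetric] norm_of_real by simp
  qed
  also have "\<dots> \<le> (\<Sum>g\<in>P. cmod (W g))" by (rule norm_sum)
  also have "\<dots> = (\<Sum>g\<in>bad. cmod (W g)) + (\<Sum>g\<in>P - bad. cmod (W g))"
    by (subst sum.subset_diff[of bad P]) (use finP in \<open>auto simp: bad_def\<close>)
  also have "\<dots> \<le> (\<Sum>g\<in>bad. real q) + (\<Sum>g\<in>P - bad. 2 * real r * sqrt (real q))"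
    using triv good by (intro add_mono sum_mono) auto
  also have "\<dots> \<le> real (r ^ (2 * r) * T ^ r) * real q + real (T ^ (2 * r)) * (2 * real r * sqrt (real q))"
  proof -
    have "card bad \<le> r ^ (2 * r) * T ^ r"
      using card_no_unique_value[of A r] by (simp add: bad_def P_def A_def)
    hence "real (card bad) * real q \<le> real (r ^ (2 * r) * T ^ r) * real q"
      by (intro mult_right_mono of_nat_mono) auto
    moreover have "card (P - bad) \<le> T ^ (2 * r)" using card_mono[OF finP, of "P - bad"] cardP by auto
    hence "real (card (P - bad)) * (2 * real r * sqrt (real q)) \<le> real (T ^ (2 * r)) * (2 * real r * sqrt (real q))"
      by (intro mult_right_mono of_nat_mono) auto
    ultimately show ?thesis by simp
  qed
  finally show ?thesis by (simp add: A_def algebra_simps)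
qed

end

section \<open>Multiplicative energy of boxes\<close>

text \<open>The constant stays below \<open>2\<close> so that without its first term the sum is less
  than \<open>1\<close>; this makes coprime pairs a positive proportion in
  \<open>card_B_ge\<close>.\<close>

lemma sum_inverse_squares_le: "(\<Sum>a\<in>{1..int n}. 1 / (real_of_int a)\<^sup>2) \<le> 7 / 4"
proof -
  have "(\<Sum>a\<in>{1..int n}. 1 / (real_of_int a)\<^sup>2) \<le> 7 / 4 - 1 / real n" if "n \<ge> 2" for n
    using that
  proof (induction n rule: nat_induct_at_least)
    case base
    have "{1..int 2} = {1, 2}" by auto
    thus ?case by simp
  next
    case (Suc n)
    have "{1..int (Suc n)} = insert (int (Suc n)) {1..int n}" by auto
    hence "(\<Sum>a\<in>{1..int (Suc n)}. 1 / (real_of_int a)\<^sup>2) = 1 / (real (Suc n))\<^sup>2 + (\<Sum>a\<in>{1..int n}. 1 / (real_of_int a)\<^sup>2)"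
      by simp
    also have "\<dots> \<le> 1 / (real (Suc n))\<^sup>2 + (7 / 4 - 1 / real n)" using Suc by simp
    also have "1 / (real (Suc n))\<^sup>2 \<le> 1 / (real n * real (Suc n))"
      using Suc.hyps by (intro divide_left_mono) (auto simp: power2_eq_square)
    also have "1 / (real n * real (Suc n)) = 1 / real n - 1 / real (Suc n)"
      using Suc.hyps by (simp add: field_simps)
    finally show ?case by simp
  qed
  note * = this
  consider "n = 0" | "n = 1" | "n \<ge> 2" by linarith
  thus ?thesis
  proof cases
    case 3
    have "7 / 4 - 1 / real n \<le> 7 / 4" by simp
    with *[OF 3] show ?thesis by linarith
  qed auto
qed

lemma sum_inverse_squares_le':
  "(\<Sum>x\<in>{- int n<..<int n}. 1 / (max 1 \<bar>real_of_int x\<bar>)\<^sup>2) \<le> 5"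
proof -
  define g where "g = (\<lambda>x. 1 / (max 1 \<bar>real_of_int x\<bar>)\<^sup>2)"
  have g0: "g x \<ge> 0" for x by (simp add: g_def)
  have pos: "(\<Sum>x\<in>{1..int n}. g x) \<le> 2"
  proof -
    have "(\<Sum>x\<in>{1..int n}. g x) = (\<Sum>a\<in>{1..int n}. 1 / (real_of_int a)\<^sup>2)"
      by (intro sum.cong) (auto simp: g_def max_def)
    thus ?thesis using sum_inverse_squares_le[of n] by simp
  qed
  have neg: "(\<Sum>x\<in>uminus ` {1..int n}. g x) = (\<Sum>x\<in>{1..int n}. g x)"
    by (subst sum.reindex) (auto simp: g_def inj_on_def)
  have "(\<Sum>x\<in>{- int n<..<int n}. g x) \<le> (\<Sum>x\<in>{0} \<union> ({1..int n} \<union> uminus ` {1..int n}). g x)"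
  proof (rule sum_mono2)
    show "{- int n<..<int n} \<subseteq> {0} \<union> ({1..int n} \<union> uminus ` {1..int n})"
    proof
      fix x assume x: "x \<in> {- int n<..<int n}"
      show "x \<in> {0} \<union> ({1..int n} \<union> uminus ` {1..int n})"
      proof (cases "x < 0")
        case True
        hence "- x \<in> {1..int n}" using x by auto
        hence "- (- x) \<in> uminus ` {1..int n}" by (rule imageI)
        thus ?thesis by simp
      qed (use x in auto)
    qed
  qed (use g0 in auto)
  also have "\<dots> \<le> (\<Sum>x\<in>{0}. g x) + ((\<Sum>x\<in>{1..int n}. g x) + (\<Sum>x\<in>uminus ` {1..int n}. g x))"
  proof -
    have "(\<Sum>x\<in>{0} \<union> ({1..int n} \<union> uminus ` {1..int n}). g x) = (\<Sum>x\<in>{0}. g x) + (\<Sum>x\<in>{1..int n} \<union> uminus ` {1..int n}. g x)"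
      by (rule sum.union_disjoint) auto
    moreover have "(\<Sum>x\<in>{1..int n} \<union> uminus ` {1..int n}. g x) = (\<Sum>x\<in>{1..int n}. g x) + (\<Sum>x\<in>uminus ` {1..int n}. g x)"
      by (rule sum.union_disjoint) auto
    ultimately show ?thesis by simp
  qed
  also have "\<dots> \<le> 5" using pos neg by (simp add: g_def)
  finally show ?thesis by (simp add: g_def)
qed

locale small_box =
  fixes H M :: nat and ty :: "'k :: finite_field itself"
  assumes H: "H \<ge> 1" "H \<le> M" and HM: "2 * H * M < CHAR('k)"
begin

text \<open>A lattice of pairs cut by a half-box at the origin. It contains the differences of
  solutions in translated boxes, once these are ordered by the first coordinate.\<close>

definition V :: "'k \<Rightarrow> (int \<times> int) set" where
  "V l = {(a, x). 0 \<le> a \<and> a < int H \<and> \<bar>x\<bar> < int M \<and> of_int x = l * of_int a}"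

lemma finite_V: "finite (V l)"
  by (rule finite_subset[of _ "{0..<int H} \<times> {- int M<..<int M}"]) (auto simp: V_def)

text \<open>The two products agree in the field and differ by less than the characteristic, so they
  agree as integers.\<close>

lemma V_proportional:
  assumes "(a, x) \<in> V l" "(b, y) \<in> V l"
  shows "a * y = b * x"
proof (rule of_int_eq_small)
  show "(of_int (a * y) :: 'k) = of_int (b * x)" using assms by (simp add: V_def mult_ac)
  have "\<bar>a * y\<bar> \<le> int H * int M" "\<bar>b * x\<bar> \<le> int H * int M"
    using assms unfolding abs_mult by (auto simp: V_def intro!: mult_mono)
  hence "\<bar>a * y - b * x\<bar> \<le> 2 * (int H * int M)" by linarith
  also have "\<dots> < int CHAR('k)" using HM by (metis mult.assoc of_nat_less_iff of_nat_mult of_nat_numeral)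
  finally show "\<bar>a * y - b * x\<bar> < int CHAR('k)" .
qed

text \<open>All points of \<open>V l\<close> lie on one line. Division with remainder by the point
  of least positive first coordinate shows that they are its multiples; at most
  \<open>M div mx + 1\<close> of these fit, and \<open>mx \<le> M\<close> turns this into
  \<open>2 * M / mx\<close>.\<close>

lemma card_V:
  assumes "card (V l) \<ge> 2"
  obtains a x where "1 \<le> a" "a \<le> int H" "\<bar>x\<bar> < int M" "of_int x = l * of_int a"
    "real (card (V l)) * max (real_of_int a) \<bar>real_of_int x\<bar> \<le> 2 * real M"
proof -
  have "\<not> V l \<subseteq> {(0, 0)}" using assms card_mono[of "{(0, 0)}" "V l"] by auto
  then obtain a0 x0 where ax0: "(a0, x0) \<in> V l" "(a0, x0) \<noteq> (0, 0)" by auto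
  have HM1: "int M < int CHAR('k)"
  proof -
    have "M \<le> 2 * H * M" using H by simp
    thus ?thesis using HM by linarith
  qed
  have a0: "a0 \<ge> 1"
  proof (rule ccontr)
    assume "\<not> a0 \<ge> 1"
    hence "a0 = 0" using ax0 by (auto simp: V_def)
    hence "x0 = 0" using ax0 HM1 by (intro of_int_eq_0_small[where 'a = 'k]) (auto simp: V_def)
    thus False using ax0 \<open>a0 = 0\<close> by simp
  qed
  define Q where "Q = (\<lambda>n. n \<ge> 1 \<and> (\<exists>x. (int n, x) \<in> V l))"
  define n where "n = (LEAST n. Q n)"
  have "Q (nat a0)" using a0 ax0 by (auto simp: Q_def)
  hence Qn: "Q n" and least: "Q k \<Longrightarrow> n \<le> k" for k by (auto simp: n_def intro: LeastI Least_le)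
  then obtain x where x: "n \<ge> 1" "(int n, x) \<in> V l" by (auto simp: Q_def)
  define mx where "mx = max (int n) \<bar>x\<bar>"
  have mx: "mx \<ge> 1" "mx \<le> int M" using x H by (auto simp: mx_def V_def)
  have mult: "\<exists>k. (b, y) = (k * int n, k * x) \<and> 0 \<le> k \<and> k * mx \<le> int M" if bV: "(b, y) \<in> V l" for b y
  proof -
    define k where "k = b div int n"
    define r where "r = b mod int n"
    have b: "b = k * int n + r" by (simp add: k_def r_def)
    have r: "0 \<le> r" "r < int n" using x by (auto simp: r_def)
    have "b * x = int n * y" using V_proportional[OF x(2) bV] by simp
    hence e: "int n * (y - k * x) = r * x" by (simp add: b algebra_simps)
    have "int n * \<bar>y - k * x\<bar> = r * \<bar>x\<bar>" using arg_cong[OF e, of abs] r by (simp add: abs_mult)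
    also have "\<dots> \<le> int n * \<bar>x\<bar>" using r by (intro mult_right_mono) auto
    finally have "\<bar>y - k * x\<bar> \<le> \<bar>x\<bar>" using x(1) by simp
    hence "(r, y - k * x) \<in> V l"
      using bV x(2) r by (auto simp: V_def b algebra_simps)
    have "r = 0"
    proof (rule ccontr)
      assume "r \<noteq> 0"
      hence "Q (nat r)" using r \<open>(r, y - k * x) \<in> V l\<close> by (auto simp: Q_def)
      thus False using least[of "nat r"] r by linarith
    qed
    moreover from this have "y = k * x" using e x(1) by simp
    moreover have k0: "0 \<le> k" unfolding k_def using bV x(1) by (intro pos_imp_zdiv_nonneg_iff[THEN iffD2]) (auto simp: V_def)
    moreover have "k * mx \<le> int M"
    proof (cases "\<bar>x\<bar> \<le> int n")
      case True
      hence "k * mx = b" using b \<open>r = 0\<close> by (simp add: mx_def max_def)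
      thus ?thesis using bV H by (auto simp: V_def)
    next
      case False
      hence "k * mx = \<bar>y\<bar>" using \<open>y = k * x\<close> k0 by (simp add: mx_def max_def abs_mult)
      thus ?thesis using bV by (auto simp: V_def)
    qed
    ultimately show ?thesis using b by auto
  qed
  have "V l \<subseteq> (\<lambda>k. (k * int n, k * x)) ` {0..int M div mx}"
  proof clarify
    fix b y assume "(b, y) \<in> V l"
    then obtain k where k: "(b, y) = (k * int n, k * x)" "0 \<le> k" "k * mx \<le> int M" using mult by blast
    have "k \<le> int M div mx" using zdiv_mono1[OF k(3), of mx] mx by simp
    thus "(b, y) \<in> (\<lambda>k. (k * int n, k * x)) ` {0..int M div mx}" using k by auto
  qed
  hence "card (V l) \<le> card {0..int M div mx}"
    by (meson card_image_le card_mono finite_atLeastAtMost_int finite_imageI le_trans)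
  hence "int (card (V l)) \<le> int M div mx + 1"
    using pos_imp_zdiv_nonneg_iff[of mx "int M"] mx by simp
  hence "int (card (V l)) * mx \<le> (int M div mx + 1) * mx" using mx by (intro mult_right_mono) auto
  also have "\<dots> \<le> int M + mx" using mx by (simp add: algebra_simps) (metis mult.commute div_mult_mod_eq le_add_same_cancel1 pos_mod_sign less_le_trans zero_less_one)
  also have "\<dots> \<le> 2 * int M" using mx by simp
  finally have "real_of_int (int (card (V l)) * mx) \<le> real_of_int (2 * int M)" by (simp only: of_int_le_iff)
  hence "real (card (V l)) * max (real_of_int (int n)) \<bar>real_of_int x\<bar> \<le> 2 * real M"
    by (simp add: mx_def of_int_max)
  thus ?thesis using that[of "int n" x] x by (auto simp: V_def)
qed

text \<open>Subtracting a solution with least first coordinate moves the set into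
  \<open>V l\<close>.\<close>

lemma card_translate_le:
  assumes "L \<le> M"
  shows "card {(a, x). a \<in> {1..int H} \<and> x \<in> {\<gamma>..<\<gamma> + int L} \<and> of_int x = l * (of_int a :: 'k)} \<le> card (V l)"
proof (cases "{(a, x). a \<in> {1..int H} \<and> x \<in> {\<gamma>..<\<gamma> + int L} \<and> of_int x = l * (of_int a :: 'k)} = {}")
  case False
  define N where "N = {(a, x). a \<in> {1..int H} \<and> x \<in> {\<gamma>..<\<gamma> + int L} \<and> of_int x = l * (of_int a :: 'k)}"
  have finN: "finite N"
    by (rule finite_subset[of _ "{1..int H} \<times> {\<gamma>..<\<gamma> + int L}"]) (auto simp: N_def)
  obtain z where z: "z \<in> N" "\<And>w. w \<in> N \<Longrightarrow> nat (fst z) \<le> nat (fst w)"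
    using False ex_has_least_nat[of "\<lambda>z. z \<in> N" _ "\<lambda>z. nat (fst z)"] unfolding N_def[symmetric] by blast
  have "card N \<le> card (V l)"
  proof (rule card_inj_on_le)
    show "inj_on (\<lambda>w. (fst w - fst z, snd w - snd z)) N" by (auto simp: inj_on_def prod_eq_iff)
    show "(\<lambda>w. (fst w - fst z, snd w - snd z)) ` N \<subseteq> V l"
    proof (rule image_subsetI)
      fix w assume w: "w \<in> N"
      have "fst z \<le> fst w" using z(2)[OF w] z(1) w by (auto simp: N_def)
      thus "(fst w - fst z, snd w - snd z) \<in> V l"
        using w z(1) assms by (auto simp: N_def V_def algebra_simps)
    qed
  qed (rule finite_V)
  thus ?thesis by (simp add: N_def)
qed (simp only: card.empty)

text \<open>Each \<open>l\<close> is determined by the point \<open>(a, x)\<close> from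
  \<open>card_V\<close>, and \<open>card (V l)\<close> is at most \<open>2 * M / m\<close> with
  \<open>m\<close> the larger of \<open>a\<close> and the modulus of \<open>x\<close>. Splitting
  \<open>m ^ 4\<close> into a square for \<open>a\<close> and a square for \<open>x\<close> leaves
  two convergent sums; \<open>160 = 16 * 2 * 5\<close>.\<close>

lemma sum_card_V_4: "(\<Sum>l\<in>{l. card (V l) \<ge> 2}. real (card (V l)) ^ 4) \<le> 160 * real M ^ 4"
proof -
  define G where "G = {l. card (V l) \<ge> 2}"
  have "\<forall>l\<in>G. \<exists>ax. 1 \<le> fst ax \<and> fst ax \<le> int H \<and> \<bar>snd ax\<bar> < int M \<and> of_int (snd ax) = l * of_int (fst ax) \<and>
      real (card (V l)) * max (real_of_int (fst ax)) \<bar>real_of_int (snd ax)\<bar> \<le> 2 * real M"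
    using card_V unfolding G_def by (metis fst_conv snd_conv mem_Collect_eq)
  then obtain \<psi> where \<psi>: "\<And>l. l \<in> G \<Longrightarrow> 1 \<le> fst (\<psi> l) \<and> fst (\<psi> l) \<le> int H \<and> \<bar>snd (\<psi> l)\<bar> < int M \<and>
      of_int (snd (\<psi> l)) = l * of_int (fst (\<psi> l)) \<and>
      real (card (V l)) * max (real_of_int (fst (\<psi> l))) \<bar>real_of_int (snd (\<psi> l))\<bar> \<le> 2 * real M"
    by metis
  define \<phi> where "\<phi> = (\<lambda>(a, x). 1 / (real_of_int a)\<^sup>2 * (1 / (max 1 \<bar>real_of_int x\<bar>)\<^sup>2))"
  have term_le: "real (card (V l)) ^ 4 \<le> 16 * real M ^ 4 * \<phi> (\<psi> l)" if l: "l \<in> G" for l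
  proof -
    obtain a x where ax: "\<psi> l = (a, x)" by (cases "\<psi> l")
    define m where "m = max (real_of_int a) \<bar>real_of_int x\<bar>"
    have a: "a \<ge> 1" and m: "real (card (V l)) * m \<le> 2 * real M" using \<psi>[OF l] by (auto simp: ax m_def)
    have m1: "m \<ge> real_of_int a" "m \<ge> max 1 \<bar>real_of_int x\<bar>" using a by (auto simp: m_def)
    have "real (card (V l)) ^ 4 * ((real_of_int a)\<^sup>2 * (max 1 \<bar>real_of_int x\<bar>)\<^sup>2) \<le> real (card (V l)) ^ 4 * (m\<^sup>2 * m\<^sup>2)"
      using m1 a by (intro mult_left_mono mult_mono power_mono) auto
    also have "\<dots> = (real (card (V l)) * m) ^ 4" by (simp add: power_mult_distrib flip: power_add)
    also have "\<dots> \<le> (2 * real M) ^ 4" using m m1(2) by (intro power_mono) auto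
    also have "\<dots> = 16 * real M ^ 4" by (simp add: power_mult_distrib)
    finally show ?thesis using a by (simp add: ax \<phi>_def field_simps)
  qed
  have inj: "inj_on \<psi> G"
  proof (rule inj_onI)
    fix l l' assume l: "l \<in> G" "l' \<in> G" "\<psi> l = \<psi> l'"
    have "(of_int (fst (\<psi> l)) :: 'k) \<noteq> 0"
    proof
      assume "(of_int (fst (\<psi> l)) :: 'k) = 0"
      moreover have "H \<le> 2 * H * M" using H by simp
      hence "\<bar>fst (\<psi> l)\<bar> < int CHAR('k)" using \<psi>[OF l(1)] HM by linarith
      ultimately have "fst (\<psi> l) = 0" by (rule of_int_eq_0_small)
      thus False using \<psi>[OF l(1)] by simp
    qed
    moreover have "l * of_int (fst (\<psi> l)) = l' * of_int (fst (\<psi> l))" using \<psi>[OF l(1)] \<psi>[OF l(2)] l(3) by metis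
    ultimately show "l = l'" by simp
  qed
  have le10: "(\<Sum>ax\<in>\<psi> ` G. \<phi> ax) \<le> 10"
  proof -
    have "(\<Sum>ax\<in>\<psi> ` G. \<phi> ax) \<le> (\<Sum>ax\<in>{1..int H} \<times> {- int M<..<int M}. \<phi> ax)"
    proof (rule sum_mono2)
      show "\<psi> ` G \<subseteq> {1..int H} \<times> {- int M<..<int M}"
      proof (rule image_subsetI)
        fix l assume "l \<in> G"
        from \<psi>[OF this] have "1 \<le> fst (\<psi> l)" "fst (\<psi> l) \<le> int H" "\<bar>snd (\<psi> l)\<bar> < int M" by blast+
        thus "\<psi> l \<in> {1..int H} \<times> {- int M<..<int M}" by (auto simp: mem_Times_iff)
      qed
    qed (auto simp: \<phi>_def)
    also have "\<dots> = (\<Sum>a\<in>{1..int H}. 1 / (real_of_int a)\<^sup>2) * (\<Sum>x\<in>{- int M<..<int M}. 1 / (max 1 \<bar>real_of_int x\<bar>)\<^sup>2)"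
      unfolding \<phi>_def sum_product sum.cartesian_product by simp
    also have "\<dots> \<le> 2 * 5"
      using sum_inverse_squares_le[of H] sum_inverse_squares_le'[of M] by (intro mult_mono) (auto intro: sum_nonneg)
    finally show ?thesis by simp
  qed
  have "(\<Sum>l\<in>G. real (card (V l)) ^ 4) \<le> (\<Sum>l\<in>G. 16 * real M ^ 4 * \<phi> (\<psi> l))" by (intro sum_mono term_le)
  also have "\<dots> = 16 * real M ^ 4 * (\<Sum>ax\<in>\<psi> ` G. \<phi> ax)"
    by (simp add: sum.reindex[OF inj] sum_distrib_left)
  also have "\<dots> \<le> 16 * real M ^ 4 * 10" by (intro mult_left_mono le10) auto
  finally show ?thesis by (simp add: G_def)
qed

end

locale burgess_box = finite_field_char \<chi> q e + small_box H M "TYPE('k)"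
  for \<chi> :: "'k :: finite_field \<Rightarrow> complex" and q e H M :: nat +
  fixes \<omega> :: 'k and \<alpha> \<beta> :: int and L1 L2 :: nat
  assumes indep: "of_int a + of_int b * \<omega> + of_int c * \<omega>\<^sup>2 = 0 \<Longrightarrow>
      of_int a = (0 :: 'k) \<and> of_int b = (0 :: 'k) \<and> of_int c = (0 :: 'k)"
    and L: "L1 \<le> M" "L2 \<le> M"
begin

definition el :: "int \<times> int \<Rightarrow> 'k" where "el z = of_int (fst z) + \<omega> * of_int (snd z)"

definition A :: "(int \<times> int) set" where "A = {\<alpha>..<\<alpha> + int L1} \<times> {\<beta>..<\<beta> + int L2}"

text \<open>Coprimality makes a pair determined by its ratio, so proportional elements of
  \<open>B\<close> coincide.\<close>

definition B :: "(int \<times> int) set" where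
  "B = {s \<in> {1..int H} \<times> {1..int H}. coprime (fst s) (snd s)}"

lemma finite_A: "finite A" and finite_B: "finite B" and card_A: "card A = L1 * L2"
  by (simp_all add: A_def B_def)

lemma card_B_le: "card B \<le> H\<^sup>2"
proof -
  have "card B \<le> card ({1..int H} \<times> {1..int H})" unfolding B_def by (intro card_mono) auto
  thus ?thesis by (simp add: power2_eq_square)
qed

lemma H_M_less: "int H < int CHAR('k)" "int M < int CHAR('k)" "int H * int H < int CHAR('k)"
proof -
  have "H \<le> 2 * H * M" "M \<le> 2 * H * M" using H by simp_all
  thus "int H < int CHAR('k)" "int M < int CHAR('k)" using HM by linarith+
  have "H * H \<le> 2 * H * M" using H by (simp add: mult_le_mono)
  hence "H * H < CHAR('k)" using HM by linarith
  thus "int H * int H < int CHAR('k)" by (metis of_nat_less_iff of_nat_mult)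
qed

lemma B_nonzero:
  assumes "s \<in> B"
  shows "of_int (fst s) \<noteq> (0 :: 'k)" "of_int (snd s) \<noteq> (0 :: 'k)" "el s \<noteq> 0"
proof -
  have ne: "of_int a \<noteq> (0 :: 'k)" if "a \<in> {1..int H}" for a
    using of_int_eq_0_small[of a, where 'a = 'k] that H_M_less(1) by auto
  show 1: "of_int (fst s) \<noteq> (0 :: 'k)" "of_int (snd s) \<noteq> (0 :: 'k)"
    using assms by (auto simp: B_def intro!: ne)
  show "el s \<noteq> 0"
    using indep[of "fst s" "snd s" 0] 1 by (auto simp: el_def mult.commute)
qed

lemma proportional_cases:
  assumes z: "z \<in> A" "z' \<in> A" and s: "s \<in> B" "s' \<in> B" and eq: "el z * el s' = el z' * el s"
  shows "(z = z' \<and> s = s') \<or> (\<exists>l :: 'k. of_int (fst z) = l * of_int (fst s) \<and> of_int (snd z) = l * of_int (snd s) \<and>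
     of_int (fst z') = l * of_int (fst s') \<and> of_int (snd z') = l * of_int (snd s'))"
proof -
  define u v u' v' where "u = (of_int (fst z) :: 'k)" and "v = (of_int (snd z) :: 'k)"
    and "u' = (of_int (fst z') :: 'k)" and "v' = (of_int (snd z') :: 'k)"
  define a b a' b' where "a = (of_int (fst s) :: 'k)" and "b = (of_int (snd s) :: 'k)"
    and "a' = (of_int (fst s') :: 'k)" and "b' = (of_int (snd s') :: 'k)"
  note defs = u_def v_def u'_def v'_def a_def b_def a'_def b'_def
  have nz: "a \<noteq> 0" "b \<noteq> 0" "a' \<noteq> 0" "b' \<noteq> 0" using B_nonzero s by (auto simp: defs)
  have "(u * a' - u' * a) + (u * b' + v * a' - u' * b - v' * a) * \<omega> + (v * b' - v' * b) * \<omega>\<^sup>2 = 0"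
    using eq by (simp add: el_def defs algebra_simps power2_eq_square)
  hence "u * a' - u' * a = 0 \<and> u * b' + v * a' - u' * b - v' * a = 0 \<and> v * b' - v' * b = 0"
    using indep[of "fst z * fst s' - fst z' * fst s"
        "fst z * snd s' + snd z * fst s' - fst z' * snd s - snd z' * fst s" "snd z * snd s' - snd z' * snd s"]
    by (simp add: defs)
  hence E: "u * a' = u' * a" "u * b' + v * a' = u' * b + v' * a" "v * b' = v' * b" by (auto simp: algebra_simps)
  \<comment> \<open>Unique factorization by evaluation: \<open>E\<close> equates two products of
    linear forms, and the form with coefficients \<open>a\<close>, \<open>b\<close> vanishes at
    \<open>(b, - a)\<close>, hence so does the other product.\<close>
  have "(u * b - v * a) * (a' * b - b' * a) = (u * a') * b\<^sup>2 - (u * b' + v * a') * (a * b) + (v * b') * a\<^sup>2"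
    by (simp add: algebra_simps power2_eq_square)
  also have "\<dots> = 0" unfolding E by (simp add: algebra_simps power2_eq_square)
  finally consider "u * b = v * a" | "a' * b = b' * a" by auto
  thus ?thesis
  proof cases
    case 1
    define l where "l = u / a"
    have "u = l * a" "v = l * b" using nz 1 by (simp_all add: l_def field_simps)
    moreover have "u' = l * a'" "v' = l * b'"
      using E(1,3) nz \<open>u = l * a\<close> \<open>v = l * b\<close> by (auto simp: algebra_simps)
    ultimately show ?thesis unfolding defs by blast
  next
    case 2
    have rng: "fst s \<in> {1..int H}" "snd s \<in> {1..int H}" "fst s' \<in> {1..int H}" "snd s' \<in> {1..int H}"
      and cop: "coprime (fst s) (snd s)" "coprime (fst s') (snd s')"
      using s by (auto simp: B_def)
    have "fst s' * snd s = snd s' * fst s"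
    proof (rule of_int_eq_small)
      show "(of_int (fst s' * snd s) :: 'k) = of_int (snd s' * fst s)" using 2 by (simp add: defs)
      have "0 \<le> fst s' * snd s" "fst s' * snd s \<le> int H * int H"
        "0 \<le> snd s' * fst s" "snd s' * fst s \<le> int H * int H"
        using rng by (auto intro!: mult_mono)
      thus "\<bar>fst s' * snd s - snd s' * fst s\<bar> < int CHAR('k)" using H_M_less(3) by linarith
    qed
    hence ss: "s = s'"
      using coprime_crossproduct_int[OF cop(1) coprime_commute[THEN iffD1, OF cop(2)]]
        coprime_crossproduct_int[OF cop] rng by (auto simp: prod_eq_iff mult.commute)
    hence "u = u'" "v = v'" using E(1,3) nz by (auto simp: defs)
    hence "fst z = fst z'" "snd z = snd z'"
      using z L H_M_less(2) unfolding defs A_def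
      by (auto intro!: of_int_eq_small[where 'a = 'k] simp: mem_Times_iff)
    thus ?thesis using ss by (simp add: prod_eq_iff)
  qed
qed

definition N :: "'k \<Rightarrow> ((int \<times> int) \<times> (int \<times> int)) set" where
  "N l = {(z, s) \<in> A \<times> B. of_int (fst z) = l * of_int (fst s) \<and> of_int (snd z) = l * of_int (snd s)}"

lemma finite_N: "finite (N l)"
  by (rule finite_subset[of _ "A \<times> B"]) (auto simp: N_def finite_A finite_B)

lemma card_N_le: "card (N l) \<le> card (V l) ^ 2"
proof -
  define NI where "NI = (\<lambda>\<gamma> L. {(a, x). a \<in> {1..int H} \<and> x \<in> {\<gamma>..<\<gamma> + int L} \<and> of_int x = l * (of_int a :: 'k)})"
  have finNI: "finite (NI \<gamma> L)" for \<gamma> L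
    by (rule finite_subset[of _ "{1..int H} \<times> {\<gamma>..<\<gamma> + int L}"]) (auto simp: NI_def)
  have "card (N l) \<le> card (NI \<alpha> L1 \<times> NI \<beta> L2)"
  proof (rule card_inj_on_le)
    show "inj_on (\<lambda>(z, s). ((fst s, fst z), (snd s, snd z))) (N l)"
      by (auto simp: inj_on_def prod_eq_iff)
    show "(\<lambda>(z, s). ((fst s, fst z), (snd s, snd z))) ` N l \<subseteq> NI \<alpha> L1 \<times> NI \<beta> L2"
      by (auto simp: N_def NI_def A_def B_def)
  qed (auto simp: finNI)
  also have "\<dots> = card (NI \<alpha> L1) * card (NI \<beta> L2)" by (rule card_cartesian_product)
  also have "\<dots> \<le> card (V l) * card (V l)"
    unfolding NI_def by (intro mult_le_mono card_translate_le L)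
  finally show ?thesis by (simp add: power2_eq_square)
qed

lemma sum_card_N: "(\<Sum>l\<in>S. card (N l)) \<le> card A * card B"
proof -
  have "(\<Sum>l\<in>S. card (N l)) = card (\<Union>l\<in>S. N l)"
  proof (rule card_UN_disjoint[symmetric])
    show "\<forall>l\<in>S. \<forall>l'\<in>S. l \<noteq> l' \<longrightarrow> N l \<inter> N l' = {}"
    proof (intro ballI impI)
      fix l l' :: 'k assume "l \<noteq> l'"
      show "N l \<inter> N l' = {}"
      proof (rule ccontr)
        assume "N l \<inter> N l' \<noteq> {}"
        then obtain z s where "(z, s) \<in> N l" "(z, s) \<in> N l'" by auto
        hence "l * of_int (fst s) = l' * of_int (fst s)" "s \<in> B" unfolding N_def by auto
        thus False using B_nonzero(1)[of s] \<open>l \<noteq> l'\<close> by simp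
      qed
    qed
  qed (auto simp: finite_N)
  also have "\<dots> \<le> card (A \<times> B)" by (rule card_mono) (auto simp: finite_A finite_B N_def)
  finally show ?thesis by (simp add: card_cartesian_product)
qed

text \<open>Where \<open>V l\<close> has at most one element, so has \<open>N l\<close>, and
  squaring its size changes nothing; such \<open>l\<close> are covered by the trivial count. The
  remaining ones fall under the fourth moment of \<open>card (V l)\<close>.\<close>

lemma sum_card_N_squared: "(\<Sum>l\<in>UNIV. real (card (N l)) ^ 2) \<le> real (card A * card B) + 160 * real M ^ 4"
proof -
  define G where "G = {l :: 'k. card (V l) \<ge> 2}"
  have "(\<Sum>l\<in>UNIV. real (card (N l)) ^ 2) = (\<Sum>l\<in>UNIV - G. real (card (N l)) ^ 2) + (\<Sum>l\<in>G. real (card (N l)) ^ 2)"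
    by (rule sum.subset_diff) auto
  also have "(\<Sum>l\<in>UNIV - G. real (card (N l)) ^ 2) \<le> (\<Sum>l\<in>UNIV - G. real (card (N l)))"
  proof (rule sum_mono)
    fix l assume "l \<in> UNIV - G"
    hence "card (V l) \<le> 1" by (simp add: G_def)
    hence "card (V l) ^ 2 \<le> 1 ^ 2" by (intro power_mono) auto
    hence "card (N l) \<le> 1" using card_N_le[of l] by simp
    thus "real (card (N l)) ^ 2 \<le> real (card (N l))" by (cases "card (N l)") auto
  qed
  also have "\<dots> \<le> real (card A * card B)" using sum_card_N[of "UNIV - G"] by (simp only: of_nat_sum[symmetric] of_nat_le_iff)
  also have "(\<Sum>l\<in>G. real (card (N l)) ^ 2) \<le> (\<Sum>l\<in>G. real (card (V l)) ^ 4)"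
  proof (rule sum_mono)
    fix l
    have "real (card (N l)) ^ 2 \<le> (real (card (V l)) ^ 2) ^ 2"
      using card_N_le[of l] by (intro power_mono) (simp_all flip: of_nat_power)
    thus "real (card (N l)) ^ 2 \<le> real (card (V l)) ^ 4" by (simp flip: power_mult)
  qed
  also have "\<dots> \<le> 160 * real M ^ 4" unfolding G_def by (rule sum_card_V_4)
  finally show ?thesis by simp
qed

definition \<nu> :: "'k \<Rightarrow> nat" where "\<nu> u = card {w \<in> A \<times> B. el (fst w) / el (snd w) = u}"

lemma sum_\<nu>: "(\<Sum>u\<in>UNIV. \<nu> u) = card A * card B"
proof -
  have "(\<Sum>u\<in>UNIV. \<nu> u) = card (\<Union>u\<in>UNIV. {w \<in> A \<times> B. el (fst w) / el (snd w) = u})"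
    unfolding \<nu>_def by (rule card_UN_disjoint[symmetric]) (auto simp: finite_A finite_B)
  also have "(\<Union>u\<in>UNIV. {w \<in> A \<times> B. el (fst w) / el (snd w) = u}) = A \<times> B" by auto
  finally show ?thesis by (simp add: card_cartesian_product)
qed

lemma sum_\<nu>_squared: "(\<Sum>u\<in>UNIV. real (\<nu> u) ^ 2) \<le> 2 * real (card A * card B) + 160 * real M ^ 4"
proof -
  define R where "R = (\<lambda>u. {w \<in> A \<times> B. el (fst w) / el (snd w) = u})"
  have finR: "finite (R u)" for u unfolding R_def by (simp add: finite_A finite_B)
  have "(\<Sum>u\<in>UNIV. \<nu> u ^ 2) = (\<Sum>u\<in>UNIV. card (R u \<times> R u))"
    by (simp add: \<nu>_def R_def card_cartesian_product power2_eq_square)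
  also have "\<dots> = card (\<Union>u\<in>UNIV. R u \<times> R u)"
    by (rule card_UN_disjoint[symmetric]) (auto simp: finR, auto simp: R_def)
  also have "\<dots> \<le> card ((\<lambda>w. (w, w)) ` (A \<times> B) \<union> (\<Union>l\<in>UNIV. N l \<times> N l))"
  proof (rule card_mono)
    show "finite ((\<lambda>w. (w, w)) ` (A \<times> B) \<union> (\<Union>l\<in>UNIV. N l \<times> N l))"
      by (simp add: finite_A finite_B finite_N)
    show "(\<Union>u\<in>UNIV. R u \<times> R u) \<subseteq> (\<lambda>w. (w, w)) ` (A \<times> B) \<union> (\<Union>l\<in>UNIV. N l \<times> N l)"
    proof clarify
      fix u z s z' s' assume w: "(z, s) \<in> R u" "(z', s') \<in> R u"
        and nd: "((z, s), (z', s')) \<notin> (\<Union>l\<in>UNIV. N l \<times> N l)"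
      have mem: "z \<in> A" "z' \<in> A" "s \<in> B" "s' \<in> B" using w by (auto simp: R_def)
      have "el z / el s = el z' / el s'" using w by (simp add: R_def)
      hence "el z * el s' = el z' * el s" using B_nonzero(3)[OF mem(3)] B_nonzero(3)[OF mem(4)] by (simp add: field_simps)
      from proportional_cases[OF mem this] have "(z, s) = (z', s')"
        using nd mem by (auto simp: N_def)
      thus "((z, s), (z', s')) \<in> (\<lambda>w. (w, w)) ` (A \<times> B)" using mem by auto
    qed
  qed
  also have "\<dots> \<le> card ((\<lambda>w. (w, w)) ` (A \<times> B)) + card (\<Union>l\<in>UNIV. N l \<times> N l)" by (rule card_Un_le)
  also have "card ((\<lambda>w. (w, w)) ` (A \<times> B)) \<le> card (A \<times> B)" by (rule card_image_le) (simp add: finite_A finite_B)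
  also have "card (\<Union>l\<in>UNIV. N l \<times> N l) \<le> (\<Sum>l\<in>UNIV. card (N l \<times> N l))" by (rule card_UN_le) simp
  finally have "(\<Sum>u\<in>UNIV. \<nu> u ^ 2) \<le> card A * card B + (\<Sum>l\<in>UNIV. card (N l) ^ 2)"
    by (simp add: card_cartesian_product power2_eq_square)
  hence "real (\<Sum>u\<in>UNIV. \<nu> u ^ 2) \<le> real (card A * card B + (\<Sum>l\<in>UNIV. card (N l) ^ 2))" by (simp only: of_nat_le_iff)
  thus ?thesis using sum_card_N_squared by simp
qed

end

section \<open>Amplification\<close>

lemma cauchy_schwarz_sum:
  fixes f g :: "'i \<Rightarrow> real"
  shows "(\<Sum>i\<in>S. f i * g i)\<^sup>2 \<le> (\<Sum>i\<in>S. (f i)\<^sup>2) * (\<Sum>i\<in>S. (g i)\<^sup>2)"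
proof -
  have sw: "(\<Sum>i\<in>S. \<Sum>j\<in>S. a j * b i) = (\<Sum>i\<in>S. a i) * (\<Sum>i\<in>S. b i)" for a b :: "'i \<Rightarrow> real"
    by (subst sum.swap) (simp add: sum_product)
  have sw': "(\<Sum>i\<in>S. \<Sum>j\<in>S. a i * b j) = (\<Sum>i\<in>S. a i) * (\<Sum>i\<in>S. b i)" for a b :: "'i \<Rightarrow> real"
    by (simp add: sum_product)
  have "0 \<le> (\<Sum>i\<in>S. \<Sum>j\<in>S. (f i * g j - f j * g i)\<^sup>2)" by (intro sum_nonneg) auto
  also have "\<dots> = (\<Sum>i\<in>S. \<Sum>j\<in>S. (f i)\<^sup>2 * (g j)\<^sup>2 + (f j)\<^sup>2 * (g i)\<^sup>2 - (2 * (f i * g i)) * (f j * g j))"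
    by (intro sum.cong refl) (simp add: power2_eq_square algebra_simps)
  also have "\<dots> = 2 * ((\<Sum>i\<in>S. (f i)\<^sup>2) * (\<Sum>i\<in>S. (g i)\<^sup>2)) - 2 * (\<Sum>i\<in>S. f i * g i)\<^sup>2"
    unfolding sum_subtractf sum.distrib sw[of "\<lambda>j. (f j)\<^sup>2"] sw'[of "\<lambda>j. (f j)\<^sup>2"] sw'[of "\<lambda>i. 2 * (f i * g i)"]
    by (simp add: power2_eq_square flip: sum_distrib_left)
  finally show ?thesis by simp
qed

lemma chebyshev_weighted_sum:
  fixes w g :: "'i \<Rightarrow> real"
  assumes "\<And>i. i \<in> S \<Longrightarrow> w i \<ge> 0" "\<And>i. i \<in> S \<Longrightarrow> g i \<ge> 0"
  shows "(\<Sum>i\<in>S. w i * g i) * (\<Sum>i\<in>S. w i * g i ^ r) \<le> (\<Sum>i\<in>S. w i) * (\<Sum>i\<in>S. w i * g i ^ Suc r)"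
proof -
  have "0 \<le> (\<Sum>i\<in>S. \<Sum>j\<in>S. w i * w j * ((g i - g j) * (g i ^ r - g j ^ r)))"
  proof (intro sum_nonneg)
    fix i j assume ij: "i \<in> S" "j \<in> S"
    have "0 \<le> (g i - g j) * (g i ^ r - g j ^ r)"
    proof (cases "g i \<le> g j")
      case True
      hence "g i ^ r \<le> g j ^ r" using assms(2)[OF ij(1)] by (rule power_mono)
      thus ?thesis using True by (intro mult_nonpos_nonpos) auto
    next
      case False
      hence "g j ^ r \<le> g i ^ r" using assms(2)[OF ij(2)] by (intro power_mono) auto
      thus ?thesis using False by (intro mult_nonneg_nonneg) auto
    qed
    thus "0 \<le> w i * w j * ((g i - g j) * (g i ^ r - g j ^ r))" using assms(1) ij by simp
  qed
  also have "\<dots> = (\<Sum>i\<in>S. \<Sum>j\<in>S. w j * (w i * g i ^ Suc r) + w i * (w j * g j ^ Suc r)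
      - (w i * g i) * (w j * g j ^ r) - (w j * g j) * (w i * g i ^ r))"
    by (intro sum.cong refl) (simp add: algebra_simps)
  also have "\<dots> = 2 * ((\<Sum>i\<in>S. w i) * (\<Sum>i\<in>S. w i * g i ^ Suc r)) - 2 * ((\<Sum>i\<in>S. w i * g i) * (\<Sum>i\<in>S. w i * g i ^ r))"
  proof -
    have sw: "(\<Sum>i\<in>S. \<Sum>j\<in>S. a j * b i) = (\<Sum>i\<in>S. a i) * (\<Sum>i\<in>S. b i)" for a b :: "'i \<Rightarrow> real"
      by (subst sum.swap) (simp add: sum_product)
    have sw': "(\<Sum>i\<in>S. \<Sum>j\<in>S. a i * b j) = (\<Sum>i\<in>S. a i) * (\<Sum>i\<in>S. b i)" for a b :: "'i \<Rightarrow> real"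
      by (simp add: sum_product)
    show ?thesis unfolding sum_subtractf sum.distrib sw[of w] sw[of "\<lambda>j. w j * g j"] sw'[of w] sw'[of "\<lambda>j. w j * g j"] by simp
  qed
  finally show ?thesis by simp
qed

lemma power_mean_weighted:
  fixes w g :: "'i \<Rightarrow> real"
  assumes w: "\<And>i. i \<in> S \<Longrightarrow> w i \<ge> 0" and g: "\<And>i. i \<in> S \<Longrightarrow> g i \<ge> 0"
  shows "(\<Sum>i\<in>S. w i * g i) ^ Suc r \<le> (\<Sum>i\<in>S. w i) ^ r * (\<Sum>i\<in>S. w i * g i ^ Suc r)"
proof (induction r)
  case (Suc r)
  have "(\<Sum>i\<in>S. w i * g i) ^ Suc (Suc r) \<le> (\<Sum>i\<in>S. w i * g i) * ((\<Sum>i\<in>S. w i) ^ r * (\<Sum>i\<in>S. w i * g i ^ Suc r))"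
    unfolding power_Suc[of _ "Suc r"] by (intro mult_left_mono Suc) (auto intro!: sum_nonneg mult_nonneg_nonneg w g)
  also have "\<dots> = (\<Sum>i\<in>S. w i) ^ r * ((\<Sum>i\<in>S. w i * g i) * (\<Sum>i\<in>S. w i * g i ^ Suc r))" by (simp only: mult_ac)
  also have "\<dots> \<le> (\<Sum>i\<in>S. w i) ^ r * ((\<Sum>i\<in>S. w i) * (\<Sum>i\<in>S. w i * g i ^ Suc (Suc r)))"
    by (intro mult_left_mono chebyshev_weighted_sum w g zero_le_power sum_nonneg)
  finally show ?case by (simp only: power_Suc mult_ac)
qed simp

text \<open>Power mean with exponent \<open>r\<close> first, Cauchy-Schwarz second: only the first
  two moments of \<open>w\<close> enter, and for \<open>w = \<nu>\<close> the second is the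
  multiplicative energy.\<close>

lemma holder_sum:
  fixes w g :: "'i \<Rightarrow> real"
  assumes w: "\<And>i. i \<in> S \<Longrightarrow> w i \<ge> 0" and g: "\<And>i. i \<in> S \<Longrightarrow> g i \<ge> 0" and r: "r > 0"
  shows "(\<Sum>i\<in>S. w i * g i) ^ (2 * r) \<le> (\<Sum>i\<in>S. w i) ^ (2 * r - 2) * ((\<Sum>i\<in>S. (w i)\<^sup>2) * (\<Sum>i\<in>S. g i ^ (2 * r)))"
proof -
  obtain k where k: "r = Suc k" using r by (cases r) auto
  have "(\<Sum>i\<in>S. w i * g i) ^ (2 * r) = ((\<Sum>i\<in>S. w i * g i) ^ Suc k)\<^sup>2" by (simp only: k power_mult[symmetric] mult.commute)
  also have "\<dots> \<le> ((\<Sum>i\<in>S. w i) ^ k * (\<Sum>i\<in>S. w i * g i ^ r))\<^sup>2"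
    unfolding k by (intro power_mono power_mean_weighted zero_le_power sum_nonneg mult_nonneg_nonneg w g)
  also have "\<dots> = (\<Sum>i\<in>S. w i) ^ (2 * r - 2) * (\<Sum>i\<in>S. w i * g i ^ r)\<^sup>2"
    by (simp add: k power_mult_distrib mult.commute flip: power_mult)
  also have "(\<Sum>i\<in>S. w i * g i ^ r)\<^sup>2 \<le> (\<Sum>i\<in>S. (w i)\<^sup>2) * (\<Sum>i\<in>S. (g i ^ r)\<^sup>2)" by (rule cauchy_schwarz_sum)
  also have "(\<Sum>i\<in>S. (g i ^ r)\<^sup>2) = (\<Sum>i\<in>S. g i ^ (2 * r))" by (simp add: mult.commute flip: power_mult)
  finally show ?thesis using w by (simp add: mult_left_mono sum_nonneg)
qed

lemma sum_shift_le:
  fixes f :: "int \<Rightarrow> complex"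
  assumes f: "\<And>x. norm (f x) \<le> C"
  shows "norm ((\<Sum>x\<in>{\<alpha>..<\<alpha> + int L}. f x) - (\<Sum>x\<in>{\<alpha>..<\<alpha> + int L}. f (x + int h))) \<le> 2 * real h * C"
proof -
  have sh: "(\<Sum>x\<in>{\<alpha>..<\<alpha> + int L}. f (x + int h)) = (\<Sum>x\<in>{\<alpha> + int h..<\<alpha> + int h + int L}. f x)"
    by (rule sum.reindex_bij_witness[of _ "\<lambda>x. x - int h" "\<lambda>x. x + int h"]) auto
  have un: "(\<Sum>x\<in>{a..<c}. f x) = (\<Sum>x\<in>{a..<b}. f x) + (\<Sum>x\<in>{b..<c}. f x)" if "a \<le> b" "b \<le> c" for a b c
  proof -
    have "{a..<c} = {a..<b} \<union> {b..<c}" using that by auto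
    thus ?thesis by (simp add: sum.union_disjoint)
  qed
  have len: "norm (\<Sum>x\<in>{a..<a + int h}. f x) \<le> real h * C" for a
    using sum_norm_bound[of "{a..<a + int h}" f C] f by simp
  have "(\<Sum>x\<in>{\<alpha>..<\<alpha> + int L}. f x) + (\<Sum>x\<in>{\<alpha> + int L..<\<alpha> + int L + int h}. f x) =
      (\<Sum>x\<in>{\<alpha>..<\<alpha> + int h}. f x) + (\<Sum>x\<in>{\<alpha> + int h..<\<alpha> + int h + int L}. f x)"
    using un[of \<alpha> "\<alpha> + int L" "\<alpha> + int L + int h"] un[of \<alpha> "\<alpha> + int h" "\<alpha> + int h + int L"] by (simp add: add_ac)
  hence "(\<Sum>x\<in>{\<alpha>..<\<alpha> + int L}. f x) - (\<Sum>x\<in>{\<alpha>..<\<alpha> + int L}. f (x + int h)) =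
      (\<Sum>x\<in>{\<alpha>..<\<alpha> + int h}. f x) - (\<Sum>x\<in>{\<alpha> + int L..<\<alpha> + int L + int h}. f x)"
    unfolding sh by (simp add: algebra_simps)
  also have "norm \<dots> \<le> real h * C + real h * C" using len by (intro norm_triangle_le_diff add_mono)
  finally show ?thesis by (simp add: mult_ac)
qed

context burgess_box
begin

text \<open>A pair that is not coprime has a common divisor \<open>d\<close> between
  \<open>2\<close> and \<open>H\<close>, at most \<open>(H / d) ^ 2\<close> pairs share a given
  \<open>d\<close>, and the sum over \<open>d\<close> is at most three quarters of all
  pairs.\<close>

lemma card_B_ge: "real (card B) \<ge> (real H)\<^sup>2 / 4"
proof -
  define Q where "Q = {1..int H} \<times> {1..int H}"
  define P where "P = (\<lambda>d :: int. {s \<in> Q. d dvd fst s \<and> d dvd snd s})"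
  have cardP: "real (card (P d)) \<le> (real H)\<^sup>2 * (1 / (real_of_int d)\<^sup>2)" if d: "d \<ge> 1" for d
  proof -
    define k where "k = int H div d"
    have k: "k \<ge> 0" using d by (simp add: k_def pos_imp_zdiv_nonneg_iff)
    have "P d \<subseteq> (\<lambda>(i, j). (d * i, d * j)) ` ({1..k} \<times> {1..k})"
    proof
      fix s assume s: "s \<in> P d"
      then obtain i j where ij: "s = (d * i, d * j)" by (cases s) (auto simp: P_def elim!: dvdE)
      have bd: "i \<in> {1..k}" if "d * i \<in> {1..int H}" for i
      proof -
        have "0 < d * i" using that by auto
        hence "i > 0" using d by (simp add: zero_less_mult_iff)
        moreover have "i \<le> k" using zdiv_mono1[of "d * i" "int H" d] that d by (simp add: k_def)
        ultimately show ?thesis by simp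
      qed
      have "d * i \<in> {1..int H}" "d * j \<in> {1..int H}" using s by (auto simp: P_def Q_def ij)
      thus "s \<in> (\<lambda>(i, j). (d * i, d * j)) ` ({1..k} \<times> {1..k})" using bd by (auto simp: ij)
    qed
    hence "card (P d) \<le> card ({1..k} \<times> {1..k})"
      by (meson card_image_le card_mono finite_SigmaI finite_atLeastAtMost_int finite_imageI le_trans)
    hence "card (P d) \<le> nat k * nat k" by (simp add: card_cartesian_product)
    hence "real (card (P d)) \<le> real (nat k * nat k)" by (simp only: of_nat_le_iff)
    also have "\<dots> = (real_of_int k)\<^sup>2" using k by (simp add: power2_eq_square)
    also have "real_of_int k \<le> real H / real_of_int d"
      unfolding k_def using real_of_int_div4[of "int H" d] by simp
    hence "(real_of_int k)\<^sup>2 \<le> (real H / real_of_int d)\<^sup>2" using k by (intro power_mono) auto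
    finally show ?thesis by (simp add: power_divide)
  qed
  have "Q \<subseteq> B \<union> (\<Union>d\<in>{2..int H}. P d)"
  proof
    fix s assume s: "s \<in> Q"
    define d where "d = gcd (fst s) (snd s)"
    have d: "d dvd fst s" "d dvd snd s" "d > 0" using s by (auto simp: d_def Q_def)
    hence "d \<le> int H" using s zdvd_imp_le[of d "fst s"] by (auto simp: Q_def)
    moreover have "s \<in> B" if "d = 1" using s that by (auto simp: B_def Q_def d_def coprime_iff_gcd_eq_1)
    ultimately show "s \<in> B \<union> (\<Union>d\<in>{2..int H}. P d)"
      using d s by (cases "d = 1") (auto simp: P_def intro!: bexI[of _ d])
  qed
  moreover have finP: "finite (P d)" for d by (simp add: P_def Q_def)
  ultimately have "card Q \<le> card (B \<union> (\<Union>d\<in>{2..int H}. P d))"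
    using finite_B by (intro card_mono) auto
  also have "\<dots> \<le> card B + card (\<Union>d\<in>{2..int H}. P d)" by (rule card_Un_le)
  also have "card (\<Union>d\<in>{2..int H}. P d) \<le> (\<Sum>d\<in>{2..int H}. card (P d))" by (rule card_UN_le) simp
  finally have "real (card Q) \<le> real (card B + (\<Sum>d\<in>{2..int H}. card (P d)))" by (simp only: of_nat_le_iff)
  hence "(real H)\<^sup>2 \<le> real (card B) + (\<Sum>d\<in>{2..int H}. real (card (P d)))"
    by (simp add: Q_def power2_eq_square)
  also have "(\<Sum>d\<in>{2..int H}. real (card (P d))) \<le> (\<Sum>d\<in>{2..int H}. (real H)\<^sup>2 * (1 / (real_of_int d)\<^sup>2))"
    by (intro sum_mono cardP) auto
  also have "\<dots> = (real H)\<^sup>2 * (\<Sum>d\<in>{2..int H}. 1 / (real_of_int d)\<^sup>2)" by (simp only: sum_distrib_left)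
  also have "(\<Sum>d\<in>{2..int H}. 1 / (real_of_int d)\<^sup>2) \<le> 3 / 4"
  proof -
    have "{1..int H} = insert 1 {2..int H}" using H by auto
    hence "(\<Sum>d\<in>{1..int H}. 1 / (real_of_int d)\<^sup>2) = 1 + (\<Sum>d\<in>{2..int H}. 1 / (real_of_int d)\<^sup>2)" by simp
    thus ?thesis using sum_inverse_squares_le[of H] by simp
  qed
  finally show ?thesis by (simp add: mult_left_mono)
qed

lemma box_shift_le:
  "cmod ((\<Sum>z\<in>A. \<chi> (el z)) - (\<Sum>z\<in>A. \<chi> (el (fst z + int h, snd z + int k)))) \<le> 2 * real h * real L2 + 2 * real k * real L1"
proof -
  define I J where "I = {\<alpha>..<\<alpha> + int L1}" and "J = {\<beta>..<\<beta> + int L2}"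
  have cart: "(\<Sum>z\<in>A. \<phi> (fst z) (snd z)) = (\<Sum>x\<in>I. \<Sum>y\<in>J. \<phi> x y)" for \<phi> :: "int \<Rightarrow> int \<Rightarrow> complex"
    unfolding A_def I_def J_def by (simp add: sum.cartesian_product case_prod_unfold)
  define F where "F = (\<lambda>x y. \<chi> (el (x, y)))"
  have F: "cmod (F x y) \<le> 1" for x y by (simp add: F_def norm_\<chi>_le)
  have 1: "cmod ((\<Sum>x\<in>I. \<Sum>y\<in>J. F x y) - (\<Sum>x\<in>I. \<Sum>y\<in>J. F (x + int h) y)) \<le> 2 * real h * real L2"
    unfolding I_def
  proof (rule sum_shift_le)
    fix x show "cmod (\<Sum>y\<in>J. F x y) \<le> real L2"
      using sum_norm_bound[of J "F x" 1] F by (simp add: J_def)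
  qed
  have "cmod ((\<Sum>x\<in>I. \<Sum>y\<in>J. F (x + int h) y) - (\<Sum>x\<in>I. \<Sum>y\<in>J. F (x + int h) (y + int k))) \<le> (\<Sum>x\<in>I. 2 * real k * 1)"
    unfolding J_def by (subst sum_subtractf[symmetric]) (intro sum_norm_le sum_shift_le F)
  hence 2: "cmod ((\<Sum>x\<in>I. \<Sum>y\<in>J. F (x + int h) y) - (\<Sum>x\<in>I. \<Sum>y\<in>J. F (x + int h) (y + int k))) \<le> 2 * real k * real L1"
    by (simp add: I_def mult_ac)
  have "(\<Sum>z\<in>A. \<chi> (el z)) = (\<Sum>x\<in>I. \<Sum>y\<in>J. F x y)" using cart[of F] by (simp add: F_def)
  moreover have "(\<Sum>z\<in>A. \<chi> (el (fst z + int h, snd z + int k))) = (\<Sum>x\<in>I. \<Sum>y\<in>J. F (x + int h) (y + int k))"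
    using cart[of "\<lambda>x y. F (x + int h) (y + int k)"] by (simp add: F_def)
  ultimately have "(\<Sum>z\<in>A. \<chi> (el z)) - (\<Sum>z\<in>A. \<chi> (el (fst z + int h, snd z + int k))) =
     ((\<Sum>x\<in>I. \<Sum>y\<in>J. F x y) - (\<Sum>x\<in>I. \<Sum>y\<in>J. F (x + int h) y)) +
     ((\<Sum>x\<in>I. \<Sum>y\<in>J. F (x + int h) y) - (\<Sum>x\<in>I. \<Sum>y\<in>J. F (x + int h) (y + int k)))" by simp
  also have "cmod \<dots> \<le> 2 * real h * real L2 + 2 * real k * real L1"
    by (intro norm_triangle_le add_mono 1 2)
  finally show ?thesis .
qed

definition S :: complex where "S = (\<Sum>z\<in>A. \<chi> (el z))"

text \<open>A shift by \<open>t * s\<close> changes at most \<open>T * H\<close> lines at either end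
  in each direction, each of length at most \<open>M\<close>; this is the loss
  \<open>4 * T * H * M\<close>. The factor \<open>\<chi> (el s)\<close> has modulus
  \<open>1\<close>, so what remains depends only on the quotient \<open>el z / el s\<close>.\<close>

lemma amplified_sum_le:
  fixes T :: nat
  shows "real T * real (card B) * (cmod S - 4 * real T * real H * real M) \<le>
    (\<Sum>u\<in>UNIV. real (\<nu> u) * cmod (\<Sum>t\<in>{1..T}. \<chi> (u + of_nat t)))"
proof -
  define g where "g = (\<lambda>u. cmod (\<Sum>t\<in>{1..T}. \<chi> (u + of_nat t)))"
  define sh where "sh = (\<lambda>z s t. (fst z + int t * fst s, snd z + int t * snd s) :: int \<times> int)"
  have el_sh: "el (sh z s t) = el z + of_nat t * el s" for z s t
    by (simp add: el_def sh_def algebra_simps)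
  have shift: "cmod (S - (\<Sum>z\<in>A. \<chi> (el (sh z s t)))) \<le> 4 * real T * real H * real M" if s: "s \<in> B" and t: "t \<in> {1..T}" for s t
  proof -
    define h k where "h = t * nat (fst s)" and "k = t * nat (snd s)"
    have hk: "int h = int t * fst s" "int k = int t * snd s" using s by (auto simp: h_def k_def B_def)
    have "h \<le> T * H" "k \<le> T * H" unfolding h_def k_def using s t by (auto simp: B_def intro!: mult_le_mono)
    hence hk': "real h \<le> real T * real H" "real k \<le> real T * real H" by (simp_all flip: of_nat_mult)
    have "cmod (S - (\<Sum>z\<in>A. \<chi> (el (sh z s t)))) \<le> 2 * real h * real L2 + 2 * real k * real L1"
      using box_shift_le[of h k] by (simp add: S_def sh_def hk)
    also have "\<dots> \<le> 2 * (real T * real H) * real M + 2 * (real T * real H) * real M"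
      using hk' L by (intro add_mono mult_mono) auto
    finally show ?thesis by (simp add: mult_ac)
  qed
  have "real T * real (card B) * cmod S = cmod (\<Sum>s\<in>B. \<Sum>t\<in>{1..T}. S)" by (simp add: norm_mult)
  also have "(\<Sum>s\<in>B. \<Sum>t\<in>{1..T}. S) = (\<Sum>s\<in>B. \<Sum>t\<in>{1..T}. S - (\<Sum>z\<in>A. \<chi> (el (sh z s t)))) + (\<Sum>s\<in>B. \<Sum>t\<in>{1..T}. \<Sum>z\<in>A. \<chi> (el (sh z s t)))"
    by (simp add: sum_subtractf)
  also have "cmod \<dots> \<le> (\<Sum>s\<in>B. \<Sum>t\<in>{1..T}. 4 * real T * real H * real M) + (\<Sum>u\<in>UNIV. real (\<nu> u) * g u)"
  proof (rule norm_triangle_le, rule add_mono)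
    show "cmod (\<Sum>s\<in>B. \<Sum>t\<in>{1..T}. S - (\<Sum>z\<in>A. \<chi> (el (sh z s t)))) \<le> (\<Sum>s\<in>B. \<Sum>t\<in>{1..T}. 4 * real T * real H * real M)"
      by (intro sum_norm_le shift)
    have "cmod (\<Sum>s\<in>B. \<Sum>t\<in>{1..T}. \<Sum>z\<in>A. \<chi> (el (sh z s t))) = cmod (\<Sum>s\<in>B. \<Sum>z\<in>A. \<Sum>t\<in>{1..T}. \<chi> (el (sh z s t)))"
      by (subst sum.swap[of _ A]) (rule refl)
    also have "\<dots> \<le> (\<Sum>s\<in>B. \<Sum>z\<in>A. g (el z / el s))"
    proof (intro sum_norm_le)
      fix s z assume s: "s \<in> B"
      have "(\<Sum>t\<in>{1..T}. \<chi> (el (sh z s t))) = (\<Sum>t\<in>{1..T}. \<chi> (el s) * \<chi> (el z / el s + of_nat t))"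
      proof (intro sum.cong refl)
        fix t
        have "el (sh z s t) = el s * (el z / el s + of_nat t)"
          using B_nonzero(3)[OF s] by (simp add: el_sh field_simps)
        thus "\<chi> (el (sh z s t)) = \<chi> (el s) * \<chi> (el z / el s + of_nat t)" by (simp only: \<chi>_mult)
      qed
      also have "\<dots> = \<chi> (el s) * (\<Sum>t\<in>{1..T}. \<chi> (el z / el s + of_nat t))" by (simp only: sum_distrib_left)
      finally show "cmod (\<Sum>t\<in>{1..T}. \<chi> (el (sh z s t))) \<le> g (el z / el s)"
        using B_nonzero(3)[OF s] by (simp add: norm_mult norm_\<chi> g_def)
    qed
    also have "\<dots> = (\<Sum>w\<in>A \<times> B. g (el (fst w) / el (snd w)))"
      by (subst sum.swap) (simp add: sum.cartesian_product case_prod_unfold)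
    also have "\<dots> = (\<Sum>u\<in>UNIV. \<Sum>w\<in>{w \<in> A \<times> B. el (fst w) / el (snd w) = u}. g (el (fst w) / el (snd w)))"
      by (rule sum.group[symmetric]) (auto simp: finite_A finite_B)
    also have "\<dots> = (\<Sum>u\<in>UNIV. real (\<nu> u) * g u)" by (simp add: \<nu>_def)
    finally show "cmod (\<Sum>s\<in>B. \<Sum>t\<in>{1..T}. \<Sum>z\<in>A. \<chi> (el (sh z s t))) \<le> (\<Sum>u\<in>UNIV. real (\<nu> u) * g u)" .
  qed
  finally show ?thesis by (simp add: g_def algebra_simps)
qed

lemma burgess_inequality:
  assumes T: "T \<ge> 1" "T < CHAR('k)" and r: "r > 0" and D: "cmod S \<ge> 4 * real T * real H * real M"
  shows "(cmod S - 4 * real T * real H * real M) ^ (2 * r) * real H ^ 4 \<le>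
    2592 * real M ^ 4 * (real L1 * real L2) ^ (2 * r - 2) *
      (real r ^ (2 * r) * real q / real T ^ r + 2 * real r * sqrt (real q))"
proof -
  define D where "D = cmod S - 4 * real T * real H * real M"
  define b where "b = real (card B)"
  define Y where "Y = real r ^ (2 * r) * real q / real T ^ r + 2 * real r * sqrt (real q)"
  define t where "t = real T"
  define l where "l = real L1 * real L2"
  have t0: "t > 0" using T by (simp add: t_def)
  have D0: "D \<ge> 0" using assms by (simp add: D_def)
  have Y0: "Y \<ge> 0" by (simp add: Y_def)
  have l0: "l \<ge> 0" by (simp add: l_def)
  have bH: "b \<ge> (real H)\<^sup>2 / 4" using card_B_ge by (simp add: b_def)
  have "(real H)\<^sup>2 / 4 > 0" using H by simp
  hence b0: "b > 0" using bH by linarith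
  obtain k where k: "2 * r = k + 2" using r by (intro that[of "2 * r - 2"]) simp
  \<comment> \<open>\<open>162 = 2 + 160\<close>: both \<open>A\<close> and \<open>B\<close> have at
    most \<open>M * M\<close> elements, so the diagonal terms are bounded by \<open>M ^ 4\<close>
    too.\<close>
  have sumsq: "(\<Sum>u\<in>UNIV. (real (\<nu> u))\<^sup>2) \<le> 162 * real M ^ 4"
  proof -
    have "card B \<le> M * M"
      using card_B_le mult_le_mono[OF H(2) H(2)] by (simp add: power2_eq_square)
    hence "card A * card B \<le> (M * M) * (M * M)" unfolding card_A by (intro mult_le_mono L)
    hence "real (card A * card B) \<le> real ((M * M) * (M * M))" by (simp only: of_nat_le_iff)
    also have "\<dots> = real M ^ 4" by (simp add: power4_eq_xxxx)
    finally show ?thesis using sum_\<nu>_squared by simp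
  qed
  have mom: "(\<Sum>u\<in>UNIV. cmod (\<Sum>t\<in>{1..T}. \<chi> (u + of_nat t)) ^ (2 * r)) \<le> t ^ (2 * r) * Y"
  proof -
    have e: "t ^ (2 * r) = t ^ r * t ^ r" by (simp add: mult_2 power_add)
    have "t ^ (2 * r) * (x / t ^ r) = x * t ^ r" for x using t0 by (simp add: e)
    hence "t ^ (2 * r) * Y = real r ^ (2 * r) * real q * t ^ r + t ^ (2 * r) * (2 * real r * sqrt (real q))"
      unfolding Y_def t_def[symmetric] distrib_left by (simp only:)
    also have "\<dots> = real r ^ (2 * r) * t ^ r * real q + 2 * real r * sqrt (real q) * t ^ (2 * r)"
      by (simp only: mult_ac)
    finally show ?thesis using moment_bound[OF T(2), of r] by (simp only: t_def)
  qed
  have "(t * b * D) ^ (2 * r) \<le> (\<Sum>u\<in>UNIV. real (\<nu> u) * cmod (\<Sum>t\<in>{1..T}. \<chi> (u + of_nat t))) ^ (2 * r)"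
    using amplified_sum_le[of T] t0 b0 D0 by (intro power_mono) (auto simp: t_def b_def D_def)
  also have "\<dots> \<le> (\<Sum>u\<in>UNIV. real (\<nu> u)) ^ (2 * r - 2) * ((\<Sum>u\<in>UNIV. (real (\<nu> u))\<^sup>2) * (\<Sum>u\<in>UNIV. cmod (\<Sum>t\<in>{1..T}. \<chi> (u + of_nat t)) ^ (2 * r)))"
    by (rule holder_sum) (use r in auto)
  also have "(\<Sum>u\<in>UNIV. real (\<nu> u)) = l * b"
    unfolding of_nat_sum[symmetric] sum_\<nu> card_A by (simp add: l_def b_def)
  also have "(l * b) ^ (2 * r - 2) * ((\<Sum>u\<in>UNIV. (real (\<nu> u))\<^sup>2) * (\<Sum>u\<in>UNIV. cmod (\<Sum>t\<in>{1..T}. \<chi> (u + of_nat t)) ^ (2 * r)))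
      \<le> (l * b) ^ (2 * r - 2) * ((162 * real M ^ 4) * (t ^ (2 * r) * Y))"
    using l0 b0 by (intro mult_left_mono mult_mono sumsq mom) (auto intro: sum_nonneg)
  finally have "t ^ (2 * r) * b ^ k * (b\<^sup>2 * D ^ (2 * r)) \<le> t ^ (2 * r) * b ^ k * (162 * real M ^ 4 * l ^ k * Y)"
    unfolding k by (simp add: power_mult_distrib power_add power2_eq_square mult_ac)
  hence main: "b\<^sup>2 * D ^ (2 * r) \<le> 162 * real M ^ 4 * l ^ k * Y"
    using t0 b0 by (subst (asm) mult_le_cancel_left_pos) auto
  \<comment> \<open>The factor \<open>16\<close> in \<open>2592 = 16 * 162\<close> is the square of
    the \<open>4\<close> in \<open>card_B_ge\<close>.\<close>
  have "((real H)\<^sup>2 / 4)\<^sup>2 \<le> b\<^sup>2" using bH by (intro power_mono) auto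
  hence "((real H)\<^sup>2 / 4)\<^sup>2 * D ^ (2 * r) \<le> b\<^sup>2 * D ^ (2 * r)" using D0 by (intro mult_right_mono) auto
  also note main
  finally have "D ^ (2 * r) * real H ^ 4 \<le> 16 * (162 * real M ^ 4 * l ^ k * Y)"
    by (simp add: power_divide mult.commute flip: power_mult)
  moreover have "k = 2 * r - 2" using k by simp
  ultimately show ?thesis unfolding D_def Y_def l_def by simp
qed

end

section \<open>Fields of cubic order\<close>

text \<open>Translation by \<open>1\<close> permutes the field; comparing the sums of all elements
  shows that the characteristic divides the order.\<close>

lemma CHAR_eq_of_card:
  assumes "card (UNIV :: 'k :: finite_field set) = p ^ n" "prime p"
  shows "CHAR('k) = p"
proof -
  have "(\<Sum>x\<in>(UNIV :: 'k set). x) = (\<Sum>x\<in>(UNIV :: 'k set). x + 1)"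
    by (rule sum.reindex_bij_witness[of _ "\<lambda>x. x + 1" "\<lambda>x. x - 1"]) auto
  hence "(of_nat (card (UNIV :: 'k set)) :: 'k) = 0" by (simp add: sum.distrib)
  hence "CHAR('k) dvd p ^ n" unfolding assms(1) of_nat_eq_0_iff_char_dvd .
  moreover have "prime CHAR('k)" by simp
  ultimately show ?thesis using assms(2) by (metis prime_dvd_power primes_dvd_imp_eq)
qed

lemma frobenius_fixed_iff: "(x :: 'k :: finite_field) ^ CHAR('k) = x \<longleftrightarrow> x \<in> range of_int"
proof -
  let ?p = "CHAR('k)"
  have p: "prime ?p" by simp
  have frob: "(x + y :: 'k) ^ ?p = x ^ ?p + y ^ ?p" for x y by (rule freshmans_dream) simp_all
  define f :: "'k poly" where "f = monom 1 ?p + [:0, -1:]"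
  have deg: "degree f = ?p"
    unfolding f_def by (subst degree_add_eq_left) (use prime_gt_1_nat[OF p] in \<open>auto simp: degree_monom_eq\<close>)
  have f0: "f \<noteq> 0" using deg by auto
  have roots: "{x. x ^ ?p = x} = {x. poly f x = 0}" by (auto simp: f_def poly_monom)
  have of_nat_fixed: "(of_nat n :: 'k) ^ ?p = of_nat n" for n
    by (induction n) (simp_all add: frob power_0_left)
  have "(- x) ^ ?p = - (x ^ ?p)" for x :: 'k
    using frob[of x "- x"] by (simp add: power_0_left add_eq_0_iff2)
  hence fixed: "(of_int n :: 'k) ^ ?p = of_int n" for n
    using of_nat_fixed by (cases n rule: int_cases2) auto
  have "inj_on (of_int :: int \<Rightarrow> 'k) {0..<int ?p}"
    by (intro inj_onI of_int_eq_small[where 'a = 'k]) auto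
  hence "card (of_int ` {0..<int ?p} :: 'k set) = ?p" by (simp add: card_image)
  moreover have "card {x :: 'k. x ^ ?p = x} \<le> ?p"
    unfolding roots using card_poly_roots_bound[OF f0] deg by simp
  moreover have "of_int ` {0..<int ?p} \<subseteq> {x :: 'k. x ^ ?p = x}" using fixed by auto
  ultimately have "of_int ` {0..<int ?p} = {x :: 'k. x ^ ?p = x}" by (intro card_seteq) auto
  thus ?thesis using fixed by blast
qed

text \<open>
  If \<open>\<omega>\<close> were quadratic over the prime field, then Frobenius would swap the two roots of its minimal
  polynomial, which is impossible because the third iterate of Frobenius is the identity.
\<close>
lemma cubic_independent:
  fixes \<omega> :: "'k :: finite_field"
  assumes card: "card (UNIV :: 'k set) = CHAR('k) ^ 3" and \<omega>: "\<omega> \<notin> range of_int"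
    and eq: "of_int a + of_int b * \<omega> + of_int c * \<omega>\<^sup>2 = 0"
  shows "of_int a = (0 :: 'k) \<and> of_int b = (0 :: 'k) \<and> of_int c = (0 :: 'k)"
proof -
  let ?p = "CHAR('k)"
  define \<sigma> where "\<sigma> = (\<lambda>x :: 'k. x ^ ?p)"
  have add: "\<sigma> (x + y) = \<sigma> x + \<sigma> y" for x y unfolding \<sigma>_def by (rule freshmans_dream) simp_all
  have zero: "\<sigma> 0 = 0" by (simp add: \<sigma>_def power_0_left)
  have neg: "\<sigma> (- x) = - \<sigma> x" for x using add[of x "- x"] by (simp add: zero add_eq_0_iff2)
  have mult: "\<sigma> (x * y) = \<sigma> x * \<sigma> y" for x y by (simp add: \<sigma>_def power_mult_distrib)
  have quot: "\<sigma> (x / y) = \<sigma> x / \<sigma> y" for x y by (simp add: \<sigma>_def power_divide)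
  have int: "\<sigma> (of_int n) = of_int n" for n unfolding \<sigma>_def frobenius_fixed_iff by simp
  have moved: "\<sigma> \<omega> \<noteq> \<omega>" using \<omega> by (simp add: \<sigma>_def frobenius_fixed_iff)
  have cube: "\<sigma> (\<sigma> (\<sigma> \<omega>)) = \<omega>"
    using finite_field_power_card_eq_same[of \<omega>] card by (simp add: \<sigma>_def power3_eq_cube flip: power_mult)
  have c: "of_int c = (0 :: 'k)"
  proof (rule ccontr)
    assume c: "of_int c \<noteq> (0 :: 'k)"
    define u v where "u = (of_int b / of_int c :: 'k)" and "v = (of_int a / of_int c :: 'k)"
    have uv: "\<sigma> u = u" "\<sigma> v = v" by (simp_all add: u_def v_def quot int)
    have "\<omega> * \<omega> + u * \<omega> + v = (of_int a + of_int b * \<omega> + of_int c * \<omega>\<^sup>2) / of_int c"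
      using c by (simp add: u_def v_def field_simps power2_eq_square)
    hence q: "\<omega> * \<omega> + u * \<omega> + v = 0" by (simp add: eq)
    have "\<sigma> \<omega> * \<sigma> \<omega> + u * \<sigma> \<omega> + v = \<sigma> (\<omega> * \<omega> + u * \<omega> + v)" by (simp add: add mult uv)
    hence "\<sigma> \<omega> * \<sigma> \<omega> + u * \<sigma> \<omega> + v = 0" by (simp add: q zero)
    moreover have "(\<sigma> \<omega> - \<omega>) * (\<sigma> \<omega> + \<omega> + u) = (\<sigma> \<omega> * \<sigma> \<omega> + u * \<sigma> \<omega> + v) - (\<omega> * \<omega> + u * \<omega> + v)"
      by (simp add: algebra_simps)
    ultimately have "(\<sigma> \<omega> - \<omega>) * (\<sigma> \<omega> + \<omega> + u) = 0" using q by (simp only: diff_self)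
    hence "\<sigma> \<omega> + (\<omega> + u) = 0" using moved by (simp add: add.assoc)
    hence "\<sigma> \<omega> = - (\<omega> + u)" by (simp only: eq_neg_iff_add_eq_0)
    hence "\<sigma> \<omega> = - \<omega> + - u" by simp
    hence "\<sigma> (\<sigma> \<omega>) = \<omega>" by (simp only: add neg uv) simp
    thus False using cube moved by simp
  qed
  moreover have b: "of_int b = (0 :: 'k)"
  proof (rule ccontr)
    assume b: "of_int b \<noteq> (0 :: 'k)"
    have "\<omega> * of_int b = - of_int a" using eq c by (simp add: eq_neg_iff_add_eq_0 mult.commute add.commute)
    hence "\<omega> = - of_int a / of_int b" using b by (simp add: field_simps)
    hence "\<sigma> \<omega> = \<omega>" by (simp add: quot neg int)
    thus False using moved by simp
  qed
  ultimately show ?thesis using eq by simp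
qed

subsection \<open>The inequality for fields as records\<close>

abbreviation box_sum :: "('a, 'b) ring_scheme \<Rightarrow> ('a \<Rightarrow> complex) \<Rightarrow> 'a \<Rightarrow> int \<Rightarrow> nat \<Rightarrow> int \<Rightarrow> nat \<Rightarrow> complex" where
  "box_sum K \<chi> \<omega> \<alpha> L1 \<beta> L2 \<equiv>
    \<Sum>x\<in>{\<alpha>..<\<alpha> + int L1}. \<Sum>y\<in>{\<beta>..<\<beta> + int L2}. \<chi> (of_int_in K x \<oplus>\<^bsub>K\<^esub> \<omega> \<otimes>\<^bsub>K\<^esub> of_int_in K y)"

text \<open>
  The explicit, non-asymptotic form of the character sum estimate; it is stated for records because
  it is first proved for field types and then carried over by isomorphisms.
\<close>
definition burgess_bound :: "('a, 'b) ring_scheme \<Rightarrow> bool" where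
  "burgess_bound K \<longleftrightarrow> (\<forall>p. prime p \<and> card (carrier K) = p ^ 3 \<longrightarrow>
    (\<forall>m n. of_int_in K m = of_int_in K n \<longleftrightarrow> int p dvd m - n) \<and>
    (\<forall>\<chi> \<omega> \<alpha> \<beta> (L1 :: nat) (L2 :: nat) (M :: nat) (H :: nat) (T :: nat) r.
      mult_character K \<chi> \<and> nontrivial_character K \<chi> \<and> \<omega> \<in> carrier K - prime_subfield K \<and>
      1 \<le> H \<and> H \<le> M \<and> 2 * H * M < p \<and> L1 \<le> M \<and> L2 \<le> M \<and> 1 \<le> T \<and> T < p \<and> 0 < r \<and>
      4 * real T * real H * real M \<le>
        cmod (box_sum K \<chi> \<omega> \<alpha> L1 \<beta> L2) \<longrightarrow>
      (cmod (box_sum K \<chi> \<omega> \<alpha> L1 \<beta> L2)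
         - 4 * real T * real H * real M) ^ (2 * r) * real H ^ 4 \<le>
      2592 * real M ^ 4 * (real L1 * real L2) ^ (2 * r - 2) *
        (real r ^ (2 * r) * real (p ^ 3) / real T ^ r + 2 * real r * sqrt (real (p ^ 3)))))"

lemma of_int_in_type:
  "of_int_in (ring_of_type_algebra :: 'k :: Fields.field ring) n = of_int n"
proof -
  let ?R = "ring_of_type_algebra :: 'k ring"
  interpret R: Ring.ring ?R by (rule ring_from_type_algebra)
  have ops: "x \<oplus>\<^bsub>?R\<^esub> y = x + y" "\<one>\<^bsub>?R\<^esub> = 1" "\<zero>\<^bsub>?R\<^esub> = 0" "carrier ?R = UNIV" for x y
    by (simp_all add: ring_of_type_algebra_def)
  have nat: "[k] \<cdot>\<^bsub>?R\<^esub> (1 :: 'k) = of_nat k" for k :: nat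
    by (induction k) (simp_all add: ops R.add.nat_pow_Suc add.commute)
  have inv: "\<ominus>\<^bsub>?R\<^esub> x = - x" for x
    by (rule R.minus_equality[symmetric, THEN sym]) (simp_all add: ops)
  show ?thesis
    using nat[of "nat n"] nat[of "nat (- n)"] inv
    unfolding of_int_in_def ops add_pow_def int_pow_def2 a_inv_def by (cases "n < 0") simp_all
qed

lemma burgess_bound_type: "burgess_bound (ring_of_type_algebra :: 'k :: finite_field ring)"
  unfolding burgess_bound_def
proof (intro allI impI conjI)
  let ?R = "ring_of_type_algebra :: 'k ring"
  have ops: "x \<oplus>\<^bsub>?R\<^esub> y = x + y" "x \<otimes>\<^bsub>?R\<^esub> y = x * y" "\<one>\<^bsub>?R\<^esub> = 1" "\<zero>\<^bsub>?R\<^esub> = 0" "carrier ?R = UNIV" for x y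
    by (simp_all add: ring_of_type_algebra_def)
  fix p assume p: "prime p \<and> card (carrier ?R) = p ^ 3"
  have card: "card (UNIV :: 'k set) = p ^ 3" using p by (simp add: ops)
  have CHAR: "CHAR('k) = p" using CHAR_eq_of_card[OF card] p by blast
  {
    fix m n show "of_int_in ?R m = of_int_in ?R n \<longleftrightarrow> int p dvd m - n"
    proof -
      have "(of_int m :: 'k) = of_int n \<longleftrightarrow> (of_int (m - n) :: 'k) = 0" by simp
      also have "\<dots> \<longleftrightarrow> (of_nat (nat \<bar>m - n\<bar>) :: 'k) = 0"
        by (cases "m - n \<ge> 0") (auto simp del: of_int_diff simp: algebra_simps, auto)
      also have "\<dots> \<longleftrightarrow> p dvd nat \<bar>m - n\<bar>" unfolding CHAR[symmetric] by (rule of_nat_eq_0_iff_char_dvd)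
      also have "\<dots> \<longleftrightarrow> int p dvd int (nat \<bar>m - n\<bar>)" by (simp only: int_dvd_int_iff)
      also have "\<dots> \<longleftrightarrow> int p dvd m - n" by simp
      finally show ?thesis by (simp add: of_int_in_type)
    qed
  next
    fix \<chi> :: "'k \<Rightarrow> complex" and \<omega> :: 'k and \<alpha> \<beta> :: int and L1 L2 M H T r :: nat
    let ?S = "box_sum ?R \<chi> \<omega> \<alpha> L1 \<beta> L2"
    assume asm: "mult_character ?R \<chi> \<and> nontrivial_character ?R \<chi> \<and> \<omega> \<in> carrier ?R - prime_subfield ?R \<and>
      1 \<le> H \<and> H \<le> M \<and> 2 * H * M < p \<and> L1 \<le> M \<and> L2 \<le> M \<and> 1 \<le> T \<and> T < p \<and> 0 < r \<and>
      4 * real T * real H * real M \<le> cmod ?S"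
    have \<chi>0: "\<chi> 0 = 0" using asm by (simp add: mult_character_def ops)
    have \<chi>hom: "\<chi> (x * y) = \<chi> x * \<chi> y" "\<chi> x \<noteq> 0" if "x \<noteq> 0" "y \<noteq> 0" for x y
      using asm that by (auto simp: mult_character_def hom_def complex_mult_group_def ops Pi_def)
    have \<chi>m: "\<chi> (x * y) = \<chi> x * \<chi> y" for x y using \<chi>hom[of x y] by (cases "x = 0 \<or> y = 0") (auto simp: \<chi>0)
    have \<chi>1: "\<chi> 1 = 1" using \<chi>m[of 1 1] \<chi>hom(2)[of 1 1] by simp
    have w: "\<omega> \<notin> range of_int" using asm by (auto simp: prime_subfield_def of_int_in_type)
    interpret burgess_box \<chi> "p ^ 3" 3 H M \<omega> \<alpha> \<beta> L1 L2
    proof unfold_locales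
      show "3 \<le> p ^ 3"
      proof -
        have "2 ^ 3 \<le> p ^ 3" using p prime_ge_2_nat by (intro power_mono) auto
        thus ?thesis by simp
      qed
      show "\<exists>x. x \<noteq> 0 \<and> \<chi> x \<noteq> 1" using asm by (auto simp: nontrivial_character_def ops)
      fix a b c assume "of_int a + of_int b * \<omega> + of_int c * \<omega>\<^sup>2 = 0"
      thus "of_int a = (0 :: 'k) \<and> of_int b = (0 :: 'k) \<and> of_int c = (0 :: 'k)"
        using w card by (intro cubic_independent) (simp_all add: CHAR)
    qed (use asm card in \<open>simp_all add: CHAR \<chi>m \<chi>0 \<chi>1\<close>)
    have "S = ?S"
      by (simp add: S_def A_def el_def sum.cartesian_product case_prod_unfold of_int_in_type ops)
    thus "(cmod ?S - 4 * real T * real H * real M) ^ (2 * r) * real H ^ 4 \<le>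
      2592 * real M ^ 4 * (real L1 * real L2) ^ (2 * r - 2) *
        (real r ^ (2 * r) * real (p ^ 3) / real T ^ r + 2 * real r * sqrt (real (p ^ 3)))"
      using burgess_inequality[of T r] asm by (simp only: CHAR)
  }
qed

lemma ring_iso_of_int_in:
  assumes "Ring.ring R" "Ring.ring K" "h \<in> ring_hom R K"
  shows "h (of_int_in R n) = of_int_in K n"
proof -
  interpret R: Ring.ring R by fact
  interpret K: Ring.ring K by fact
  interpret h: ring_hom_ring R K h by (rule ring_hom_ringI2[OF assms])
  have "h (pow (add_monoid R) \<one>\<^bsub>R\<^esub> n) = pow (add_monoid K) (h \<one>\<^bsub>R\<^esub>) n"
    by (rule group_hom.hom_int_pow[OF h.a_group_hom]) simp
  thus ?thesis by (simp add: of_int_in_def add_pow_def)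
qed

lemma burgess_bound_iso:
  fixes R :: "('a, 'b) ring_scheme" and K :: "('c, 'd) ring_scheme"
  assumes R: "Ring.field R" and K: "Ring.field K" and h: "h \<in> ring_iso R K" and bd: "burgess_bound R"
  shows "burgess_bound K"
proof -
  interpret R: Ring.field R by fact
  interpret K: Ring.field K by fact
  have hh: "h \<in> ring_hom R K" and bij: "bij_betw h (carrier R) (carrier K)" using h by (auto simp: ring_iso_def)
  interpret h: ring_hom_ring R K h by (rule ring_hom_ringI2[OF R.ring_axioms K.ring_axioms hh])
  have card: "card (carrier R) = card (carrier K)" using bij by (rule bij_betw_same_card)
  have int: "h (of_int_in R n) = of_int_in K n" for n
    by (rule ring_iso_of_int_in[OF R.ring_axioms K.ring_axioms hh])
  have intR: "of_int_in R n \<in> carrier R" for n by (simp add: of_int_in_def)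
  have inj: "h x = h y \<longleftrightarrow> x = y" if "x \<in> carrier R" "y \<in> carrier R" for x y
    using bij that by (auto simp: bij_betw_def inj_on_def)
  have onto: "\<exists>x\<in>carrier R. y = h x" if "y \<in> carrier K" for y using bij that by (auto simp: bij_betw_def)
  show ?thesis
    unfolding burgess_bound_def
  proof (intro allI impI conjI)
    fix p assume p: "prime p \<and> card (carrier K) = p ^ 3"
    note bdp = bd[unfolded burgess_bound_def, rule_format, of p, unfolded card, OF p]
    {
      fix m n
      show "of_int_in K m = of_int_in K n \<longleftrightarrow> int p dvd m - n"
        using bdp inj[OF intR intR] by (simp flip: int)
    next
      fix \<chi> :: "'c \<Rightarrow> complex" and \<omega> :: 'c and \<alpha> \<beta> :: int and L1 L2 M H T r :: nat
      let ?S = "box_sum K \<chi> \<omega> \<alpha> L1 \<beta> L2"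
      assume asm: "mult_character K \<chi> \<and> nontrivial_character K \<chi> \<and> \<omega> \<in> carrier K - prime_subfield K \<and>
        1 \<le> H \<and> H \<le> M \<and> 2 * H * M < p \<and> L1 \<le> M \<and> L2 \<le> M \<and> 1 \<le> T \<and> T < p \<and> 0 < r \<and>
        4 * real T * real H * real M \<le> cmod ?S"
      obtain w where w: "w \<in> carrier R" "\<omega> = h w" using onto asm by blast
      have "w \<notin> prime_subfield R" using asm w int by (auto simp: prime_subfield_def)
      moreover have "mult_character R (\<chi> \<circ> h)"
      proof -
        have "h x \<in> carrier K - {\<zero>\<^bsub>K\<^esub>}" if "x \<in> carrier R - {\<zero>\<^bsub>R\<^esub>}" for x
          using that inj[of x "\<zero>\<^bsub>R\<^esub>"] by auto
        moreover have "\<chi> \<in> hom (Multiplicative_Group.mult_of K) complex_mult_group" "\<chi> \<zero>\<^bsub>K\<^esub> = 0"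
          using asm by (auto simp: mult_character_def)
        ultimately show ?thesis by (simp add: mult_character_def hom_def Pi_def)
      qed
      moreover have "nontrivial_character R (\<chi> \<circ> h)"
      proof -
        have "nontrivial_character K \<chi>" using asm by blast
        then obtain y where y: "y \<in> carrier K" "y \<noteq> \<zero>\<^bsub>K\<^esub>" "\<chi> y \<noteq> 1"
          by (auto simp: nontrivial_character_def)
        obtain x where x: "x \<in> carrier R" "y = h x" using onto y by blast
        have "x \<noteq> \<zero>\<^bsub>R\<^esub>" using x y by auto
        hence "x \<in> carrier (Multiplicative_Group.mult_of R)" using x by simp
        moreover have "(\<chi> \<circ> h) x \<noteq> 1" using x y by simp
        ultimately show ?thesis unfolding nontrivial_character_def by blast
      qed
      moreover have "box_sum R (\<chi> \<circ> h) w \<alpha> L1 \<beta> L2 = ?S"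
        using w intR by (intro sum.cong refl) (simp add: int)
      ultimately show "(cmod ?S - 4 * real T * real H * real M) ^ (2 * r) * real H ^ 4 \<le>
        2592 * real M ^ 4 * (real L1 * real L2) ^ (2 * r - 2) *
          (real r ^ (2 * r) * real (p ^ 3) / real T ^ r + 2 * real r * sqrt (real (p ^ 3)))"
        using bdp[THEN conjunct2, rule_format, of "\<chi> \<circ> h" w H M L1 L2 T r \<beta> \<alpha>] asm w(1) by simp
    }
  qed
qed

subsection \<open>A type for a hypothetical counterexample\<close>

text \<open>
  A type cannot depend on the prime, so field types cannot represent all fields of order \<open>p\<^sup>3\<close>
  at once. Instead, a single field is chosen that violates the bound if any finite field does, and
  only this field is turned into a type; what holds for that type then holds for all finite fields.
  Up to isomorphism its carrier consists of natural numbers.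
\<close>

definition worst_field :: "nat ring" where
  "worst_field = (SOME K. Ring.field K \<and> finite (carrier K) \<and>
     ((\<exists>R :: nat ring. Ring.field R \<and> finite (carrier R) \<and> \<not> burgess_bound R) \<longrightarrow> \<not> burgess_bound K))"

text \<open>The element type of a field is arbitrary, but a finite carrier embeds into the naturals,
  so one record type contains all candidates.\<close>

lemma nat_field_exists:
  assumes "Ring.field R" "finite (carrier R)"
  obtains f and S :: "nat ring" where "Ring.field S" "finite (carrier S)" "f \<in> ring_iso R S"
proof -
  interpret R: Ring.field R by fact
  obtain f :: "_ \<Rightarrow> nat" where f: "inj_on f (carrier R)"
    using finite_imp_inj_to_nat_seg[OF assms(2)] by blast
  show ?thesis
    by (rule that[OF R.inj_imp_image_ring_is_field[OF f] _ inj_imp_image_ring_iso[OF f]])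
      (simp add: image_ring_carrier assms(2))
qed

lemma worst_field: "Ring.field worst_field" "finite (carrier worst_field)"
  and worst_field_worst: "burgess_bound worst_field \<Longrightarrow> Ring.field R \<Longrightarrow> finite (carrier R) \<Longrightarrow> burgess_bound (R :: nat ring)"
proof -
  have "\<exists>K :: nat ring. Ring.field K \<and> finite (carrier K) \<and>
     ((\<exists>R :: nat ring. Ring.field R \<and> finite (carrier R) \<and> \<not> burgess_bound R) \<longrightarrow> \<not> burgess_bound K)"
  proof (cases "\<exists>R :: nat ring. Ring.field R \<and> finite (carrier R) \<and> \<not> burgess_bound R")
    case False
    \<comment> \<open>Without a counterexample any finite field may be chosen; the field with two
      elements shows that one exists on the naturals.\<close>
    have "Ring.field (ring_of_type_algebra :: gf2 ring)" by (rule field_from_type_algebra)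
    moreover have "finite (carrier (ring_of_type_algebra :: gf2 ring))" by simp
    ultimately obtain f and S :: "nat ring" where "Ring.field S" "finite (carrier S)" "f \<in> ring_iso (ring_of_type_algebra :: gf2 ring) S"
      by (rule nat_field_exists)
    thus ?thesis using False by blast
  qed blast
  from someI_ex[OF this] show "Ring.field worst_field" "finite (carrier worst_field)"
    "burgess_bound worst_field \<Longrightarrow> Ring.field R \<Longrightarrow> finite (carrier R) \<Longrightarrow> burgess_bound (R :: nat ring)"
    unfolding worst_field_def[symmetric] by blast+
qed

lemma worst_field_closed:
  "\<zero>\<^bsub>worst_field\<^esub> \<in> carrier worst_field" "\<one>\<^bsub>worst_field\<^esub> \<in> carrier worst_field"
  "x \<in> carrier worst_field \<Longrightarrow> y \<in> carrier worst_field \<Longrightarrow> x \<oplus>\<^bsub>worst_field\<^esub> y \<in> carrier worst_field"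
  "x \<in> carrier worst_field \<Longrightarrow> \<ominus>\<^bsub>worst_field\<^esub> x \<in> carrier worst_field"
  "x \<in> carrier worst_field \<Longrightarrow> y \<in> carrier worst_field \<Longrightarrow> x \<ominus>\<^bsub>worst_field\<^esub> y \<in> carrier worst_field"
  "x \<in> carrier worst_field \<Longrightarrow> y \<in> carrier worst_field \<Longrightarrow> x \<otimes>\<^bsub>worst_field\<^esub> y \<in> carrier worst_field"
  "x \<in> carrier worst_field \<Longrightarrow>
    (if x = \<zero>\<^bsub>worst_field\<^esub> then \<zero>\<^bsub>worst_field\<^esub> else inv\<^bsub>worst_field\<^esub> x) \<in> carrier worst_field"
proof -
  interpret W: Ring.field worst_field by (rule worst_field)
  show "\<zero>\<^bsub>worst_field\<^esub> \<in> carrier worst_field" "\<one>\<^bsub>worst_field\<^esub> \<in> carrier worst_field"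
    "x \<in> carrier worst_field \<Longrightarrow> y \<in> carrier worst_field \<Longrightarrow> x \<oplus>\<^bsub>worst_field\<^esub> y \<in> carrier worst_field"
    "x \<in> carrier worst_field \<Longrightarrow> \<ominus>\<^bsub>worst_field\<^esub> x \<in> carrier worst_field"
    "x \<in> carrier worst_field \<Longrightarrow> y \<in> carrier worst_field \<Longrightarrow> x \<ominus>\<^bsub>worst_field\<^esub> y \<in> carrier worst_field"
    "x \<in> carrier worst_field \<Longrightarrow> y \<in> carrier worst_field \<Longrightarrow> x \<otimes>\<^bsub>worst_field\<^esub> y \<in> carrier worst_field"
    by simp_all
  show "x \<in> carrier worst_field \<Longrightarrow>
    (if x = \<zero>\<^bsub>worst_field\<^esub> then \<zero>\<^bsub>worst_field\<^esub> else inv\<^bsub>worst_field\<^esub> x) \<in> carrier worst_field"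
    by (auto simp: W.field_Units)
qed

typedef worst = "carrier worst_field"
  using worst_field_closed(1) by blast

setup_lifting type_definition_worst

instantiation worst :: Fields.field
begin

lift_definition zero_worst :: worst is "\<zero>\<^bsub>worst_field\<^esub>" by (rule worst_field_closed)
lift_definition one_worst :: worst is "\<one>\<^bsub>worst_field\<^esub>" by (rule worst_field_closed)
lift_definition plus_worst :: "worst \<Rightarrow> worst \<Rightarrow> worst" is "add worst_field" by (rule worst_field_closed)
lift_definition uminus_worst :: "worst \<Rightarrow> worst" is "a_inv worst_field" by (rule worst_field_closed)
lift_definition minus_worst :: "worst \<Rightarrow> worst \<Rightarrow> worst" is "a_minus worst_field" by (rule worst_field_closed)
lift_definition times_worst :: "worst \<Rightarrow> worst \<Rightarrow> worst" is "monoid.mult worst_field" by (rule worst_field_closed)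
lift_definition inverse_worst :: "worst \<Rightarrow> worst"
  is "\<lambda>x. if x = \<zero>\<^bsub>worst_field\<^esub> then \<zero>\<^bsub>worst_field\<^esub> else inv\<^bsub>worst_field\<^esub> x"
  by (rule worst_field_closed)
definition divide_worst :: "worst \<Rightarrow> worst \<Rightarrow> worst" where "divide_worst x y = x * inverse y"

instance
proof
  interpret W: Ring.field worst_field by (rule worst_field)
  fix a b c :: worst
  show "a + b + c = a + (b + c)" by transfer (rule W.a_assoc)
  show "a + b = b + a" by transfer (rule W.a_comm)
  show "0 + a = a" by transfer simp
  show "- a + a = 0" by transfer (rule W.l_neg)
  show "a - b = a + - b" by transfer (rule W.minus_eq)
  show "a * b * c = a * (b * c)" by transfer (rule W.m_assoc)
  show "a * b = b * a" by transfer (rule W.m_comm)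
  show "1 * a = a" by transfer simp
  show "(a + b) * c = a * c + b * c" by transfer (rule W.l_distr)
  show "(0 :: worst) \<noteq> 1" by transfer simp
  show "a \<noteq> 0 \<Longrightarrow> inverse a * a = 1" by transfer (auto simp: W.field_Units)
  show "a div b = a * inverse b" by (simp add: divide_worst_def)
  show "inverse (0 :: worst) = 0" by transfer simp
qed

end

instance worst :: finite_field
proof
  have "Abs_worst ` carrier worst_field = UNIV"
    by (rule type_definition.Abs_image[OF type_definition_worst])
  thus "finite (UNIV :: worst set)" using finite_imageI[OF worst_field(2), of Abs_worst] by (simp only:)
qed

text \<open>The bound passes from the type \<open>worst\<close> to \<open>worst_field\<close>, by
  its choice to every finite field on the naturals, and then along an isomorphism to
  \<open>K\<close>.\<close>

lemma burgess_bound_finite_field: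
  assumes "Ring.field K" "finite (carrier K)"
  shows "burgess_bound K"
proof -
  have "Rep_worst \<in> ring_iso (ring_of_type_algebra :: worst ring) worst_field"
    by (auto simp: ring_iso_def ring_hom_def ring_of_type_algebra_def times_worst.rep_eq plus_worst.rep_eq
        one_worst.rep_eq bij_betw_def inj_on_def Rep_worst_inject Rep_worst)
      (metis Rep_worst_cases rangeI)
  hence "burgess_bound worst_field"
    by (rule burgess_bound_iso[OF field_from_type_algebra worst_field(1) _ burgess_bound_type])
  moreover obtain f and S :: "nat ring" where S: "Ring.field S" "finite (carrier S)" "f \<in> ring_iso K S"
    by (rule nat_field_exists[OF assms])
  ultimately have "burgess_bound S" using worst_field_worst by blast
  moreover have "inv_into (carrier K) f \<in> ring_iso S K"
    by (rule ring_iso_set_sym[OF _ S(3)]) (simp add: assms(1) field.is_ring Ring.field.axioms cring.axioms domain.axioms)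
  ultimately show ?thesis using burgess_bound_iso[OF S(1) assms(1)] by blast
qed

section \<open>Asymptotics\<close>

text \<open>Blocks of length \<open>L\<close> are split off until at most \<open>2 * L\<close> is
  left, and the rest never falls below \<open>L\<close>. This reaches sides too long for the
  condition \<open>2 * H * M < p\<close>.\<close>

lemma sum_interval_extend:
  fixes f :: "int \<Rightarrow> complex"
  assumes bd: "\<And>\<alpha> n. L \<le> n \<Longrightarrow> n \<le> 2 * L \<Longrightarrow> cmod (\<Sum>x\<in>{\<alpha>..<\<alpha> + int n}. f x) \<le> \<kappa> * real n"
    and L: "L \<ge> 1" "L \<le> n"
  shows "cmod (\<Sum>x\<in>{\<alpha>..<\<alpha> + int n}. f x) \<le> \<kappa> * real n"
  using L(2)
proof (induction n arbitrary: \<alpha> rule: less_induct)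
  case (less n)
  show ?case
  proof (cases "n \<le> 2 * L")
    case False
    have "{\<alpha>..<\<alpha> + int n} = {\<alpha>..<\<alpha> + int L} \<union> {\<alpha> + int L..<(\<alpha> + int L) + int (n - L)}"
      using False by auto
    hence "(\<Sum>x\<in>{\<alpha>..<\<alpha> + int n}. f x) =
        (\<Sum>x\<in>{\<alpha>..<\<alpha> + int L}. f x) + (\<Sum>x\<in>{\<alpha> + int L..<(\<alpha> + int L) + int (n - L)}. f x)"
      by (simp add: sum.union_disjoint)
    also have "cmod \<dots> \<le> \<kappa> * real L + \<kappa> * real (n - L)"
      using False L(1) by (intro norm_triangle_le add_mono bd less.IH) auto
    also have "\<dots> = \<kappa> * real n" using False by (simp add: of_nat_diff algebra_simps)
    finally show ?thesis .
  qed (use bd less.prems in blast)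
qed

lemma sum_box_extend:
  fixes f :: "int \<Rightarrow> int \<Rightarrow> complex"
  assumes bd: "\<And>\<alpha> \<beta> n m. L \<le> n \<Longrightarrow> n \<le> 2 * L \<Longrightarrow> L \<le> m \<Longrightarrow> m \<le> 2 * L \<Longrightarrow>
      cmod (\<Sum>x\<in>{\<alpha>..<\<alpha> + int n}. \<Sum>y\<in>{\<beta>..<\<beta> + int m}. f x y) \<le> \<kappa> * (real n * real m)"
    and L: "L \<ge> 1" "L \<le> n" "L \<le> m"
  shows "cmod (\<Sum>x\<in>{\<alpha>..<\<alpha> + int n}. \<Sum>y\<in>{\<beta>..<\<beta> + int m}. f x y) \<le> \<kappa> * (real n * real m)"
proof -
  have "cmod (\<Sum>x\<in>{\<alpha>..<\<alpha> + int k}. \<Sum>y\<in>{\<beta>..<\<beta> + int m}. f x y) \<le> (\<kappa> * real m) * real k"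
    if k: "L \<le> k" "k \<le> 2 * L" for \<alpha> k
  proof -
    have "cmod (\<Sum>y\<in>{\<beta>..<\<beta> + int m}. \<Sum>x\<in>{\<alpha>..<\<alpha> + int k}. f x y) \<le> (\<kappa> * real k) * real m"
    proof (rule sum_interval_extend[OF _ L(1,3)])
      fix \<beta> j assume "L \<le> j" "j \<le> 2 * L"
      thus "cmod (\<Sum>y\<in>{\<beta>..<\<beta> + int j}. \<Sum>x\<in>{\<alpha>..<\<alpha> + int k}. f x y) \<le> \<kappa> * real k * real j"
        using bd[OF k, of j \<beta> \<alpha>] by (subst sum.swap) (simp add: mult_ac)
    qed
    thus ?thesis by (subst sum.swap) (simp add: mult_ac)
  qed
  hence "cmod (\<Sum>x\<in>{\<alpha>..<\<alpha> + int n}. \<Sum>y\<in>{\<beta>..<\<beta> + int m}. f x y) \<le> (\<kappa> * real m) * real n"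
    by (rule sum_interval_extend[OF _ L(1,2)])
  thus ?thesis by (simp add: mult_ac)
qed

text \<open>More than \<open>p\<close> consecutive integers repeat residues. Cutting the range after
  \<open>p\<close> points keeps the image and makes the map injective, so the length becomes the
  cardinality.\<close>

lemma interval_parametrization:
  assumes eq: "\<And>m n. of_int_in K m = of_int_in K n \<longleftrightarrow> int p dvd m - n" and p: "p > 0"
    and I: "is_interval_in K I"
  obtains \<alpha> where "I = of_int_in K ` {\<alpha>..<\<alpha> + int (card I)}" "inj_on (of_int_in K) {\<alpha>..<\<alpha> + int (card I)}"
proof -
  obtain a b where ab: "I = of_int_in K ` {a..b}" using I by (auto simp: is_interval_in_def)
  define n where "n = min (nat (b - a + 1)) p"
  have inj: "inj_on (of_int_in K) {a..<a + int n}"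
  proof (rule inj_onI)
    fix x y assume xy: "x \<in> {a..<a + int n}" "y \<in> {a..<a + int n}" "of_int_in K x = of_int_in K y"
    have "int p dvd x - y" using xy(3) eq by simp
    moreover have "\<bar>x - y\<bar> < int p" using xy(1,2) by (auto simp: n_def)
    ultimately show "x = y" using dvd_imp_le_int[of "x - y" "int p"] by (cases "x = y") auto
  qed
  have "I = of_int_in K ` {a..<a + int n}"
  proof
    show "of_int_in K ` {a..<a + int n} \<subseteq> I" unfolding ab by (intro image_mono) (auto simp: n_def)
    show "I \<subseteq> of_int_in K ` {a..<a + int n}"
    proof (unfold ab, rule image_subsetI)
      fix x assume x: "x \<in> {a..b}"
      define y where "y = a + (x - a) mod int p"
      have "x - y = (x - a) - (x - a) mod int p" by (simp add: y_def)
      hence "int p dvd x - y" by (simp only: dvd_minus_mod)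
      hence "of_int_in K x = of_int_in K y" using eq by simp
      moreover have "y \<in> {a..<a + int n}"
      proof -
        have "(x - a) mod int p \<le> x - a" using x p by (intro zmod_le_nonneg_dividend) auto
        moreover have "0 \<le> (x - a) mod int p" "(x - a) mod int p < int p" using p by auto
        ultimately show ?thesis using x by (auto simp: y_def n_def)
      qed
      ultimately show "of_int_in K x \<in> of_int_in K ` {a..<a + int n}" by blast
    qed
  qed
  moreover from this have "card I = n" using card_image[OF inj] by simp
  ultimately show ?thesis using inj that[of a] by simp
qed

lemma powr_pow: "x > 0 \<Longrightarrow> (x powr a) ^ n = x powr (real n * a)" for x :: real
  by (metis mult.commute powr_gt_zero powr_powr powr_realpow)

text \<open>The balance of exponents. \<open>r * \<tau> \<ge> 2\<close> reduces
  \<open>P ^ 3 / T ^ r\<close> to order \<open>P\<close>, so the Weil term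
  \<open>P powr (3 / 2)\<close> dominates. Taking \<open>H\<close> smaller than \<open>L\<close>
  costs \<open>P powr (8 * \<tau>) = P powr (2 * \<epsilon>)\<close>, while \<open>l ^ 2\<close> is
  at least \<open>P powr (3 / 2 + 4 * \<epsilon>)\<close>. Of the surplus
  \<open>P powr (2 * \<epsilon>)\<close>, one half absorbs \<open>4 ^ r * C\<close> and the other is
  the saving.\<close>

lemma amplified_bound_small:
  fixes P D L l T H \<tau> \<epsilon> :: real and r :: nat
  defines "C \<equiv> 2592 * 256 * (real r ^ (2 * r) * 2 ^ r + 2 * real r)"
  assumes P: "P > 1" and r: "r > 0" "real r * \<tau> \<ge> 2" and \<tau>: "8 * \<tau> = 2 * \<epsilon>"
    and D: "D \<ge> 0" "D ^ (2 * r) * H ^ 4 \<le> 2592 * (2 * L) ^ 4 * l ^ (2 * r - 2) * (real r ^ (2 * r) * P ^ 3 / T ^ r + 2 * real r * sqrt (P ^ 3))"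
    and T: "T \<ge> P powr \<tau> / 2" and H: "H \<ge> L * P powr (- (2 * \<tau>)) / 2"
    and L: "L \<ge> P powr (3 / 8 + \<epsilon>)" and l: "l \<ge> L * L"
    and big: "P powr \<epsilon> > 4 ^ r * C"
  shows "D \<le> l * P powr (- (\<epsilon> / (2 * real r))) / 2"
proof -
  have P0: "P > 0" using P by simp
  have L0: "L > 0" using L P0 by (smt (verit) powr_gt_zero)
  have l0: "l > 0" using l L0 by (smt (verit) mult_pos_pos)
  define C1 where "C1 = real r ^ (2 * r) * 2 ^ r + 2 * real r"
  have C1: "C1 > 0" using r by (simp add: C1_def add_pos_pos)
  have Y: "real r ^ (2 * r) * P ^ 3 / T ^ r + 2 * real r * sqrt (P ^ 3) \<le> C1 * P powr (3 / 2)"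
  proof -
    have sq: "sqrt (P ^ 3) = P powr (3 / 2)"
    proof -
      have "(P powr (3 / 2)) ^ 2 = P ^ 3" using P0 powr_realpow[OF P0, of 3] by (simp add: powr_pow)
      thus ?thesis by (intro real_sqrt_unique) auto
    qed
    have "P ^ 2 / 2 ^ r \<le> (P powr \<tau> / 2) ^ r"
    proof -
      have "P ^ 2 = P powr 2" using powr_realpow[OF P0, of 2] by simp
      also have "\<dots> \<le> P powr (real r * \<tau>)" using r P by (intro powr_mono) auto
      also have "\<dots> = (P powr \<tau>) ^ r" using P0 by (simp add: powr_pow)
      finally show ?thesis by (simp add: power_divide divide_right_mono)
    qed
    also have "\<dots> \<le> T ^ r" using T P0 by (intro power_mono) auto
    finally have Tr: "P ^ 2 / 2 ^ r \<le> T ^ r" .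
    have "P ^ 3 / T ^ r \<le> P ^ 3 / (P ^ 2 / 2 ^ r)"
      using Tr P0 by (intro divide_left_mono mult_pos_pos) (auto intro: less_le_trans[OF _ Tr])
    also have "\<dots> = 2 ^ r * P" using P0 by (simp add: power2_eq_square power3_eq_cube)
    also have "P \<le> P powr (3 / 2)" using powr_mono[of 1 "3 / 2" P] P by simp
    finally have "P ^ 3 / T ^ r \<le> 2 ^ r * P powr (3 / 2)" by simp
    hence "real r ^ (2 * r) * (P ^ 3 / T ^ r) \<le> real r ^ (2 * r) * (2 ^ r * P powr (3 / 2))"
      by (intro mult_left_mono) auto
    thus ?thesis unfolding sq C1_def by (simp add: algebra_simps)
  qed
  have H4: "L ^ 4 * P powr (- (8 * \<tau>)) / 16 \<le> H ^ 4"
  proof -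
    have "(P powr (- (2 * \<tau>))) ^ 4 = P powr (- (8 * \<tau>))" using P0 by (simp add: powr_pow)
    hence "L ^ 4 * P powr (- (8 * \<tau>)) / 16 = (L * P powr (- (2 * \<tau>)) / 2) ^ 4"
      by (simp add: power_divide power_mult_distrib)
    also have "\<dots> \<le> H ^ 4" using H L0 P0 by (intro power_mono) auto
    finally show ?thesis .
  qed
  define k where "k = 2 * r - 2"
  have rk: "2 * r = k + 2" using r by (simp add: k_def)
  have "D ^ (2 * r) * (L ^ 4 * P powr (- (8 * \<tau>)) / 16) \<le> D ^ (2 * r) * H ^ 4"
    using H4 D(1) by (intro mult_left_mono) auto
  also have "\<dots> \<le> 2592 * (2 * L) ^ 4 * l ^ k * (C1 * P powr (3 / 2))"
    by (rule order_trans[OF D(2)]) (use Y L0 l0 in \<open>auto simp: k_def intro!: mult_left_mono\<close>)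
  finally have "L ^ 4 * (D ^ (2 * r) * P powr (- (8 * \<tau>))) \<le> L ^ 4 * (C * l ^ k * P powr (3 / 2))"
    by (simp add: C_def C1_def power_mult_distrib field_simps)
  hence "D ^ (2 * r) * P powr (- (8 * \<tau>)) \<le> C * l ^ k * P powr (3 / 2)" using L0 by simp
  hence "D ^ (2 * r) * P powr (- (8 * \<tau>)) * P powr (8 * \<tau>) \<le> C * l ^ k * P powr (3 / 2) * P powr (8 * \<tau>)"
    by (intro mult_right_mono) auto
  hence D1: "D ^ (2 * r) \<le> C * l ^ k * P powr (3 / 2 + 2 * \<epsilon>)"
    using P0 by (simp add: mult.assoc \<tau> flip: powr_add)
  have l2: "P powr (3 / 2 + 4 * \<epsilon>) \<le> l ^ 2"
  proof -
    have "P powr (3 / 2 + 4 * \<epsilon>) = (P powr (3 / 8 + \<epsilon>)) ^ 4" using P0 by (simp add: powr_pow algebra_simps)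
    also have "\<dots> \<le> L ^ 4" using L P0 by (intro power_mono) auto
    also have "\<dots> = (L * L) ^ 2" by (simp add: power2_eq_square power4_eq_xxxx)
    also have "\<dots> \<le> l ^ 2" using l L0 by (intro power_mono) auto
    finally show ?thesis .
  qed
  have C0: "C > 0" using C1 by (simp add: C_def C1_def)
  have "D ^ (2 * r) \<le> C * l ^ k * (P powr (3 / 2 + 4 * \<epsilon>) * P powr (- (2 * \<epsilon>)))"
  proof -
    have "P powr (3 / 2 + 4 * \<epsilon>) * P powr (- (2 * \<epsilon>)) = P powr (3 / 2 + 2 * \<epsilon>)"
      unfolding powr_add[symmetric] by (rule arg_cong[of _ _ "(powr) P"]) simp
    thus ?thesis using D1 by (simp only:)
  qed
  also have "\<dots> \<le> C * l ^ k * (l ^ 2 * P powr (- (2 * \<epsilon>)))"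
    using l2 C0 l0 by (intro mult_left_mono mult_right_mono) auto
  also have "\<dots> = l ^ (2 * r) * (C * P powr (- (2 * \<epsilon>)))" unfolding rk power_add by (simp only: mult_ac)
  also have "C * P powr (- (2 * \<epsilon>)) \<le> P powr (- \<epsilon>) / 4 ^ r"
  proof -
    have "4 ^ r * C * P powr (- (2 * \<epsilon>)) \<le> P powr \<epsilon> * P powr (- (2 * \<epsilon>))"
      using big by (intro mult_right_mono) auto
    also have "\<dots> = P powr (- \<epsilon>)" using P0 by (simp flip: powr_add)
    finally show ?thesis by (simp add: field_simps)
  qed
  also have "l ^ (2 * r) * (P powr (- \<epsilon>) / 4 ^ r) = (l * P powr (- (\<epsilon> / (2 * real r))) / 2) ^ (2 * r)"
  proof -
    have "(P powr (- (\<epsilon> / (2 * real r)))) ^ (2 * r) = P powr (- \<epsilon>)"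
      using P0 r by (simp add: powr_pow)
    moreover have "(2 :: real) ^ (2 * r) = 4 ^ r" by (simp add: power_mult)
    ultimately show ?thesis by (simp add: power_divide power_mult_distrib)
  qed
  finally have "D ^ (2 * r) \<le> (l * P powr (- (\<epsilon> / (2 * real r))) / 2) ^ (2 * r)"
    using l0 by simp
  thus ?thesis using l0 r by (subst (asm) power_mono_iff) (use D in auto)
qed

lemma eventually_powr_gt:
  fixes c K :: real
  assumes "c > 0"
  shows "eventually (\<lambda>p :: nat. real p powr c > K) sequentially"
proof -
  have "filterlim (\<lambda>p :: nat. real p powr c) at_top sequentially"
    using assms by real_asymp
  thus ?thesis by (simp add: filterlim_at_top_dense)
qed

text \<open>The type tokens fix the record type of \<open>K\<close>, which the other arguments do
  not determine.\<close>

definition piece_bound :: "'a itself \<Rightarrow> 'b itself \<Rightarrow> real \<Rightarrow> real \<Rightarrow> real \<Rightarrow> nat \<Rightarrow> bool" where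
  "piece_bound TA TB \<epsilon> \<tau> \<delta> p \<longleftrightarrow>
      (\<forall>(K :: ('a, 'b) ring_scheme) \<omega> \<chi> \<alpha> \<beta> L1 L2.
        Ring.field K \<and> card (carrier K) = p ^ 3 \<and> \<omega> \<in> carrier K - prime_subfield K \<and>
        mult_character K \<chi> \<and> nontrivial_character K \<chi> \<and>
        nat \<lceil>real p powr (3 / 8 + \<epsilon>)\<rceil> \<le> L1 \<and> L1 \<le> 2 * nat \<lceil>real p powr (3 / 8 + \<epsilon>)\<rceil> \<and>
        nat \<lceil>real p powr (3 / 8 + \<epsilon>)\<rceil> \<le> L2 \<and> L2 \<le> 2 * nat \<lceil>real p powr (3 / 8 + \<epsilon>)\<rceil> \<longrightarrow>
        cmod (box_sum K \<chi> \<omega> \<alpha> L1 \<beta> L2)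
          \<le> (8 * real p powr (- \<tau>) + real p powr (- \<delta>) / 2) * (real L1 * real L2))"

lemma burgess_piece:
  fixes \<epsilon> :: real
  assumes \<epsilon>: "0 < \<epsilon>" "\<epsilon> \<le> 1 / 16"
  obtains \<delta> \<tau> where "\<delta> > 0" "\<tau> \<ge> 2 * \<delta>"
    "eventually (\<lambda>p. prime p \<longrightarrow> piece_bound TYPE('a) TYPE('b) \<epsilon> \<tau> \<delta> p) sequentially"
proof -
  \<comment> \<open>\<open>8 * \<tau> = 2 * \<epsilon>\<close> is what
    \<open>amplified_bound_small\<close> asks for. Taking \<open>r \<ge> 4 / \<tau>\<close> gives
    both \<open>r * \<tau> \<ge> 2\<close> and \<open>r \<ge> 4\<close>, hence
    \<open>\<delta> \<le> \<epsilon> / 8 = \<tau> / 2\<close>.\<close>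
  define \<tau> where "\<tau> = \<epsilon> / 4"
  define r where "r = nat \<lceil>4 / \<tau>\<rceil>"
  define \<delta> where "\<delta> = \<epsilon> / (2 * real r)"
  define C where "C = 2592 * 256 * (real r ^ (2 * r) * 2 ^ r + 2 * real r)"
  have \<tau>0: "\<tau> > 0" "\<tau> \<le> 1 / 64" using \<epsilon> by (auto simp: \<tau>_def)
  have r4: "real r \<ge> 4 / \<tau>" unfolding r_def by linarith
  have r\<tau>: "real r * \<tau> \<ge> 2" using r4 \<tau>0 by (simp add: field_simps)
  have "4 / \<tau> \<ge> 4" using \<tau>0 by (simp add: field_simps)
  hence rbig: "real r \<ge> 4" using r4 by linarith
  have r0: "r > 0" using rbig by (cases r) auto
  have \<delta>0: "\<delta> > 0" using \<epsilon> r0 by (simp add: \<delta>_def)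
  have \<delta>\<tau>: "\<tau> \<ge> 2 * \<delta>"
  proof -
    have "\<epsilon> / (2 * real r) \<le> \<epsilon> / 8" using rbig \<epsilon> by (intro divide_left_mono) auto
    thus ?thesis by (simp add: \<delta>_def \<tau>_def mult.commute)
  qed
  have "eventually (\<lambda>p. real p powr \<tau> > 2) sequentially" "eventually (\<lambda>p. real p powr (3 / 8) > 2) sequentially"
    "eventually (\<lambda>p. real p powr \<epsilon> > 4 ^ r * C) sequentially" "eventually (\<lambda>p. real p powr (1 / 8) > 16) sequentially"
    "eventually (\<lambda>p :: nat. p \<ge> 2) sequentially"
    using \<epsilon> \<tau>0 by (auto intro!: eventually_powr_gt eventually_ge_at_top)
  hence "eventually (\<lambda>p. prime p \<longrightarrow> piece_bound TYPE('a) TYPE('b) \<epsilon> \<tau> \<delta> p) sequentially"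
  proof eventually_elim
    case (elim p)
    define P where "P = real p"
    define L where "L = nat \<lceil>P powr (3 / 8 + \<epsilon>)\<rceil>"
    define T where "T = nat \<lfloor>P powr \<tau>\<rfloor>"
    \<comment> \<open>\<open>T * H\<close> is at most \<open>L * P powr (- \<tau>)\<close>, so the
      shifts move the box by a negligible part of its side.\<close>
    define H where "H = nat \<lfloor>real L * P powr (- (2 * \<tau>))\<rfloor>"
    have P1: "P > 1" and P0: "P > 0" using elim by (auto simp: P_def)
    have Lge: "real L \<ge> P powr (3 / 8 + \<epsilon>)" unfolding L_def by linarith
    have "real L \<le> P powr (3 / 8 + \<epsilon>) + 1"
      unfolding L_def using powr_ge_zero[of P "3 / 8 + \<epsilon>"] by linarith
    also have "P powr (3 / 8 + \<epsilon>) \<le> P powr (7 / 16)" using \<epsilon> P1 by (intro powr_mono) auto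
    also have "1 \<le> P powr (7 / 16)" using P1 by (intro ge_one_powr_ge_zero) auto
    finally have Lle: "real L \<le> 2 * P powr (7 / 16)" by simp
    have Tle: "real T \<le> P powr \<tau>" unfolding T_def using powr_ge_zero[of P \<tau>] by linarith
    have Tge: "real T \<ge> P powr \<tau> / 2"
    proof -
      have "real T > P powr \<tau> - 1" unfolding T_def using powr_ge_zero[of P \<tau>] by linarith
      thus ?thesis using elim(1) by (simp add: P_def)
    qed
    have Hx: "real L * P powr (- (2 * \<tau>)) \<ge> 2"
    proof -
      have "2 < P powr (3 / 8)" using elim(2) by (simp add: P_def)
      also have "\<dots> \<le> P powr (3 / 8 + \<epsilon> + - (2 * \<tau>))" using P1 \<epsilon> by (intro powr_mono) (auto simp: \<tau>_def)
      also have "\<dots> = P powr (3 / 8 + \<epsilon>) * P powr (- (2 * \<tau>))" by (rule powr_add)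
      also have "\<dots> \<le> real L * P powr (- (2 * \<tau>))" using Lge by (intro mult_right_mono) auto
      finally show ?thesis by simp
    qed
    have Hle: "real H \<le> real L * P powr (- (2 * \<tau>))" unfolding H_def using Hx by linarith
    have Hge: "real H \<ge> real L * P powr (- (2 * \<tau>)) / 2" unfolding H_def using Hx by linarith
    have H1: "1 \<le> H"
    proof -
      have "real H \<ge> 1" using Hge Hx by linarith
      thus ?thesis by simp
    qed
    have HL: "real H \<le> real L"
    proof -
      have "P powr (- (2 * \<tau>)) \<le> P powr 0" using P1 \<tau>0 by (intro powr_mono) auto
      hence "real L * P powr (- (2 * \<tau>)) \<le> real L * 1" using P0 by (intro mult_left_mono) auto
      thus ?thesis using Hle by simp
    qed
    \<comment> \<open>Here \<open>\<epsilon> \<le> 1 / 16\<close> enters through \<open>Lle\<close>: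
      \<open>L * L\<close> is at most \<open>4 * P powr (7 / 8)\<close>, which leaves a power of
      \<open>p\<close> to absorb the constants.\<close>
    have HM: "2 * H * (2 * L) < p"
    proof -
      have "real (2 * H * (2 * L)) \<le> 4 * (real L * real L)" using HL by (simp add: mult_right_mono)
      also have "\<dots> \<le> 4 * ((2 * P powr (7 / 16)) * (2 * P powr (7 / 16)))"
        using Lle by (intro mult_left_mono mult_mono) auto
      also have "\<dots> = 16 * P powr (7 / 8)" by (simp flip: powr_add)
      also have "\<dots> < P powr (1 / 8) * P powr (7 / 8)" using elim(4) P0 by (intro mult_strict_right_mono) (auto simp: P_def)
      also have "\<dots> = real p" using P0 by (simp add: P_def flip: powr_add)
      finally show ?thesis by (simp only: of_nat_less_iff)
    qed
    have T1: "1 \<le> T"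
    proof -
      have "real T \<ge> 1" using Tge elim(1) by (simp add: P_def)
      thus ?thesis by simp
    qed
    have Tp: "T < p"
    proof -
      have "P powr \<tau> < P powr 1" using P1 \<tau>0 by (intro powr_less_mono) auto
      thus ?thesis using Tle P0 by (simp add: P_def)
    qed
    show ?case
      unfolding piece_bound_def
    proof (intro impI allI)
      fix K :: "('a, 'b) ring_scheme" and \<omega> \<chi> \<alpha> \<beta> L1 L2
      assume p: "prime p" and asm: "Ring.field K \<and> card (carrier K) = p ^ 3 \<and> \<omega> \<in> carrier K - prime_subfield K \<and>
        mult_character K \<chi> \<and> nontrivial_character K \<chi> \<and>
        nat \<lceil>real p powr (3 / 8 + \<epsilon>)\<rceil> \<le> L1 \<and> L1 \<le> 2 * nat \<lceil>real p powr (3 / 8 + \<epsilon>)\<rceil> \<and>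
        nat \<lceil>real p powr (3 / 8 + \<epsilon>)\<rceil> \<le> L2 \<and> L2 \<le> 2 * nat \<lceil>real p powr (3 / 8 + \<epsilon>)\<rceil>"
      have L12: "L \<le> L1" "L1 \<le> 2 * L" "L \<le> L2" "L2 \<le> 2 * L" using asm by (auto simp: L_def P_def)
      define S where "S = (box_sum K \<chi> \<omega> \<alpha> L1 \<beta> L2)"
      define E where "E = 4 * real T * real H * real (2 * L)"
      have "card (carrier K) > 0" using asm p by (simp add: prime_gt_0_nat)
      hence "burgess_bound K" using asm burgess_bound_finite_field card_ge_0_finite by blast
      note bd = this[unfolded burgess_bound_def, rule_format, of p, THEN conjunct2, rule_format]
      have LL: "real L * real L \<le> real L1 * real L2" using L12 by (intro mult_mono) auto
      have E: "E \<le> 8 * P powr (- \<tau>) * (real L1 * real L2)"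
      proof -
        have "E \<le> 8 * ((P powr \<tau> * (real L * P powr (- (2 * \<tau>)))) * real L)"
        proof -
          have "real T * real H * real L \<le> (P powr \<tau> * (real L * P powr (- (2 * \<tau>)))) * real L"
            using Tle Hle by (intro mult_right_mono mult_mono) auto
          thus ?thesis by (simp add: E_def)
        qed
        also have "\<dots> = 8 * (P powr (\<tau> + - (2 * \<tau>)) * (real L * real L))" unfolding powr_add by (simp only: mult_ac)
        also have "\<dots> = 8 * P powr (- \<tau>) * (real L * real L)" by simp
        also have "\<dots> \<le> 8 * P powr (- \<tau>) * (real L1 * real L2)" using LL by (intro mult_left_mono) auto
        finally show ?thesis .
      qed
      have D: "cmod S - E \<le> real L1 * real L2 * P powr (- \<delta>) / 2"
      proof (cases "E \<le> cmod S")
        case True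
        have "(cmod S - E) ^ (2 * r) * real H ^ 4 \<le> 2592 * real (2 * L) ^ 4 * (real L1 * real L2) ^ (2 * r - 2) *
            (real r ^ (2 * r) * real (p ^ 3) / real T ^ r + 2 * real r * sqrt (real (p ^ 3)))"
          unfolding S_def E_def
          by (rule bd) (use p asm H1 HL HM L12 T1 Tp r0 True in \<open>auto simp: S_def E_def\<close>)
        hence "(cmod S - E) ^ (2 * r) * real H ^ 4 \<le> 2592 * (2 * real L) ^ 4 * (real L1 * real L2) ^ (2 * r - 2) *
            (real r ^ (2 * r) * P ^ 3 / real T ^ r + 2 * real r * sqrt (P ^ 3))"
          by (simp add: P_def)
        thus ?thesis unfolding \<delta>_def
          using P1 r0 r\<tau> Tge Hge Lge LL True elim(3)
          by (intro amplified_bound_small[where \<tau> = \<tau> and T = "real T" and H = "real H" and L = "real L"])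
            (auto simp: \<tau>_def C_def P_def)
      next
        case False
        moreover have "0 \<le> real L1 * real L2 * P powr (- \<delta>) / 2" by simp
        ultimately show ?thesis by linarith
      qed
      have "cmod S \<le> 8 * P powr (- \<tau>) * (real L1 * real L2) + real L1 * real L2 * P powr (- \<delta>) / 2"
        using E D by linarith
      also have "\<dots> = (8 * P powr (- \<tau>) + P powr (- \<delta>) / 2) * (real L1 * real L2)" by (simp add: algebra_simps)
      finally show "cmod (box_sum K \<chi> \<omega> \<alpha> L1 \<beta> L2)
          \<le> (8 * real p powr (- \<tau>) + real p powr (- \<delta>) / 2) * (real L1 * real L2)"
        by (simp add: S_def P_def)
    qed
  qed
  thus ?thesis using that \<delta>0 \<delta>\<tau> by blast
qed

theorem theorem1:
  fixes \<epsilon> :: real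
  assumes "\<epsilon> > 0"
  shows "\<exists>\<delta>::real. \<delta> > 0 \<and>
    (\<exists>p0::nat. \<forall>p::nat. p \<ge> p0 \<longrightarrow> Factorial_Ring.prime p \<longrightarrow>
      (\<forall>(K :: ('a, 'b) ring_scheme) (\<omega> :: 'a) (I :: 'a set) (J :: 'a set) (\<chi> :: 'a \<Rightarrow> complex).
        Ring.field K \<and> card (carrier K) = p ^ 3 \<and>
        \<omega> \<in> carrier K - prime_subfield K \<and>
        is_interval_in K I \<and> real (card I) \<ge> real p powr (3 / 8 + \<epsilon>) \<and>
        is_interval_in K J \<and> real (card J) \<ge> real p powr (3 / 8 + \<epsilon>) \<and>
        mult_character K \<chi> \<and> nontrivial_character K \<chi> \<longrightarrow>
        cmod (\<Sum>x\<in>I. \<Sum>y\<in>J. \<chi> (x \<oplus>\<^bsub>K\<^esub> \<omega> \<otimes>\<^bsub>K\<^esub> y))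
          < real p powr (- \<delta>) * real (card I) * real (card J)))"
    (is "\<exists>\<delta>. _ \<and> (\<exists>p0. \<forall>p. _ \<longrightarrow> _ \<longrightarrow> ?P \<delta> p)")
proof -
  \<comment> \<open>The cap only lowers the threshold \<open>L\<close>, so intervals of the given
    length still reach it; \<open>sum_box_extend\<close> covers sides beyond
    \<open>2 * L\<close>.\<close>
  define \<eta> where "\<eta> = min \<epsilon> (1 / 16)"
  have \<eta>: "0 < \<eta>" "\<eta> \<le> 1 / 16" "\<eta> \<le> \<epsilon>" using assms by (auto simp: \<eta>_def)
  obtain \<delta> \<tau> where \<delta>: "\<delta> > 0" "\<tau> \<ge> 2 * \<delta>" and ev:
    "eventually (\<lambda>p. prime p \<longrightarrow> piece_bound TYPE('a) TYPE('b) \<eta> \<tau> \<delta> p) sequentially"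
    by (rule burgess_piece[OF \<eta>(1,2)])
  \<comment> \<open>\<open>16\<close> is what pushes \<open>8 * p powr (- (2 * \<delta>))\<close>
    below half of \<open>p powr (- \<delta>)\<close>, so that the final inequality is
    strict.\<close>
  have "eventually (\<lambda>p. real p powr \<delta> > 16) sequentially" using \<delta> by (rule_tac eventually_powr_gt)
  with ev have "eventually (\<lambda>p. prime p \<longrightarrow> ?P \<delta> p) sequentially"
  proof eventually_elim
    case (elim p)
    show ?case
    proof (intro impI allI)
      fix K :: "('a, 'b) ring_scheme" and \<omega> I J and \<chi> :: "'a \<Rightarrow> complex"
      assume p: "prime p" and asm: "Ring.field K \<and> card (carrier K) = p ^ 3 \<and>
        \<omega> \<in> carrier K - prime_subfield K \<and>
        is_interval_in K I \<and> real (card I) \<ge> real p powr (3 / 8 + \<epsilon>) \<and>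
        is_interval_in K J \<and> real (card J) \<ge> real p powr (3 / 8 + \<epsilon>) \<and>
        mult_character K \<chi> \<and> nontrivial_character K \<chi>"
      define L where "L = nat \<lceil>real p powr (3 / 8 + \<eta>)\<rceil>"
      define \<kappa> where "\<kappa> = 8 * real p powr (- \<tau>) + real p powr (- \<delta>) / 2"
      have p1: "real p > 1" using p prime_gt_1_nat by simp
      have pw: "real p powr (3 / 8 + \<eta>) \<le> real p powr (3 / 8 + \<epsilon>)" using \<eta> p1 by (intro powr_mono) auto
      have LI: "L \<le> card I" "L \<le> card J" using pw asm unfolding L_def by (simp_all add: nat_le_iff ceiling_le_iff)
      have L1: "L \<ge> 1"
      proof -
        have "real p powr (3 / 8 + \<eta>) > 0" using p1 by simp
        thus ?thesis unfolding L_def by linarith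
      qed
      have "card (carrier K) > 0" using asm p by (simp add: prime_gt_0_nat)
      hence "burgess_bound K" using asm burgess_bound_finite_field card_ge_0_finite by blast
      hence eq: "of_int_in K m = of_int_in K n \<longleftrightarrow> int p dvd m - n" for m n
        using p asm unfolding burgess_bound_def by blast
      obtain \<alpha> where \<alpha>: "I = of_int_in K ` {\<alpha>..<\<alpha> + int (card I)}" "inj_on (of_int_in K) {\<alpha>..<\<alpha> + int (card I)}"
        using interval_parametrization[OF eq, of I] p asm prime_gt_0_nat by blast
      obtain \<beta> where \<beta>: "J = of_int_in K ` {\<beta>..<\<beta> + int (card J)}" "inj_on (of_int_in K) {\<beta>..<\<beta> + int (card J)}"
        using interval_parametrization[OF eq, of J] p asm prime_gt_0_nat by blast
      have J: "(\<Sum>y\<in>J. g y) = (\<Sum>y\<in>{\<beta>..<\<beta> + int (card J)}. g (of_int_in K y))" for g :: "'a \<Rightarrow> complex"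
        by (subst \<beta>(1)) (simp add: sum.reindex[OF \<beta>(2)])
      have I: "(\<Sum>x\<in>I. g x) = (\<Sum>x\<in>{\<alpha>..<\<alpha> + int (card I)}. g (of_int_in K x))" for g :: "'a \<Rightarrow> complex"
        by (subst \<alpha>(1)) (simp add: sum.reindex[OF \<alpha>(2)])
      have "cmod (box_sum K \<chi> \<omega> \<alpha> (card I) \<beta> (card J))
          \<le> \<kappa> * (real (card I) * real (card J))"
      proof (rule sum_box_extend[OF _ L1 LI])
        fix \<alpha> \<beta> n m assume "L \<le> n" "n \<le> 2 * L" "L \<le> m" "m \<le> 2 * L"
        thus "cmod (box_sum K \<chi> \<omega> \<alpha> n \<beta> m)
            \<le> \<kappa> * (real n * real m)"
          using elim(1) p asm unfolding L_def \<kappa>_def piece_bound_def by blast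
      qed
      also have "\<dots> < real p powr (- \<delta>) * (real (card I) * real (card J))"
      proof (rule mult_strict_right_mono)
        have "8 * real p powr (- \<tau>) \<le> 8 * real p powr (- \<delta> + - \<delta>)"
          using \<delta> p1 by (intro mult_left_mono powr_mono) auto
        also have "\<dots> = 8 * real p powr (- \<delta>) * real p powr (- \<delta>)" unfolding powr_add by simp
        also have "\<dots> < (1 / 2) * real p powr (- \<delta>)"
        proof (rule mult_strict_right_mono)
          show "8 * real p powr (- \<delta>) < 1 / 2" using elim(2) p1 by (simp add: powr_minus field_simps)
        qed (use p1 in auto)
        finally show "\<kappa> < real p powr (- \<delta>)" by (simp add: \<kappa>_def)
        show "0 < real (card I) * real (card J)" using L1 LI by simp
      qed
      finally show "cmod (\<Sum>x\<in>I. \<Sum>y\<in>J. \<chi> (x \<oplus>\<^bsub>K\<^esub> \<omega> \<otimes>\<^bsub>K\<^esub> y))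
          < real p powr (- \<delta>) * real (card I) * real (card J)"
        unfolding I J by (simp add: mult.assoc)
    qed
  qed
  then obtain p0 where "\<forall>p\<ge>p0. prime p \<longrightarrow> ?P \<delta> p"
    unfolding eventually_sequentially by blast
  thus ?thesis using \<delta>(1) by blast
qed

end
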